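(* Let $R$ be a 2-Henselian discrete valuation ring with residue field $F$ and quotient field $K$, both of characteristic not $2$, and let $n\geq 3$ be an integer. If $F$ has property $\mathsf{Sim}(n-1)$ and property $\mathsf{Sim}(n)$, then $K$ has property $\mathsf{Sim}(n)$.
   Context: All fields have characteristic not $2$. A quadratic form (or form) is a nondegenerate quadratic form of finite dimension. For a field $E$, $\mathsf{W}(E)$ is the Witt ring, $[\varphi]$ is the Witt class of a form $\varphi$, and $\mathsf{I}^m(E)$ is the $m$-th power of the fundamental ideal $\mathsf{I}(E)$ (classes of even-dimensional forms). Two forms $\varphi,\psi$ over $E$ are similar if $\psi\cong c\varphi$ for some $c\in E^\ast$. For an integer $m\geq 2$, a field $E$ has property $\mathsf{Sim}(m)$ if any two non-zero anisotropic forms $\varphi,\psi$ over $E$ of dimension at most $2^m+2^{m-1}$ with $[\varphi],[\psi]\in\mathsf{I}^m(E)$ and $[\varphi]\equiv[\psi]\pmod{\mathsf{I}^{m+1}(E)}$ are similar. A discrete valuation ring $R$ with residue field $F$ and residue map $x\mapsto\overline{x}$ is called 2-Henselian if every $x\in R^\ast$ for which $\overline{x}$ is a square in $F$ is a square in $R$. *)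

theory Defs
  imports "Jordan_Normal_Form.Determinant" "HOL-Algebra.Ideal_Product"
begin

section \<open>Quadratic forms\<close>

text \<open>
  Over a field of characteristic different from 2 (a standing assumption, made
  explicit where the definitions are used), a quadratic form of dimension \<open>n\<close> is
  the map \<open>v \<mapsto> v\<^sup>T A v\<close> of a unique symmetric \<open>n \<times> n\<close> matrix \<open>A\<close>, and it is
  nondegenerate iff \<open>A\<close> is invertible. Forms are encoded by these matrices.
  The form of dimension 0 is included.
\<close>

definition is_qform :: "'a::field mat \<Rightarrow> bool" where
  "is_qform A \<longleftrightarrow> square_mat A \<and> A\<^sup>T = A \<and> det A \<noteq> 0"

definition qf_dim :: "'a mat \<Rightarrow> nat" where
  "qf_dim A = dim_row A"

definition qf_value :: "'a::field mat \<Rightarrow> 'a vec \<Rightarrow> 'a" where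
  "qf_value A v = v \<bullet> (A *\<^sub>v v)"

definition anisotropic :: "'a::field mat \<Rightarrow> bool" where
  "anisotropic A \<longleftrightarrow>
     (\<forall>v \<in> carrier_vec (qf_dim A). qf_value A v = 0 \<longrightarrow> v = 0\<^sub>v (qf_dim A))"

definition qf_isometric :: "'a::field mat \<Rightarrow> 'a mat \<Rightarrow> bool" where
  "qf_isometric A B \<longleftrightarrow>
     (\<exists>P \<in> carrier_mat (qf_dim A) (qf_dim A). invertible_mat P \<and> B = P\<^sup>T * A * P)"

definition qf_similar :: "'a::field mat \<Rightarrow> 'a mat \<Rightarrow> bool" where
  "qf_similar A B \<longleftrightarrow> (\<exists>c. c \<noteq> 0 \<and> qf_isometric B (c \<cdot>\<^sub>m A))"

definition orth_sum :: "'a::field mat \<Rightarrow> 'a mat \<Rightarrow> 'a mat" where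
  "orth_sum A B =
     four_block_mat A (0\<^sub>m (dim_row A) (dim_col B)) (0\<^sub>m (dim_row B) (dim_col A)) B"

text \<open>The Kronecker product, i.e. the Gram matrix of the tensor product of two forms.\<close>

definition qf_tensor :: "'a::field mat \<Rightarrow> 'a mat \<Rightarrow> 'a mat" where
  "qf_tensor A B =
     mat (dim_row A * dim_row B) (dim_col A * dim_col B)
       (\<lambda>(i, j). A $$ (i div dim_row B, j div dim_col B) * B $$ (i mod dim_row B, j mod dim_col B))"

definition hyperbolic_plane :: "'a::field mat" where
  "hyperbolic_plane = mat_of_rows_list 2 [[0, 1], [1, 0]]"

definition hyperbolic :: "nat \<Rightarrow> 'a::field mat" where
  "hyperbolic k = diag_block_mat (replicate k hyperbolic_plane)"

section \<open>The Witt ring\<close>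

definition witt_equiv :: "'a::field mat \<Rightarrow> 'a mat \<Rightarrow> bool" where
  "witt_equiv A B \<longleftrightarrow>
     (\<exists>k l. qf_isometric (orth_sum A (hyperbolic k)) (orth_sum B (hyperbolic l)))"

definition witt_class :: "'a::field mat \<Rightarrow> 'a mat set" where
  "witt_class A = {B. is_qform B \<and> witt_equiv A B}"

text \<open>
  Sum and product of Witt classes are induced by orthogonal sum and tensor product
  of representatives. As for sums of cosets, the union over all representatives is
  taken; all the classes in that union coincide.
\<close>

definition witt_ring :: "'a::field mat set ring" where
  "witt_ring =
     \<lparr> carrier = {witt_class A | A. is_qform A},
       mult = (\<lambda>X Y. \<Union>A\<in>X. \<Union>B\<in>Y. witt_class (qf_tensor A B)),
       one = witt_class (1\<^sub>m 1),
       zero = witt_class (0\<^sub>m 0 0),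
       add = (\<lambda>X Y. \<Union>A\<in>X. \<Union>B\<in>Y. witt_class (orth_sum A B)) \<rparr>"

definition fundamental_ideal :: "'a::field mat set set" where
  "fundamental_ideal = {witt_class A | A. is_qform A \<and> even (qf_dim A)}"

primrec fundamental_ideal_power :: "nat \<Rightarrow> 'a::field mat set set" where
  "fundamental_ideal_power 0 = carrier witt_ring"
| "fundamental_ideal_power (Suc m) =
     ideal_prod witt_ring (fundamental_ideal_power m) fundamental_ideal"

section \<open>The property Sim\<close>

text \<open>Only meaningful for \<open>m \<ge> 2\<close>; the natural subtraction \<open>m - 1\<close> is then harmless.\<close>

definition has_Sim :: "'a::field itself \<Rightarrow> nat \<Rightarrow> bool" where
  "has_Sim _ m \<longleftrightarrow>
     (\<forall>\<phi> \<psi> :: 'a mat.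
        is_qform \<phi> \<and> is_qform \<psi> \<and>
        qf_dim \<phi> \<noteq> 0 \<and> qf_dim \<psi> \<noteq> 0 \<and>
        anisotropic \<phi> \<and> anisotropic \<psi> \<and>
        qf_dim \<phi> \<le> 2 ^ m + 2 ^ (m - 1) \<and> qf_dim \<psi> \<le> 2 ^ m + 2 ^ (m - 1) \<and>
        witt_class \<phi> \<in> fundamental_ideal_power m \<and>
        witt_class \<psi> \<in> fundamental_ideal_power m \<and>
        witt_class \<phi> \<ominus>\<^bsub>witt_ring\<^esub> witt_class \<psi> \<in> fundamental_ideal_power (m + 1)
        \<longrightarrow> qf_similar \<phi> \<psi>)"

section \<open>2-Henselian discrete valuation rings\<close>

text \<open>The value at 0 (conventionally infinity) is left unspecified.\<close>

definition discrete_valuation :: "('k::field \<Rightarrow> int) \<Rightarrow> bool" where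
  "discrete_valuation v \<longleftrightarrow>
     v ` (UNIV - {0}) = UNIV \<and>
     (\<forall>x y. x \<noteq> 0 \<longrightarrow> y \<noteq> 0 \<longrightarrow> v (x * y) = v x + v y) \<and>
     (\<forall>x y. x \<noteq> 0 \<longrightarrow> y \<noteq> 0 \<longrightarrow> x + y \<noteq> 0 \<longrightarrow> min (v x) (v y) \<le> v (x + y))"

text \<open>
  A discrete valuation ring is the valuation ring of a discrete valuation on its
  quotient field. It is given here as a subset of that field, which is the whole
  type (see lemma \<open>DVR_quotient_field\<close>).
\<close>

definition DVR :: "'k::field set \<Rightarrow> bool" where
  "DVR R \<longleftrightarrow> (\<exists>v. discrete_valuation v \<and> R = {x. x = 0 \<or> 0 \<le> v x})"

definition units_in :: "'k::field set \<Rightarrow> 'k set" where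
  "units_in R = {x \<in> R. x \<noteq> 0 \<and> inverse x \<in> R}"

text \<open>
  The residue field is given, up to isomorphism, by a surjective ring homomorphism
  on \<open>R\<close> whose kernel is the maximal ideal, i.e. the set of non-units of \<open>R\<close>. The
  values of this map outside \<open>R\<close> are irrelevant.
\<close>

definition residue_map :: "'k::field set \<Rightarrow> ('k \<Rightarrow> 'f::field) \<Rightarrow> bool" where
  "residue_map R res \<longleftrightarrow>
     res 1 = 1 \<and>
     (\<forall>x\<in>R. \<forall>y\<in>R. res (x + y) = res x + res y) \<and>
     (\<forall>x\<in>R. \<forall>y\<in>R. res (x * y) = res x * res y) \<and>
     res ` R = UNIV \<and>
     {x \<in> R. res x = 0} = R - units_in R"

definition two_henselian :: "'k::field set \<Rightarrow> ('k \<Rightarrow> 'f::field) \<Rightarrow> bool" where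
  "two_henselian R res \<longleftrightarrow>
     (\<forall>x\<in>units_in R. (\<exists>a. res x = a ^ 2) \<longrightarrow> (\<exists>y\<in>R. x = y ^ 2))"

lemma DVR_quotient_field:
  assumes "DVR R"
  shows "\<exists>a\<in>R. \<exists>b\<in>R. b \<noteq> 0 \<and> x = a / b"
proof -
  obtain v where v: "discrete_valuation v" and R: "R = {x. x = 0 \<or> 0 \<le> v x}"
    using assms by (auto simp: DVR_def)
  have mult: "v (y * z) = v y + v z" if "y \<noteq> 0" "z \<noteq> 0" for y z
    using v that by (auto simp: discrete_valuation_def)
  have "v 1 = 0" using mult[of 1 1] by simp
  hence one: "1 \<in> R" by (simp add: R)
  show ?thesis
  proof (cases "x \<in> R")
    case True
    thus ?thesis using one by (intro bexI[of _ x] bexI[of _ 1]) auto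
  next
    case False
    hence x: "x \<noteq> 0" "v x < 0" by (auto simp: R)
    have "v (inverse x) = - v x" using mult[of x "inverse x"] x \<open>v 1 = 0\<close> by simp
    hence "inverse x \<in> R" using x by (simp add: R)
    thus ?thesis using one x
      by (intro bexI[of _ 1] bexI[of _ "inverse x"]) (auto simp: field_simps)
  qed
qed

end

theory Submission
  imports Defs "HOL-Library.Poly_Mapping" "HOL-Computational_Algebra.Fraction_Field"
begin

text \<open>
  By Springer, an anisotropic form over \<open>K\<close> is \<open>\<phi>\<^sub>1 \<bottom> t\<phi>\<^sub>2\<close> with anisotropic residue forms over \<open>F\<close>. If its
  class lies in \<open>I\<^sup>n(K)\<close>, then \<open>\<phi>\<^sub>2 \<in> I\<^sup>n\<^sup>-\<^sup>1(F)\<close> and \<open>\<phi>\<^sub>1 + \<phi>\<^sub>2 \<in> I\<^sup>n(F)\<close>. Given a second form with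
  residues \<open>\<psi>\<^sub>1, \<psi>\<^sub>2\<close>, in each form one residue has dimension at most \<open>2\<^sup>n\<^sup>-\<^sup>1 + 2\<^sup>n\<^sup>-\<^sup>2\<close>, and \<open>Sim(n - 1)\<close>
  makes these two similar (if no residue vanishes); after scaling, \<open>\<phi>\<^sub>2 = \<psi>\<^sub>2 = \<rho>\<close> and
  \<open>\<phi>\<^sub>1 - \<psi>\<^sub>1 \<in> I\<^sup>n\<^sup>+\<^sup>1(F)\<close>. By the Hauptsatz either \<open>\<phi>\<^sub>1 = \<psi>\<^sub>1\<close>, or \<open>\<phi>\<^sub>1\<close> and \<open>\<psi>\<^sub>1\<close> have dimension \<open>2\<^sup>n\<close> and
  \<open>\<rho>\<close> has dimension \<open>2\<^sup>n\<^sup>-\<^sup>1\<close>. In the latter case choose \<open>a\<close> such that \<open>\<phi>\<^sub>1 \<bottom> -a\<rho>\<close> is isotropic. The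
  anisotropic parts of \<open>\<phi>\<^sub>1 \<bottom> -a\<rho>\<close> and \<open>\<psi>\<^sub>1 \<bottom> -a\<rho>\<close> are similar by \<open>Sim(n)\<close>, so the second form is
  isotropic as well. Hence some \<open>k\<close> with \<open>k\<rho> = \<rho>\<close> makes \<open>k\<phi>\<^sub>1 \<bottom> -\<psi>\<^sub>1\<close> isotropic, and this form of
  dimension \<open>2\<^sup>n\<^sup>+\<^sup>1\<close> in \<open>I\<^sup>n\<^sup>+\<^sup>1(F)\<close> must be hyperbolic.

  The Hauptsatz of Arason and Pfister is proved by induction on the number of Pfister summands,
  without function fields of quadrics: multiplication by \<open>1 - \<langle>d\<rangle>\<close>, where \<open>d\<close> is a generic value of
  one of the Pfister forms \<open>\<pi>\<close>, annihilates \<open>\<pi>\<close>. If the remaining sum vanishes, the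
  Cassels-Pfister theorem bounds the dimension from below by that of \<open>\<pi>\<close>. All field extensions in
  this induction are purely transcendental, so that it takes place in a single field \<open>\<Omega>\<close> with
  \<open>\<Omega>(x) \<cong> \<Omega>\<close>.
\<close>

section \<open>The Witt ring by generators and relations\<close>

text \<open>A list stands for the diagonal form with these entries; entries \<open>0\<close> are ignored. With this
  convention the last rule covers the relation \<open>\<langle>a\<rangle> + \<langle>-a\<rangle> = 0\<close> too.\<close>

inductive weq :: "'a::field list \<Rightarrow> 'a list \<Rightarrow> bool" where
  weq_perm: "mset xs = mset ys \<Longrightarrow> weq xs ys"
| weq_sym: "weq xs ys \<Longrightarrow> weq ys xs"
| weq_trans: "weq xs ys \<Longrightarrow> weq ys zs \<Longrightarrow> weq xs zs"
| weq_Cons: "weq xs ys \<Longrightarrow> weq (a # xs) (a # ys)"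
| weq_zero: "weq (0 # xs) xs"
| weq_square: "c \<noteq> 0 \<Longrightarrow> weq (a * c\<^sup>2 # xs) (a # xs)"
| weq_add: "weq (a # b # xs) ((a + b) # (a * b * (a + b)) # xs)"

lemma weq_refl [simp]: "weq xs xs"
  by (rule weq_perm) simp

quotient_type (overloaded) 'a witt = "'a::field list" / weq
  by (intro equivpI reflpI sympI transpI) (auto intro: weq_sym weq_trans)

lemma weq_append_left: "weq xs ys \<Longrightarrow> weq (zs @ xs) (zs @ ys)"
  by (induct zs) (auto intro: weq_Cons)

lemma weq_append: "weq xs ys \<Longrightarrow> weq xs' ys' \<Longrightarrow> weq (xs @ xs') (ys @ ys')"
proof -
  assume a: "weq xs ys" "weq xs' ys'"
  have "weq (xs @ xs') (xs @ ys')" using a(2) by (rule weq_append_left)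
  moreover have "weq (xs @ ys') (ys' @ xs)" by (rule weq_perm) simp
  moreover have "weq (ys' @ xs) (ys' @ ys)" using a(1) by (rule weq_append_left)
  moreover have "weq (ys' @ ys) (ys @ ys')" by (rule weq_perm) simp
  ultimately show ?thesis by (metis weq_trans)
qed

text \<open>The entries come in the order of the Kronecker product of diagonal matrices, which
  \<open>misom_tensor\<close> relies on.\<close>

definition lmul :: "'a::field list \<Rightarrow> 'a list \<Rightarrow> 'a list" where
  "lmul xs ys = concat (map (\<lambda>a. map ((*) a) ys) xs)"

lemma lmul_Nil [simp]: "lmul [] ys = []" and
  lmul_Cons: "lmul (x # xs) ys = map ((*) x) ys @ lmul xs ys"
  by (simp_all add: lmul_def)

lemma lmul_Nil2 [simp]: "lmul xs [] = []"
  by (induct xs) (simp_all add: lmul_Cons)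

lemma mset_lmul_Cons2: "mset (lmul xs (y # ys)) = mset (map (\<lambda>a. a * y) xs) + mset (lmul xs ys)"
  by (induct xs) (simp_all add: lmul_Cons)

lemma mset_lmul_commute: "mset (lmul xs ys) = mset (lmul ys xs)"
  by (induct xs) (simp_all add: lmul_Cons mset_lmul_Cons2 mult.commute)

lemma mset_lmul: "mset (lmul xs ys) = (\<Sum>x\<in>#mset xs. image_mset ((*) x) (mset ys))"
  by (induct xs) (simp_all add: lmul_Cons)

lemma weq_map_mult: "weq xs ys \<Longrightarrow> weq (map ((*) a) xs) (map ((*) a) ys)"
proof (induct rule: weq.induct)
  case (weq_perm xs ys)
  then have "mset (map ((*) a) xs) = mset (map ((*) a) ys)" by simp
  then show ?case by (rule weq.weq_perm)
next
  case (weq_square c b xs)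
  then show ?case using weq.weq_square[of c "a * b" "map ((*) a) xs"] by (simp add: mult.assoc)
next
  case (weq_add b c xs)
  show ?case
  proof (cases "a = 0")
    case True
    have "weq (0 # 0 # map ((*) 0) xs) (0 # 0 # map ((*) 0) xs)" by simp
    then show ?thesis using True by simp
  next
    case False
    let ?x = "map ((*) a) xs"
    have "weq (a * b # a * c # ?x) ((a * b + a * c) # (a * b * (a * c) * (a * b + a * c)) # ?x)"
      by (rule weq.weq_add)
    also have "a * b * (a * c) * (a * b + a * c) = (a * (b * c * (b + c))) * a\<^sup>2"
      by (simp add: algebra_simps power2_eq_square)
    finally have 1: "weq (a * b # a * c # ?x) ((a * b + a * c) # (a * (b * c * (b + c))) * a\<^sup>2 # ?x)" .
    have "weq ((a * b + a * c) # (a * (b * c * (b + c))) * a\<^sup>2 # ?x)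
       ((a * b + a * c) # (a * (b * c * (b + c))) # ?x)"
      using False by (intro weq.weq_Cons weq.weq_square)
    with 1 show ?thesis by (metis (no_types, lifting) weq.weq_trans distrib_left list.simps(9))
  qed
qed (auto intro: weq.intros)

lemma weq_lmul_right: "weq ys ys' \<Longrightarrow> weq (lmul xs ys) (lmul xs ys')"
  by (induct xs) (auto simp: lmul_Cons intro: weq_append weq_map_mult)

lemma weq_lmul: "weq xs xs' \<Longrightarrow> weq ys ys' \<Longrightarrow> weq (lmul xs ys) (lmul xs' ys')"
  by (meson mset_lmul_commute weq_lmul_right weq_perm weq_trans)

lemma weq_map_uminus: "weq xs ys \<Longrightarrow> weq (map uminus xs) (map uminus ys)"
  using weq_map_mult[of xs ys "- 1"] by (simp add: comp_def cong: map_cong)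

text \<open>Each pair -x, x is turned by \<open>weq_add\<close> into two zeros, and these are
  dropped.\<close>

lemma weq_hyperbolic: "weq (map uminus xs @ xs) []"
proof (induct xs)
  case (Cons x xs)
  have "weq (map uminus (x # xs) @ (x # xs)) (- x # x # map uminus xs @ xs)"
    by (rule weq_perm) simp
  moreover have "weq (- x # x # map uminus xs @ xs) (0 # 0 # map uminus xs @ xs)"
    using weq_add[of "- x" x "map uminus xs @ xs"] by simp
  moreover have "weq (0 # 0 # map uminus xs @ xs) (map uminus xs @ xs)"
    by (meson weq_zero weq_trans)
  ultimately show ?case using Cons by (metis weq_trans)
qed simp

text \<open>The dimension modulo 2 is an invariant: \<open>weq_add\<close> loses nonzero entries
  only if \<open>b = - a\<close>, and then exactly two. This separates 0 from 1 in the Witt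
  ring.\<close>

lemma weq_parity: "weq xs ys \<Longrightarrow> even (length (filter ((\<noteq>) 0) xs)) \<longleftrightarrow> even (length (filter ((\<noteq>) 0) ys))"
proof (induct rule: weq.induct)
  case (weq_perm xs ys)
  then have "mset (filter ((\<noteq>) 0) xs) = mset (filter ((\<noteq>) 0) ys)" by simp
  then show ?case by (metis size_mset)
qed (auto simp: add_eq_0_iff)

section \<open>Ring structure on the classes of diagonal forms\<close>

instantiation witt :: (field) comm_ring_1
begin

lift_definition zero_witt :: "'a witt" is "[]" .
lift_definition one_witt :: "'a witt" is "[1]" .
lift_definition plus_witt :: "'a witt \<Rightarrow> 'a witt \<Rightarrow> 'a witt" is "(@)"
  by (rule weq_append)
lift_definition uminus_witt :: "'a witt \<Rightarrow> 'a witt" is "map uminus"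
  by (rule weq_map_uminus)
lift_definition times_witt :: "'a witt \<Rightarrow> 'a witt \<Rightarrow> 'a witt" is lmul
  by (rule weq_lmul)
definition minus_witt :: "'a witt \<Rightarrow> 'a witt \<Rightarrow> 'a witt" where
  "minus_witt x y = x + - y"

lemma mset_lmul_append: "mset (lmul (xs @ ys) zs) = mset (lmul xs zs) + mset (lmul ys zs)"
  by (simp add: mset_lmul)

lemma lmul_map_left: "lmul (map ((*) a) xs) ys = map ((*) a) (lmul xs ys)"
  by (induct xs) (simp_all add: lmul_Cons comp_def mult.assoc)

lemma mset_lmul_assoc: "mset (lmul (lmul xs ys) zs) = mset (lmul xs (lmul ys zs))"
  by (induct xs) (simp_all add: lmul_Cons mset_lmul_append lmul_map_left)

instance
proof
  fix a b c :: "'a witt"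
  show "a + b + c = a + (b + c)" by transfer simp
  show "a + b = b + a" by transfer (simp add: weq_perm)
  show "0 + a = a" by transfer simp
  show "- a + a = 0" by transfer (rule weq_hyperbolic)
  show "a - b = a + - b" by (rule minus_witt_def)
  show "a * b * c = a * (b * c)" by transfer (rule weq_perm[OF mset_lmul_assoc])
  show "a * b = b * a" by transfer (rule weq_perm[OF mset_lmul_commute])
  show "1 * a = a" by transfer (simp add: lmul_Cons cong: map_cong)
  show "(a + b) * c = a * c + b * c" by transfer (simp add: weq_perm mset_lmul_append)
  show "(0::'a witt) \<noteq> 1"
    by transfer (auto dest: weq_parity)
qed

end

lift_definition rk :: "'a::field \<Rightarrow> 'a witt" is "\<lambda>a. [a]" .

definition wcls :: "'a::field list \<Rightarrow> 'a witt" where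
  "wcls xs = sum_list (map rk xs)"

lemma wcls_Nil [simp]: "wcls [] = 0" and
  wcls_Cons [simp]: "wcls (x # xs) = rk x + wcls xs" and
  wcls_append [simp]: "wcls (xs @ ys) = wcls xs + wcls ys"
  by (simp_all add: wcls_def)

lemma wcls_eq_abs: "wcls xs = abs_witt xs"
  by (induct xs) (simp_all add: zero_witt_def rk_def plus_witt.abs_eq)

lemma wcls_eq_iff: "wcls xs = wcls ys \<longleftrightarrow> weq xs ys"
  by (simp add: wcls_eq_abs witt.abs_eq_iff)

lemma wcls_surj: "\<exists>xs. x = wcls xs"
  by (metis Quotient3_witt Quotient3_def wcls_eq_abs)

lemma wcls_mset: "mset xs = mset ys \<Longrightarrow> wcls xs = wcls ys"
  by (simp add: wcls_eq_iff weq_perm)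

lemma rk_0 [simp]: "rk 0 = 0"
  by transfer (rule weq_zero)

lemma rk_1 [simp]: "rk 1 = 1"
  by transfer simp

lemma rk_square: "c \<noteq> 0 \<Longrightarrow> rk (a * c\<^sup>2) = rk a"
  by transfer (rule weq_square)

lemma rk_add: "rk a + rk b = rk (a + b) + rk (a * b * (a + b))"
  by transfer (use weq_add[of _ _ "[]"] in simp)

lemma rk_mult: "rk (a * b) = rk a * rk b"
  by transfer (simp add: lmul_def)

lemma rk_uminus: "rk (- a) = - rk a"
  by transfer simp

lemma rk_square_1: "a \<noteq> 0 \<Longrightarrow> rk (a\<^sup>2) = 1"
  using rk_square[of a 1] by simp

lemma rk_mult_self: "a \<noteq> 0 \<Longrightarrow> rk a * rk a = 1"
  by (metis rk_mult rk_square_1 power2_eq_square)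

lemma wcls_map_mult: "wcls (map ((*) a) xs) = rk a * wcls xs"
  by (induct xs) (simp_all add: rk_mult distrib_left)

lemma wcls_lmul: "wcls (lmul xs ys) = wcls xs * wcls ys"
  by (induct xs) (simp_all add: lmul_Cons wcls_map_mult distrib_right)

lemma wcls_nonzero_rep: "\<exists>xs. 0 \<notin> set xs \<and> x = wcls xs"
proof -
  obtain xs where "x = wcls xs" using wcls_surj by blast
  moreover have "wcls xs = wcls (filter ((\<noteq>) 0) xs)" by (induct xs) auto
  ultimately show ?thesis by (intro exI[of _ "filter ((\<noteq>) 0) xs"]) auto
qed

text \<open>The value of \<open>wlift g\<close> depends on the choice of representatives unless \<open>g\<close> respects the
  relations.\<close>

definition wlift :: "('a::field \<Rightarrow> 'b::comm_ring_1) \<Rightarrow> 'a witt \<Rightarrow> 'b" where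
  "wlift g x = sum_list (map g (rep_witt x))"

text \<open>These are the relations \<open>weq_zero\<close>, \<open>weq_square\<close> and
  \<open>weq_add\<close>; the remaining rules of \<open>weq\<close> hold for every sum over the
  entries. Base change and the residue maps are instances.\<close>

locale witt_map =
  fixes g :: "'a::field \<Rightarrow> 'b::comm_ring_1"
  assumes zero: "g 0 = 0"
    and square: "c \<noteq> 0 \<Longrightarrow> g (a * c\<^sup>2) = g a"
    and add: "g a + g b = g (a + b) + g (a * b * (a + b))"
begin

lemma weq_sum: "weq xs ys \<Longrightarrow> sum_list (map g xs) = sum_list (map g ys)"
proof (induct rule: weq.induct)
  case (weq_perm xs ys)
  then have "sum_mset (image_mset g (mset xs)) = sum_mset (image_mset g (mset ys))" by simp
  then show ?case by (metis mset_map sum_mset_sum_list)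
next
  case (weq_add a b xs)
  then show ?case using add[of a b] by (simp add: add.assoc[symmetric])
qed (auto simp: zero square)

lemma wlift_wcls: "wlift g (wcls xs) = sum_list (map g xs)"
  unfolding wlift_def
  by (rule weq_sum) (metis Quotient3_rep_abs Quotient3_witt weq_refl wcls_eq_abs)

lemma wlift_rk [simp]: "wlift g (rk a) = g a"
  using wlift_wcls[of "[a]"] by simp

lemma wlift_0 [simp]: "wlift g 0 = 0"
  using wlift_wcls[of "[]"] by simp

lemma wlift_add: "wlift g (x + y) = wlift g x + wlift g y"
proof -
  obtain xs ys where "x = wcls xs" "y = wcls ys" using wcls_surj by blast
  then show ?thesis by (simp add: wlift_wcls flip: wcls_append)
qed

lemma wlift_uminus: "wlift g (- x) = - wlift g x"
  using wlift_add[of x "- x"] by (simp add: eq_neg_iff_add_eq_0 add.commute)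

lemma wlift_diff: "wlift g (x - y) = wlift g x - wlift g y"
  using wlift_add[of x "- y"] by (simp add: wlift_uminus)

end

lemma witt_induct [case_names zero add]:
  assumes "P 0" and "\<And>a x. P x \<Longrightarrow> P (rk a + x)"
  shows "P x"
proof -
  have "P (wcls xs)" for xs by (induct xs) (simp_all add: assms)
  then show ?thesis using wcls_surj by metis
qed

section \<open>Diagonal forms\<close>

text \<open>Vectors are functions on all of \<open>nat\<close>, of which only the first
  \<open>length xs\<close> values count.\<close>

definition bf :: "'a::field list \<Rightarrow> (nat \<Rightarrow> 'a) \<Rightarrow> (nat \<Rightarrow> 'a) \<Rightarrow> 'a" where
  "bf xs v w = (\<Sum>i<length xs. xs ! i * v i * w i)"

definition anis :: "'a::field list \<Rightarrow> bool" where
  "anis xs \<longleftrightarrow> (\<forall>v. bf xs v v = 0 \<longrightarrow> (\<forall>i<length xs. v i = 0))"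

text \<open>The map \<open>T\<close> need not be linear: only its values on unit vectors matter.\<close>

definition isometric :: "'a::field list \<Rightarrow> 'a list \<Rightarrow> bool" where
  "isometric xs ys \<longleftrightarrow> length xs = length ys \<and> (\<exists>T. \<forall>v w. bf xs (T v) (T w) = bf ys v w)"

definition unit_fun :: "nat \<Rightarrow> nat \<Rightarrow> 'a::field" where
  "unit_fun i = (\<lambda>j. if j = i then 1 else 0)"

lemma bf_Nil [simp]: "bf [] v w = 0"
  by (simp add: bf_def)

lemma bf_Cons [simp]: "bf (x # xs) v w = x * v 0 * w 0 + bf xs (\<lambda>i. v (Suc i)) (\<lambda>i. w (Suc i))"
  by (simp add: bf_def sum.lessThan_Suc_shift del: sum.lessThan_Suc)

lemma bf_append: "bf (xs @ ys) v w = bf xs v w + bf ys (\<lambda>i. v (length xs + i)) (\<lambda>i. w (length xs + i))"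
  by (induct xs arbitrary: v w) (simp_all add: add.assoc)

lemma bf_commute: "bf xs v w = bf xs w v"
  by (simp add: bf_def ac_simps)

lemma bf_cong: "(\<And>i. i < length xs \<Longrightarrow> v i = v' i) \<Longrightarrow> (\<And>i. i < length xs \<Longrightarrow> w i = w' i) \<Longrightarrow>
    bf xs v w = bf xs v' w'"
  by (simp add: bf_def)

lemma bf_add: "bf xs (\<lambda>i. v i + v' i) w = bf xs v w + bf xs v' w"
  "bf xs v (\<lambda>i. w i + w' i) = bf xs v w + bf xs v w'"
  by (simp_all add: bf_def algebra_simps sum.distrib)

lemma bf_diff: "bf xs (\<lambda>i. v i - v' i) w = bf xs v w - bf xs v' w"
  "bf xs v (\<lambda>i. w i - w' i) = bf xs v w - bf xs v w'"
  by (simp_all add: bf_def algebra_simps sum_subtractf)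

lemma bf_scale: "bf xs (\<lambda>i. c * v i) w = c * bf xs v w" "bf xs v (\<lambda>i. c * w i) = c * bf xs v w"
  by (simp_all add: bf_def algebra_simps sum_distrib_left)

lemma bf_zero [simp]: "bf xs (\<lambda>i. 0) w = 0" "bf xs v (\<lambda>i. 0) = 0"
  by (simp_all add: bf_def)

lemma bf_unit: "i < length xs \<Longrightarrow> bf xs (unit_fun i) w = xs ! i * w i"
  by (simp add: bf_def unit_fun_def if_distrib[of "\<lambda>x. _ * x"] if_distrib[of "\<lambda>x. x * _"] sum.delta cong: if_cong)

lemma bf_map_mult: "bf (map ((*) a) xs) v w = a * bf xs v w"
  by (simp add: bf_def sum_distrib_left mult.assoc)

lemma anis_nonzero: "anis xs \<Longrightarrow> 0 \<notin> set xs"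
proof
  assume a: "anis xs" and "0 \<in> set xs"
  then obtain i where i: "i < length xs" "xs ! i = 0" by (auto simp: in_set_conv_nth)
  then have "bf xs (unit_fun i) (unit_fun i) = 0" by (simp add: bf_unit)
  then have "unit_fun i i = (0::'a)" using a i unfolding anis_def by blast
  then show False by (simp add: unit_fun_def)
qed

lemma anis_append: "anis (xs @ ys) \<Longrightarrow> anis xs" "anis (xs @ ys) \<Longrightarrow> anis ys"
proof -
  assume a: "anis (xs @ ys)"
  show "anis xs" unfolding anis_def
  proof (intro allI impI)
    fix v i assume v: "bf xs v v = 0" and i: "i < length xs"
    let ?v = "\<lambda>i. if i < length xs then v i else 0"
    have "bf (xs @ ys) ?v ?v = 0"
      using v by (simp add: bf_append cong: bf_cong)
    then have "\<forall>i < length (xs @ ys). ?v i = 0" using a unfolding anis_def by blast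
    then show "v i = 0" using i by (metis length_append trans_less_add1)
  qed
  show "anis ys" unfolding anis_def
  proof (intro allI impI)
    fix v i assume v: "bf ys v v = 0" and i: "i < length ys"
    let ?v = "\<lambda>i. if i < length xs then 0 else v (i - length xs)"
    have "bf (xs @ ys) ?v ?v = 0"
      using v by (simp add: bf_append cong: bf_cong)
    then have "\<forall>i < length (xs @ ys). ?v i = 0" using a unfolding anis_def by blast
    from this[rule_format, of "length xs + i"] show "v i = 0" using i by simp
  qed
qed

lemma anis_map_mult: "a \<noteq> 0 \<Longrightarrow> anis (map ((*) a) xs) \<longleftrightarrow> anis xs"
  by (simp add: anis_def bf_map_mult)

subsection \<open>Isometries\<close>

lemma isometric_length: "isometric xs ys \<Longrightarrow> length xs = length ys"
  by (simp add: isometric_def)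

lemma isometric_refl [simp]: "isometric xs xs"
  unfolding isometric_def by (intro conjI exI[of _ "\<lambda>v. v"]) simp_all

lemma isometric_trans: "isometric xs ys \<Longrightarrow> isometric ys zs \<Longrightarrow> isometric xs zs"
  unfolding isometric_def
proof (elim conjE exE, intro conjI)
  fix S T assume "\<forall>v w. bf xs (S v) (S w) = bf ys v w" "\<forall>v w. bf ys (T v) (T w) = bf zs v w"
  then show "\<exists>T. \<forall>v w. bf xs (T v) (T w) = bf zs v w" by (intro exI[of _ "\<lambda>v. S (T v)"]) simp
qed simp

lemma isometric_append: "isometric xs ys \<Longrightarrow> isometric xs' ys' \<Longrightarrow> isometric (xs @ xs') (ys @ ys')"
  unfolding isometric_def
proof (elim conjE exE, intro conjI)
  fix S T
  assume len: "length xs = length ys" and S: "\<forall>v w. bf xs (S v) (S w) = bf ys v w"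
    and T: "\<forall>v w. bf xs' (T v) (T w) = bf ys' v w"
  let ?U = "\<lambda>v i. if i < length xs then S v i else T (\<lambda>i. v (length xs + i)) (i - length xs)"
  have "bf (xs @ xs') (?U v) (?U w) = bf (ys @ ys') v w" for v w
    using S T len by (simp add: bf_append cong: bf_cong)
  then show "\<exists>T. \<forall>v w. bf (xs @ xs') (T v) (T w) = bf (ys @ ys') v w"
    by (intro exI[of _ ?U]) blast
qed simp

lemma isometric_Cons: "isometric xs ys \<Longrightarrow> isometric (a # xs) (a # ys)"
  using isometric_append[of "[a]" "[a]" xs ys] by simp

lemma isometric_perm: "mset xs = mset ys \<Longrightarrow> isometric xs ys"
proof -
  assume m: "mset xs = mset ys"
  then obtain f where f: "f permutes {..<length ys}" "permute_list f ys = xs"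
    by (metis mset_eq_permutation)
  have len: "length xs = length ys" using m by (metis size_mset)
  have "bf xs (\<lambda>i. v (f i)) (\<lambda>i. w (f i)) = bf ys v w" for v w
  proof -
    have "bf xs (\<lambda>i. v (f i)) (\<lambda>i. w (f i)) = (\<Sum>i<length ys. ys ! f i * v (f i) * w (f i))"
      using f len by (auto simp: bf_def permute_list_nth intro!: sum.cong)
    also have "\<dots> = bf ys v w" unfolding bf_def
      using sum.reindex_bij_betw[OF permutes_imp_bij[OF f(1)], of "\<lambda>i. ys ! i * v i * w i"] by simp
    finally show ?thesis .
  qed
  with len show ?thesis unfolding isometric_def by (intro conjI exI[of _ "\<lambda>v i. v (f i)"]) auto
qed

text \<open>The images \<open>p j\<close> of the unit vectors are orthogonal with values
  \<open>ys ! j\<close>, which says \<open>A * B = 1\<close>. For square matrices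
  \<open>B * A = 1\<close> follows, which is the expansion of vectors in the basis \<open>p\<close>.
  Taking coordinates in this basis is the inverse isometry \<open>S\<close>.\<close>

lemma isometric_sym:
  assumes "isometric xs ys" "0 \<notin> set ys"
  shows "isometric ys xs"
proof -
  obtain T where len: "length xs = length ys" and T: "\<And>v w. bf xs (T v) (T w) = bf ys v w"
    using assms(1) unfolding isometric_def by auto
  define n where "n = length ys"
  define p where "p j = T (unit_fun j)" for j
  have nz: "ys ! j \<noteq> 0" if "j < n" for j using assms(2) that by (auto simp: n_def in_set_conv_nth)
  define A where "A = mat n n (\<lambda>(j, k). p j k * xs ! k / ys ! j)"
  define B where "B = mat n n (\<lambda>(k, j). p j k)"
  have AB: "A \<in> carrier_mat n n" "B \<in> carrier_mat n n" by (simp_all add: A_def B_def)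
  have "A * B = 1\<^sub>m n"
  proof (rule eq_matI)
    fix i j assume "i < dim_row (1\<^sub>m n :: 'a mat)" "j < dim_col (1\<^sub>m n :: 'a mat)"
    then have ij: "i < n" "j < n" by auto
    then have "(A * B) $$ (i, j) = (\<Sum>k<n. p i k * xs ! k / ys ! i * p j k)"
      by (simp add: A_def B_def scalar_prod_def atLeast0LessThan)
    also have "\<dots> = bf xs (p i) (p j) / ys ! i"
      by (simp add: bf_def len n_def sum_divide_distrib ac_simps)
    also have "\<dots> = bf ys (unit_fun i) (unit_fun j) / ys ! i" by (simp add: p_def T)
    also have "\<dots> = (1\<^sub>m n) $$ (i, j)"
      using ij nz by (simp add: bf_unit n_def) (simp add: unit_fun_def)
    finally show "(A * B) $$ (i, j) = (1\<^sub>m n) $$ (i, j)" .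
  qed (simp_all add: A_def B_def)
  then have BA: "B * A = 1\<^sub>m n" using mat_mult_left_right_inverse[OF AB] by simp
  have complete: "(\<Sum>j<n. p j l * (p j k * xs ! k / ys ! j)) = (if l = k then 1 else 0)"
    if "k < n" "l < n" for k l
  proof -
    have "(B * A) $$ (l, k) = (\<Sum>j<n. p j l * (p j k * xs ! k / ys ! j))"
      using that by (simp add: A_def B_def scalar_prod_def atLeast0LessThan)
    then show ?thesis using BA that by simp
  qed
  define S where "S v = (\<lambda>j. bf xs v (p j) / ys ! j)" for v
  have "bf ys (S v) (S w) = bf xs v w" for v w
  proof -
    have "bf ys (S v) (S w) = (\<Sum>j<n. bf xs v (p j) * bf xs w (p j) / ys ! j)"
      unfolding bf_def[of ys] S_def n_def[symmetric] using nz by (intro sum.cong) auto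
    also have "\<dots> = (\<Sum>j<n. \<Sum>l<n. \<Sum>k<n. xs ! l * v l * w k * (p j l * (p j k * xs ! k / ys ! j)))"
      by (simp add: bf_def len n_def sum_product sum_divide_distrib ac_simps)
    also have "\<dots> = (\<Sum>l<n. \<Sum>k<n. \<Sum>j<n. xs ! l * v l * w k * (p j l * (p j k * xs ! k / ys ! j)))"
      by (subst sum.swap) (intro sum.cong refl sum.swap)
    also have "\<dots> = (\<Sum>l<n. \<Sum>k<n. xs ! l * v l * w k * (if l = k then 1 else 0))"
      unfolding sum_distrib_left[symmetric] by (intro sum.cong refl) (simp only: complete lessThan_iff)
    also have "\<dots> = bf xs v w"
      by (simp add: bf_def len n_def if_distrib[of "\<lambda>x. _ * x"] sum.delta' cong: if_cong)
    finally show ?thesis .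
  qed
  then show ?thesis using len unfolding isometric_def by auto
qed

subsection \<open>Witt cancellation\<close>

lemma reflection:
  fixes u z :: "nat \<Rightarrow> 'a::field"
  assumes z: "bf xs z z \<noteq> 0"
  obtains R where "\<And>v w. bf xs (R v) (R w) = bf xs v w"
    and "\<And>v. R v = (\<lambda>i. v i - (2 * bf xs v z / bf xs z z) * z i)"
proof
  define R where "R v = (\<lambda>i. v i - (2 * bf xs v z / bf xs z z) * z i)" for v
  show "bf xs (R v) (R w) = bf xs v w" for v w
    unfolding R_def bf_diff bf_scale bf_commute[of xs z w] using z by (simp add: field_simps)
  show "R v = (\<lambda>i. v i - (2 * bf xs v z / bf xs z z) * z i)" for v by (simp add: R_def)
qed

text \<open>The values of the form at \<open>u - e\<close> and \<open>u + e\<close> add up to 4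
  times its value at \<open>e\<close>, so one of them is nonzero. The reflection along
  \<open>u - e\<close> sends \<open>u\<close> to \<open>e\<close>, the one along
  \<open>u + e\<close> sends it to \<open>- e\<close>.\<close>

lemma reflection_transitive:
  fixes u e :: "nat \<Rightarrow> 'a::field"
  assumes two: "(2::'a) \<noteq> 0" and eq: "bf xs u u = bf xs e e" and nz: "bf xs e e \<noteq> 0"
  obtains R c where "\<And>v w. bf xs (R v) (R w) = bf xs v w" and "R u = (\<lambda>i. c * e i)" "c = 1 \<or> c = - 1"
proof (cases "bf xs (\<lambda>i. u i - e i) (\<lambda>i. u i - e i) = 0")
  case False
  then obtain R where R: "\<And>v w. bf xs (R v) (R w) = bf xs v w"
    "\<And>v. R v = (\<lambda>i. v i - (2 * bf xs v (\<lambda>i. u i - e i) / bf xs (\<lambda>i. u i - e i) (\<lambda>i. u i - e i)) * (u i - e i))"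
    using reflection[of xs "\<lambda>i. u i - e i"] by blast
  have "2 * bf xs u (\<lambda>i. u i - e i) / bf xs (\<lambda>i. u i - e i) (\<lambda>i. u i - e i) = 1"
    using False eq by (simp add: bf_diff bf_commute[of xs e u] divide_simps)
  then have "R u = (\<lambda>i. 1 * e i)" by (simp add: R(2))
  then show ?thesis using that R(1) by blast
next
  case True
  have pm: "bf xs (\<lambda>i. u i + e i) (\<lambda>i. u i + e i) = 4 * bf xs e e"
    using True eq two by (auto simp: bf_diff bf_add bf_commute[of xs e u] algebra_simps)
  have four: "(4::'a) \<noteq> 0" using two by (metis mult_2 mult_eq_0_iff numeral_Bit0)
  then have "bf xs (\<lambda>i. u i + e i) (\<lambda>i. u i + e i) \<noteq> 0" using pm nz by simp
  then obtain R where R: "\<And>v w. bf xs (R v) (R w) = bf xs v w"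
    "\<And>v. R v = (\<lambda>i. v i - (2 * bf xs v (\<lambda>i. u i + e i) / bf xs (\<lambda>i. u i + e i) (\<lambda>i. u i + e i)) * (u i + e i))"
    using reflection[of xs "\<lambda>i. u i + e i"] by blast
  have "2 * bf xs u (\<lambda>i. u i + e i) = 4 * bf xs e e"
    using True eq two by (auto simp: bf_diff bf_add bf_commute[of xs e u] algebra_simps)
  then have "2 * bf xs u (\<lambda>i. u i + e i) / bf xs (\<lambda>i. u i + e i) (\<lambda>i. u i + e i) = 1"
    using pm nz four by simp
  then have "R u = (\<lambda>i. (- 1) * e i)" by (simp add: R(2))
  then show ?thesis using that R(1) by blast
qed

text \<open>Witt cancellation. A reflection moves the image of the first unit vector back to this
  vector up to sign; the composite then maps the orthogonal complements to each other, and these are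
  the remaining forms.\<close>

lemma isometric_cancel:
  fixes a :: "'a::field"
  assumes two: "(2::'a) \<noteq> 0" and isometric: "isometric (a # xs) (a # ys)" and a: "a \<noteq> 0"
  shows "isometric xs ys"
proof -
  obtain T where len: "length xs = length ys" and T: "\<And>v w. bf (a # xs) (T v) (T w) = bf (a # ys) v w"
    using isometric unfolding isometric_def by auto
  let ?e = "unit_fun 0 :: nat \<Rightarrow> 'a"
  have e: "bf (a # zs) ?e w = a * w 0" for zs w using bf_unit[of 0 "a # zs" w] by simp
  have "bf (a # xs) (T ?e) (T ?e) = bf (a # xs) ?e ?e" unfolding T e by simp
  moreover have "bf (a # xs) ?e ?e \<noteq> 0" using a unfolding e by (simp add: unit_fun_def)
  ultimately obtain R c where R: "\<And>v w. bf (a # xs) (R v) (R w) = bf (a # xs) v w"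
    and c: "R (T ?e) = (\<lambda>i. c * ?e i)" "c = 1 \<or> c = - 1"
    using reflection_transitive[OF two] by metis
  \<comment> \<open>\<open>case_nat 0 v\<close> puts the coordinate 0 in front of
    \<open>v\<close>.\<close>
  define S where "S v = R (T (case_nat 0 v))" for v
  have S0: "S v 0 = 0" for v
  proof -
    have "bf (a # xs) (R (T ?e)) (S v) = bf (a # ys) ?e (case_nat 0 v)"
      unfolding S_def R T by simp
    also have "\<dots> = 0" unfolding e by simp
    finally have "c * (a * S v 0) = 0" unfolding c(1) bf_scale e .
    then show ?thesis using a c(2) by auto
  qed
  have "bf xs (\<lambda>i. S v (Suc i)) (\<lambda>i. S w (Suc i)) = bf ys v w" for v w
  proof -
    have "bf xs (\<lambda>i. S v (Suc i)) (\<lambda>i. S w (Suc i)) = bf (a # xs) (S v) (S w)" by (simp add: S0)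
    also have "\<dots> = bf (a # ys) (case_nat 0 v) (case_nat 0 w)" unfolding S_def R T ..
    also have "\<dots> = bf ys v w" by simp
    finally show ?thesis .
  qed
  then show ?thesis using len unfolding isometric_def by (intro conjI exI[of _ "\<lambda>v i. S v (Suc i)"]) auto
qed

lemma isometric_cancel_append:
  assumes two: "(2::'a::field) \<noteq> 0" and "isometric (zs @ xs) (zs @ ys :: 'a list)" "0 \<notin> set zs"
  shows "isometric xs ys"
  using assms(2,3) by (induct zs) (auto dest: isometric_cancel[OF two])

subsection \<open>Witt equivalence and isometry\<close>

definition hyp :: "nat \<Rightarrow> 'a::field list" where
  "hyp k = concat (replicate k [1, - 1])"

lemma hyp_simps [simp]: "hyp 0 = []" "hyp (Suc k) = 1 # - 1 # hyp k"
  by (simp_all add: hyp_def)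

lemma hyp_add: "hyp (k + l) = hyp k @ hyp l"
  by (induct k) simp_all

lemma length_hyp [simp]: "length (hyp k) = 2 * k"
  by (induct k) simp_all

lemma wcls_hyp [simp]: "wcls (hyp k) = 0"
  by (induct k) (simp_all add: rk_uminus)

lemma nonzero_hyp [simp]: "0 \<notin> set (hyp k)"
  by (induct k) simp_all

lemma isometric_square: "c \<noteq> 0 \<Longrightarrow> isometric [a * c\<^sup>2] [a]"
  unfolding isometric_def
  by (intro conjI exI[of _ "\<lambda>v i. v i / c"]) (simp_all add: power2_eq_square)

lemma isometric_hyperbolic:
  assumes two: "(2::'a::field) \<noteq> 0" and a: "a \<noteq> 0"
  shows "isometric [a, - a] [1, - 1 :: 'a]"
proof -
  define h where "h = 1 / (2::'a)"
  have h: "h + h = 1" using two by (simp add: h_def field_simps)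
  \<comment> \<open>The coordinates X, Y are chosen with X + Y = v 0 + v 1 and X - Y = (v 0 - v 1) /
    a, which turns a (X^2 - Y^2) into <1, -1>.\<close>
  let ?T = "\<lambda>v i. if i = 0 then h * ((1 + 1/a) * v 0 + (1 - 1/a) * v (Suc 0))
    else h * ((1 - 1/a) * v 0 + (1 + 1/a) * v (Suc (0::nat)))"
  have "4 * (h * h) = (h + h) * (h + h)" by (simp add: algebra_simps)
  then have hh: "4 * (h * h) = 1" unfolding h by simp
  have "bf [a, - a] (?T v) (?T w) = bf [1, - 1] v w" for v w
  proof -
    have "bf [a, - a] (?T v) (?T w) = 4 * (h * h) * (v 0 * w 0 - v 1 * w 1)"
      using a by (simp add: field_simps)
    then show ?thesis unfolding hh by simp
  qed
  then show ?thesis unfolding isometric_def by (intro conjI exI[of _ ?T]) auto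
qed

lemma isometric_add:
  assumes "a + b \<noteq> (0::'a::field)" and "a \<noteq> 0" "b \<noteq> 0"
  shows "isometric [a, b] [a + b, a * b * (a + b)]"
proof -
  \<comment> \<open>The new orthogonal basis consists of (1, 1) and (-b, a), with values a + b and a
    b (a + b).\<close>
  let ?T = "\<lambda>v i. if i = 0 then v 0 - b * v (Suc 0) else v 0 + a * v (Suc (0::nat))"
  have "bf [a, b] (?T v) (?T w) = bf [a + b, a * b * (a + b)] v w" for v w
    by (simp add: algebra_simps)
  then show ?thesis unfolding isometric_def by (intro conjI exI[of _ ?T]) auto
qed

text \<open>From relations to geometry: every rule of \<open>weq\<close> becomes an isometry once
  zeros are dropped and hyperbolic planes may be added. Planes originate from \<open>weq_add\<close>
  with \<open>b = - a\<close>.\<close>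

lemma weq_isometric:
  assumes two: "(2::'a::field) \<noteq> 0" and "weq xs (ys::'a list)"
  shows "\<exists>k l. isometric (filter ((\<noteq>) 0) xs @ hyp k) (filter ((\<noteq>) 0) ys @ hyp l)"
  using assms(2)
proof (induct rule: weq.induct)
  case (weq_perm xs ys)
  then have "mset (filter ((\<noteq>) 0) xs) = mset (filter ((\<noteq>) 0) ys)" by simp
  then show ?case by (intro exI[of _ 0]) (simp add: isometric_perm)
next
  case (weq_sym xs ys)
  then obtain k l where "isometric (filter ((\<noteq>) 0) xs @ hyp k) (filter ((\<noteq>) 0) ys @ hyp l)" by blast
  then have "isometric (filter ((\<noteq>) 0) ys @ hyp l) (filter ((\<noteq>) 0) xs @ hyp k)" by (rule isometric_sym) auto
  then show ?case by blast
next
  case (weq_trans xs ys zs)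
  then obtain k l k' l' where kl: "isometric (filter ((\<noteq>) 0) xs @ hyp k) (filter ((\<noteq>) 0) ys @ hyp l)"
    "isometric (filter ((\<noteq>) 0) ys @ hyp k') (filter ((\<noteq>) 0) zs @ hyp l')" by blast
  have "isometric ((filter ((\<noteq>) 0) xs @ hyp k) @ hyp k') ((filter ((\<noteq>) 0) ys @ hyp l) @ hyp k')"
    by (intro isometric_append kl isometric_refl)
  moreover have "isometric ((filter ((\<noteq>) 0) ys @ hyp l) @ hyp k') ((filter ((\<noteq>) 0) ys @ hyp k') @ hyp l)"
    by (rule isometric_perm) simp
  moreover have "isometric ((filter ((\<noteq>) 0) ys @ hyp k') @ hyp l) ((filter ((\<noteq>) 0) zs @ hyp l') @ hyp l)"
    by (intro isometric_append kl isometric_refl)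
  ultimately have "isometric (filter ((\<noteq>) 0) xs @ hyp (k + k')) (filter ((\<noteq>) 0) zs @ hyp (l' + l))"
    unfolding hyp_add append_assoc[symmetric] by (rule isometric_trans[OF isometric_trans])
  then show ?case by blast
next
  case (weq_Cons xs ys a)
  then obtain k l where "isometric (filter ((\<noteq>) 0) xs @ hyp k) (filter ((\<noteq>) 0) ys @ hyp l)" by blast
  then show ?case by (intro exI[of _ k] exI[of _ l]) (simp add: isometric_Cons)
next
  case (weq_zero xs)
  show ?case by (intro exI[of _ 0]) simp
next
  case (weq_square c a xs)
  show ?case using isometric_append[OF isometric_square[OF weq_square, of a] isometric_refl] weq_square
    by (intro exI[of _ 0]) simp
next
  case (weq_add a b xs)
  consider "a = 0 \<or> b = 0" | "a \<noteq> 0" "b = - a" | "a \<noteq> 0" "b \<noteq> 0" "a + b \<noteq> 0"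
    by (metis add_eq_0_iff)
  then show ?case
  proof cases
    case 1
    then show ?thesis by (intro exI[of _ 0]) auto
  next
    case 2
    have "isometric ([a, - a] @ filter ((\<noteq>) 0) xs) ([1, - 1] @ filter ((\<noteq>) 0) xs)"
      by (intro isometric_append isometric_hyperbolic two 2 isometric_refl)
    moreover have "isometric ([1, - 1] @ filter ((\<noteq>) 0) xs) (filter ((\<noteq>) 0) xs @ [1, - 1])"
      by (rule isometric_perm) simp
    ultimately have "isometric ([a, - a] @ filter ((\<noteq>) 0) xs) (filter ((\<noteq>) 0) xs @ [1, - 1])"
      by (rule isometric_trans)
    then show ?thesis using 2 by (intro exI[of _ 0] exI[of _ "Suc 0"]) simp
  next
    case 3
    then show ?thesis using isometric_append[OF isometric_add[of a b] isometric_refl]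
      by (intro exI[of _ 0]) simp
  qed
qed

lemma wcls_eq_imp_isometric_hyp:
  assumes two: "(2::'a::field) \<noteq> 0" and "wcls xs = wcls (ys::'a list)" "0 \<notin> set xs" "0 \<notin> set ys"
  obtains k l where "isometric (xs @ hyp k) (ys @ hyp l)"
proof -
  have "filter ((\<noteq>) 0) xs = xs" "filter ((\<noteq>) 0) ys = ys"
    using assms by (auto simp: filter_id_conv)
  then show ?thesis using weq_isometric[of xs ys] that assms by (auto simp: wcls_eq_iff)
qed

lemma isometric_hyp_cancel:
  assumes two: "(2::'a::field) \<noteq> 0" and isometric: "isometric (xs @ hyp k) (ys @ hyp l :: 'a list)" and "k \<le> l"
  shows "isometric xs (ys @ hyp (l - k))"
proof -
  have "isometric (hyp k @ xs) (xs @ hyp k)" by (rule isometric_perm) simp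
  also have "isometric (ys @ hyp l) (hyp k @ (ys @ hyp (l - k)))"
    using assms(3) hyp_add[of k "l - k", where 'a='a] by (intro isometric_perm) simp
  finally (isometric_trans[OF isometric_trans[OF _ isometric]]) have "isometric (hyp k @ xs) (hyp k @ (ys @ hyp (l - k)))" .
  then show ?thesis using isometric_cancel_append[OF two] nonzero_hyp by blast
qed

text \<open>Equal lengths force equally many hyperbolic planes on both sides, and Witt cancellation
  removes them.\<close>

theorem isometric_if_wcls_eq:
  assumes two: "(2::'a::field) \<noteq> 0" and "wcls xs = wcls (ys::'a list)" "0 \<notin> set xs" "0 \<notin> set ys"
    and len: "length xs = length ys"
  shows "isometric xs ys"
proof -
  obtain k l where "isometric (xs @ hyp k) (ys @ hyp l)" using wcls_eq_imp_isometric_hyp assms by blast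
  moreover from this have "k = l" using isometric_length[of "xs @ hyp k" "ys @ hyp l"] len by simp
  ultimately show ?thesis using isometric_hyp_cancel[OF two, of xs k ys l] by simp
qed

lemma bf_eq_0: "\<forall>i<length xs. v i = 0 \<Longrightarrow> bf xs v w = 0"
  by (simp add: bf_def)

text \<open>The relation \<open>rk_add\<close> collects the value at \<open>v\<close> entry by
  entry. An isotropic \<open>v\<close> is allowed: the entry split off is then 0, so that the class
  has a representative shorter by one.\<close>

lemma value_split:
  assumes "\<exists>i<length xs. v i \<noteq> 0"
  shows "\<exists>ys. length ys + 1 = length xs \<and> wcls xs = rk (bf xs v v) + wcls ys \<and>
    (0 \<notin> set xs \<and> bf xs v v \<noteq> 0 \<longrightarrow> 0 \<notin> set ys)"
  using assms
proof (induct xs arbitrary: v)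
  case (Cons x xs)
  let ?v = "\<lambda>i. v (Suc i)"
  let ?b = "bf xs ?v ?v" let ?a = "x * v 0 * v 0"
  have rk_a: "rk ?a = rk x" if "v 0 \<noteq> 0"
    using rk_square[OF that, of x] by (simp add: power2_eq_square mult.assoc)
  show ?case
  proof (cases "v 0 \<noteq> 0 \<and> ?b = 0")
    case True
    then show ?thesis using rk_a by (intro exI[of _ xs]) auto
  next
    case False
    have "\<exists>i<length xs. ?v i \<noteq> 0"
    proof (rule ccontr)
      assume 0: "\<not> ?thesis"
      then have "?b = 0" by (simp add: bf_eq_0)
      moreover have "v 0 \<noteq> 0" using 0 Cons.prems by (auto simp: less_Suc_eq_0_disj)
      ultimately show False using False by blast
    qed
    from Cons.hyps[OF this] obtain ys where ys: "length ys + 1 = length xs" "wcls xs = rk ?b + wcls ys"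
      "0 \<notin> set xs \<and> ?b \<noteq> 0 \<longrightarrow> 0 \<notin> set ys" by blast
    show ?thesis
    proof (cases "v 0 = 0")
      case True
      then show ?thesis using ys by (intro exI[of _ "x # ys"]) auto
    next
      case v0: False
      have "rk x + rk ?b = rk (?a + ?b) + rk (?a * ?b * (?a + ?b))"
        unfolding rk_a[OF v0, symmetric] by (rule rk_add)
      then have "wcls (x # xs) = rk (bf (x # xs) v v) + wcls (?a * ?b * (?a + ?b) # ys)"
        using ys(2) by (simp flip: add.assoc)
      then show ?thesis using ys(1,3) v0 False
        by (intro exI[of _ "?a * ?b * (?a + ?b) # ys"]) auto
    qed
  qed
qed simp

lemma value_split_nonzero:
  assumes "bf xs v v \<noteq> 0" "0 \<notin> set xs"
  shows "\<exists>ys. 0 \<notin> set ys \<and> length ys + 1 = length xs \<and> wcls xs = rk (bf xs v v) + wcls ys"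
proof -
  have "\<exists>i<length xs. v i \<noteq> 0" using assms(1) bf_eq_0[of xs v v] by auto
  from value_split[OF this] show ?thesis using assms by auto
qed

text \<open>Since \<open>xs\<close> represents the first entry \<open>b\<close> of
  \<open>ys\<close>, it is isometric to some \<open>b # zs\<close>, and cancellation compares
  \<open>zs\<close> with the rest of \<open>ys\<close>.\<close>

lemma isometric_wcls:
  assumes two: "(2::'a::field) \<noteq> 0" and "isometric xs (ys::'a list)" "0 \<notin> set xs" "0 \<notin> set ys"
  shows "wcls xs = wcls ys"
  using assms(2-)
proof (induct ys arbitrary: xs)
  case Nil
  then show ?case by (auto dest: isometric_length)
next
  case (Cons b ys)
  obtain T where T: "\<And>v w. bf xs (T v) (T w) = bf (b # ys) v w"
    using Cons.prems(1) unfolding isometric_def by blast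
  have v: "bf xs (T (unit_fun 0)) (T (unit_fun 0)) = b"
    unfolding T using bf_unit[of 0 "b # ys"] by (simp add: unit_fun_def)
  then obtain zs where zs: "0 \<notin> set zs" "length zs + 1 = length xs" "wcls xs = rk b + wcls zs"
    using value_split_nonzero[of xs "T (unit_fun 0)"] Cons.prems unfolding v by auto
  have iz: "isometric xs (b # zs)"
    using zs Cons.prems by (intro isometric_if_wcls_eq[OF two]) auto
  then have "isometric (b # zs) xs" using isometric_sym[OF iz] zs Cons.prems by auto
  then have "isometric (b # zs) (b # ys)" using Cons.prems(1) by (rule isometric_trans)
  then have "isometric zs ys" using isometric_cancel[OF two] Cons.prems(3) by auto
  then have "wcls zs = wcls ys" using zs(1) Cons.prems(3) by (intro Cons.hyps) auto
  then show ?case using zs(3) by simp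
qed

text \<open>If \<open>T v\<close> vanishes, then \<open>v\<close> is orthogonal to all unit vectors,
  so it vanishes as well.\<close>

lemma isometric_anis:
  assumes "isometric xs ys" "anis xs" "0 \<notin> set ys"
  shows "anis ys"
  unfolding anis_def
proof (intro allI impI)
  fix v i assume v: "bf ys v v = 0" and i: "i < length ys"
  obtain T where T: "\<And>v w. bf xs (T v) (T w) = bf ys v w" and len: "length xs = length ys"
    using assms unfolding isometric_def by blast
  have "\<forall>i<length xs. T v i = 0" using v assms(2) unfolding anis_def T[symmetric] by blast
  then have "bf xs (T (unit_fun i)) (T v) = 0" by (simp add: bf_def)
  then show "v i = 0" unfolding T using i assms(3) by (auto simp: bf_unit in_set_conv_nth)
qed

lemma anis_append_hyp: "anis (xs @ hyp k) \<Longrightarrow> k = 0"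
proof (cases k)
  case (Suc j)
  assume "anis (xs @ hyp k)"
  then have "anis ([1, - 1] @ hyp j :: 'a list)" unfolding Suc using anis_append(2) by auto
  then have "anis [1, - 1 :: 'a]" by (rule anis_append)
  moreover have "bf [1, - 1 :: 'a] (\<lambda>_. 1) (\<lambda>_. 1) = 0" by simp
  ultimately have "\<forall>i<length [1, - 1 :: 'a]. (1::'a) = 0" unfolding anis_def by blast
  from this[rule_format, of 0] show ?thesis by simp
qed

text \<open>After cancellation one form is isometric to the other plus the surplus hyperbolic
  planes, and anisotropy leaves no surplus.\<close>

theorem anis_unique:
  assumes two: "(2::'a::field) \<noteq> 0" and "anis xs" "anis (ys::'a list)" "wcls xs = wcls ys"
  shows "isometric xs ys"
proof -
  have nz: "0 \<notin> set xs" "0 \<notin> set ys" using assms anis_nonzero by auto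
  then obtain k l where kl: "isometric (xs @ hyp k) (ys @ hyp l)"
    using wcls_eq_imp_isometric_hyp assms by blast
  show ?thesis
  proof (cases "k \<le> l")
    case True
    then have 1: "isometric xs (ys @ hyp (l - k))" using isometric_hyp_cancel[OF two kl] by simp
    then have "anis (ys @ hyp (l - k))" using assms nz by (auto intro: isometric_anis)
    then have "l - k = 0" by (rule anis_append_hyp)
    then show ?thesis using 1 by simp
  next
    case False
    have "isometric (ys @ hyp l) (xs @ hyp k)" using isometric_sym[OF kl] nz by auto
    then have 1: "isometric ys (xs @ hyp (k - l))" using isometric_hyp_cancel[OF two] False by simp
    then have "anis (xs @ hyp (k - l))" using assms nz by (auto intro: isometric_anis)
    then have "k - l = 0" by (rule anis_append_hyp)
    then have "isometric ys xs" using 1 by simp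
    then show ?thesis using isometric_sym nz by blast
  qed
qed

text \<open>As long as there is an isotropic vector, \<open>value_split\<close> splits off the entry
  0 and shortens the list without changing its class.\<close>

lemma anis_rep:
  "\<exists>ys. anis ys \<and> wcls ys = wcls xs \<and> length ys \<le> length xs \<and> (\<not> anis xs \<longrightarrow> length ys < length xs)"
proof (induct "length xs" arbitrary: xs rule: less_induct)
  case less
  show ?case
  proof (cases "anis xs")
    case False
    then obtain v i where v: "bf xs v v = 0" "i < length xs" "v i \<noteq> 0" by (auto simp: anis_def)
    then obtain ys where ys: "length ys + 1 = length xs" "wcls xs = wcls ys"
      using value_split[of xs v] by auto
    then have "length ys < length xs" by simp
    then obtain zs where "anis zs" "wcls zs = wcls ys" "length zs \<le> length ys" using less by blast
    then show ?thesis using ys by (intro exI[of _ zs]) auto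
  next
    case True
    then show ?thesis by blast
  qed
qed

lemma witt_anis_rep: "\<exists>xs. anis xs \<and> wcls xs = x"
proof -
  obtain xs where "x = wcls xs" using wcls_surj by blast
  then show ?thesis using anis_rep[of xs] by auto
qed

lemma anis_length_le:
  assumes two: "(2::'a::field) \<noteq> 0" and "anis xs" "wcls xs = wcls (ys::'a list)"
  shows "length xs \<le> length ys" and "length xs = length ys \<Longrightarrow> anis ys"
proof -
  obtain zs where zs: "anis zs" "wcls zs = wcls ys" "length zs \<le> length ys"
    "\<not> anis ys \<Longrightarrow> length zs < length ys" using anis_rep[of ys] by auto
  have "isometric xs zs" using zs(1,2) assms(2,3) by (intro anis_unique two) auto
  then have "length xs = length zs" by (rule isometric_length)
  with zs show "length xs \<le> length ys" "length xs = length ys \<Longrightarrow> anis ys" by auto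
qed

lemma anis_wcls_0: "(2::'a::field) \<noteq> 0 \<Longrightarrow> anis (xs::'a list) \<Longrightarrow> wcls xs = 0 \<Longrightarrow> xs = []"
  using anis_length_le(1)[of xs "[]"] by simp

lemma represents_split:
  assumes two: "(2::'a::field) \<noteq> 0" and "0 \<notin> set (xs::'a list)" "bf xs u u = b" "b \<noteq> 0"
  obtains ys where "0 \<notin> set ys" "isometric xs (b # ys)" "length ys + 1 = length xs"
proof -
  obtain ys where ys: "0 \<notin> set ys" "length ys + 1 = length xs" "wcls xs = rk b + wcls ys"
    using value_split_nonzero[of xs u] assms by auto
  moreover have "isometric xs (b # ys)" using ys assms by (intro isometric_if_wcls_eq[OF two]) auto
  ultimately show ?thesis using that by blast
qed

text \<open>As in Witt cancellation, a reflection moves the image of \<open>u\<close> to the first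
  unit vector up to sign. The image of \<open>w\<close> is orthogonal to it and so has first
  coordinate 0.\<close>

lemma represents_orthogonal_split:
  assumes two: "(2::'a::field) \<noteq> 0" and iso: "isometric (b # ys) (xs::'a list)"
    and b: "b \<noteq> 0" and u: "bf xs u u = b" and uw: "bf xs u w = 0"
  shows "\<exists>w'. bf ys w' w' = bf xs w w"
proof -
  let ?e = "unit_fun 0 :: nat \<Rightarrow> 'a"
  obtain T where T: "\<And>v w. bf (b # ys) (T v) (T w) = bf xs v w"
    using iso unfolding isometric_def by blast
  have e: "bf (b # ys) ?e w = b * w 0" for w using bf_unit[of 0 "b # ys" w] by simp
  have "bf (b # ys) (T u) (T u) = bf (b # ys) ?e ?e" "bf (b # ys) ?e ?e \<noteq> 0"
    unfolding T u e using b by (simp_all add: unit_fun_def)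
  then obtain R c where R: "\<And>v w. bf (b # ys) (R v) (R w) = bf (b # ys) v w"
    and c: "R (T u) = (\<lambda>i. c * ?e i)" "c = 1 \<or> c = - 1"
    using reflection_transitive[OF two] by metis
  have "bf (b # ys) (R (T u)) (R (T w)) = 0" unfolding R T uw ..
  then have 0: "R (T w) 0 = 0" unfolding c(1) bf_scale e using b c(2) by auto
  have "bf (b # ys) (R (T w)) (R (T w)) = bf xs w w" unfolding R T ..
  then show ?thesis using 0 by auto
qed

section \<open>Pfister forms and powers of the fundamental ideal\<close>

text \<open>The sign convention is that the one-fold Pfister form of \<open>a\<close> is <1,
  -a>.\<close>

definition pf :: "'a::field list \<Rightarrow> 'a witt" where
  "pf as = prod_list (map (\<lambda>a. 1 - rk a) as)"

definition psum :: "('a::field \<times> 'a list) list \<Rightarrow> 'a witt" where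
  "psum L = (\<Sum>(b, as)\<leftarrow>L. rk b * pf as)"

definition pfister_terms :: "nat \<Rightarrow> ('a::field \<times> 'a list) list \<Rightarrow> bool" where
  "pfister_terms n L \<longleftrightarrow> (\<forall>(b, as)\<in>set L. b \<noteq> 0 \<and> length as = n \<and> 0 \<notin> set as)"

text \<open>This is the n-th power of the fundamental ideal, see
  \<open>fundamental_ideal_power_eq\<close>. The terms are kept in a list because the Hauptsatz is
  proved by induction on their number.\<close>

definition IW :: "nat \<Rightarrow> 'a::field witt set" where
  "IW n = {psum L | L. pfister_terms n L}"

lemma pf_simps [simp]: "pf [] = 1" "pf (a # as) = (1 - rk a) * pf as"
  by (simp_all add: pf_def)

lemma psum_simps [simp]: "psum [] = 0" "psum ((b, as) # L) = rk b * pf as + psum L"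
  "psum (L @ L') = psum L + psum L'"
  by (simp_all add: psum_def)

lemma pfister_terms_simps [simp]: "pfister_terms n []"
  "pfister_terms n ((b, as) # L) \<longleftrightarrow> b \<noteq> 0 \<and> length as = n \<and> 0 \<notin> set as \<and> pfister_terms n L"
  "pfister_terms n (L @ L') \<longleftrightarrow> pfister_terms n L \<and> pfister_terms n L'"
  by (auto simp: pfister_terms_def)

lemma IW_induct [consumes 1, case_names zero add]:
  assumes "x \<in> IW n" and "P 0"
    and "\<And>b as x. b \<noteq> 0 \<Longrightarrow> length as = n \<Longrightarrow> 0 \<notin> set as \<Longrightarrow> x \<in> IW n \<Longrightarrow> P x \<Longrightarrow> P (rk b * pf as + x)"
  shows "P x"
proof -
  have "pfister_terms n L \<Longrightarrow> psum L \<in> IW n \<and> P (psum L)" for L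
  proof (induct L)
    case (Cons p L)
    obtain b as where "p = (b, as)" by fastforce
    moreover from this have "psum (p # L) \<in> IW n" if "pfister_terms n (p # L)"
      using that unfolding IW_def by blast
    ultimately show ?case using Cons assms(3)[of b as "psum L"] by auto
  qed (use assms(2) in \<open>auto simp: IW_def intro: exI[of _ "[]"]\<close>)
  then show ?thesis using assms(1) by (auto simp: IW_def)
qed

lemma IW_0 [simp]: "0 \<in> IW n"
  unfolding IW_def by (auto intro: exI[of _ "[]"])

lemma IW_add: "x \<in> IW n \<Longrightarrow> y \<in> IW n \<Longrightarrow> x + y \<in> IW n"
  unfolding IW_def
proof (clarsimp)
  fix L L' :: "('a \<times> 'a list) list"
  assume "pfister_terms n L" "pfister_terms n L'"
  then show "\<exists>L''. psum L + psum L' = psum L'' \<and> pfister_terms n L''"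
    by (intro exI[of _ "L @ L'"]) simp
qed

lemma IW_pf: "b \<noteq> 0 \<Longrightarrow> length as = n \<Longrightarrow> 0 \<notin> set as \<Longrightarrow> rk b * pf as \<in> IW n"
  unfolding IW_def by (auto intro: exI[of _ "[(b, as)]"])

lemma IW_rk_mult: "x \<in> IW n \<Longrightarrow> rk a * x \<in> IW n"
proof (induct rule: IW_induct)
  case (add b as x)
  show ?case
  proof (cases "a = 0")
    case False
    then have "rk (a * b) * pf as \<in> IW n" using add by (intro IW_pf) auto
    then show ?thesis using add IW_add by (simp add: distrib_left rk_mult mult.assoc)
  qed simp
qed simp

lemma IW_uminus: "x \<in> IW n \<Longrightarrow> - x \<in> IW n"
  using IW_rk_mult[of x n "- 1"] by (simp add: rk_uminus)

lemma IW_diff: "x \<in> IW n \<Longrightarrow> y \<in> IW n \<Longrightarrow> x - y \<in> IW n"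
  using IW_add[of x n "- y"] IW_uminus[of y n] by simp

lemma IW_mult: "x \<in> IW n \<Longrightarrow> y * x \<in> IW n"
  by (induct y rule: witt_induct) (simp_all add: distrib_right IW_add IW_rk_mult)

lemma IW_Suc_mult: "x \<in> IW n \<Longrightarrow> a \<noteq> 0 \<Longrightarrow> (1 - rk a) * x \<in> IW (Suc n)"
proof (induct rule: IW_induct)
  case (add b as x)
  have "rk b * pf (a # as) \<in> IW (Suc n)" using add by (intro IW_pf) auto
  then have "rk b * pf (a # as) + (1 - rk a) * x \<in> IW (Suc n)" using add by (intro IW_add) auto
  then show ?case by (simp add: algebra_simps)
qed simp

lemma IW_Suc_mult_plus: "x \<in> IW n \<Longrightarrow> a \<noteq> 0 \<Longrightarrow> (1 + rk a) * x \<in> IW (Suc n)"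
  using IW_Suc_mult[of x n "- a"] by (simp add: rk_uminus)

lemma IW_Suc_subset: "x \<in> IW (Suc n) \<Longrightarrow> x \<in> IW n"
proof (induct rule: IW_induct)
  case (add b as x)
  then obtain a as' where as: "as = a # as'" by (cases as) auto
  have "rk b * pf as' \<in> IW n" using add as by (intro IW_pf) auto
  from IW_mult[OF this, of "1 - rk a"] have "rk b * pf as \<in> IW n" by (simp add: as ac_simps)
  then show ?case using add by (intro IW_add)
qed simp

lemma IW_zero [simp]: "IW 0 = UNIV"
  using IW_mult[of 1 0] IW_pf[of 1 "[]" 0] by auto

lemma rk_rk_IW1: "a \<noteq> 0 \<Longrightarrow> b \<noteq> 0 \<Longrightarrow> rk a + rk b \<in> IW 1"
proof -
  assume ab: "a \<noteq> 0" "b \<noteq> 0"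
  have "rk a + rk b = rk a * pf [- (a * b)]"
    using rk_mult_self[OF ab(1)] by (simp add: rk_uminus rk_mult distrib_left flip: mult.assoc)
  then show ?thesis using ab IW_pf[of a "[- (a * b)]" 1] by simp
qed

lemma wcls_even_IW1: "0 \<notin> set xs \<Longrightarrow> even (length xs) \<Longrightarrow> wcls xs \<in> IW 1"
proof (induct xs rule: induct_list012)
  case (3 x y zs)
  then have "rk x + rk y + wcls zs \<in> IW 1" by (intro IW_add rk_rk_IW1) auto
  then show ?case by (simp add: add.assoc)
qed simp_all

lemma IW1_even:
  assumes "x \<in> IW 1"
  shows "\<exists>xs. 0 \<notin> set xs \<and> even (length xs) \<and> wcls xs = x"
  using assms
proof (induct rule: IW_induct)
  case zero
  show ?case by (intro exI[of _ "[]"]) simp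
next
  case (add b as x)
  then obtain xs a where xs: "0 \<notin> set xs" "even (length xs)" "wcls xs = x" "as = [a]"
    by (auto simp: length_Suc_conv)
  have "wcls (b # - (b * a) # xs) = rk b * pf as + x"
    using xs by (simp add: rk_uminus rk_mult algebra_simps)
  then show ?case using xs add by (intro exI[of _ "b # - (b * a) # xs"]) auto
qed

lemma IW_mult_IW1: "y \<in> IW 1 \<Longrightarrow> x \<in> IW n \<Longrightarrow> x * y \<in> IW (Suc n)"
proof (induct y rule: IW_induct)
  case (add b as y)
  then obtain a where a: "as = [a]" by (auto simp: length_Suc_conv)
  have "rk b * ((1 - rk a) * x) \<in> IW (Suc n)" using add a by (intro IW_rk_mult IW_Suc_mult) auto
  then have "rk b * ((1 - rk a) * x) + x * y \<in> IW (Suc n)" using add by (intro IW_add) auto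
  then show ?case using a by (simp add: algebra_simps)
qed simp

section \<open>Diagonal Pfister forms and their roundness\<close>

fun pflist :: "'a::field list \<Rightarrow> 'a list" where
  "pflist [] = [1]"
| "pflist (a # as) = pflist as @ map ((*) (- a)) (pflist as)"

lemma length_pflist [simp]: "length (pflist as) = 2 ^ length as"
  by (induct as) simp_all

lemma pflist_nonzero: "0 \<notin> set as \<Longrightarrow> 0 \<notin> set (pflist as)"
  by (induct as) auto

lemma hd_pflist: "\<exists>xs. pflist as = 1 # xs"
  by (induct as) auto

text \<open>Write d = x - a y with values x, y of the form of \<open>as\<close>. By induction
  \<open>rk x\<close> and \<open>rk y\<close> fix \<open>pf as\<close>, and the claim results from
  multiplying \<open>rk_add\<close> for x and -a y by \<open>pf as\<close>. The cases x = 0 and y =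
  0 are separate, since the induction hypothesis is about nonzero values.\<close>

lemma pfister_round:
  assumes "0 \<notin> set as" "bf (pflist as) v v = d" "d \<noteq> 0"
  shows "rk d * pf as = pf as"
  using assms
proof (induct as arbitrary: v d)
  case Nil
  then show ?case using rk_square_1[of "v 0"] by (auto simp: power2_eq_square)
next
  case (Cons a as)
  define x where "x = bf (pflist as) v v"
  define v' where "v' = (\<lambda>i. v (length (pflist as) + i))"
  define y where "y = bf (pflist as) v' v'"
  have d: "d = x + - a * y" using Cons.prems(2)
    by (simp add: bf_append bf_map_mult x_def y_def v'_def)
  have x: "rk x * pf as = pf as" if "x \<noteq> 0"
    using Cons.hyps[of v x] Cons.prems that by (simp add: x_def)
  have y: "rk y * pf as = pf as" if "y \<noteq> 0"
    using Cons.hyps[of v' y] Cons.prems that by (simp add: y_def)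
  have a: "rk a * rk a = 1" using Cons.prems by (intro rk_mult_self) auto
  consider "x = 0" "y \<noteq> 0" | "x \<noteq> 0" "y = 0" | "x \<noteq> 0" "y \<noteq> 0"
    using Cons.prems d by force
  then show ?case
  proof cases
    case 1
    have "rk d * pf (a # as) = - rk a * (1 - rk a) * (rk y * pf as)"
      using 1 d by (simp add: rk_uminus rk_mult algebra_simps)
    also have "\<dots> = pf (a # as)" using y[OF 1(2)] a by (simp add: algebra_simps flip: mult.assoc)
    finally show ?thesis .
  next
    case 2
    have "rk d * pf (a # as) = (1 - rk a) * (rk x * pf as)"
      using 2 d by (simp add: algebra_simps)
    then show ?thesis using x[OF 2(1)] by simp
  next
    case 3
    have "(rk x + rk (- a * y)) * pf as = (rk d + rk (x * (- a * y) * d)) * pf as"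
      unfolding d by (subst rk_add) simp
    moreover have "(rk x + rk (- a * y)) * pf as = rk x * pf as - rk a * (rk y * pf as)"
      by (simp add: rk_uminus rk_mult algebra_simps)
    moreover have "(rk d + rk (x * (- a * y) * d)) * pf as
        = rk d * pf as - rk d * rk a * (rk x * (rk y * pf as))"
      by (simp add: rk_uminus rk_mult algebra_simps)
    ultimately have "rk x * pf as - rk a * (rk y * pf as)
        = rk d * pf as - rk d * rk a * (rk x * (rk y * pf as))" by metis
    then have "pf as - rk a * pf as = rk d * pf as - rk d * rk a * pf as"
      unfolding y[OF 3(2)] x[OF 3(1)] .
    then show ?thesis by (simp add: algebra_simps)
  qed
qed

subsection \<open>Base change\<close>

context field_hom
begin

lemma witt_map_hom: "witt_map (\<lambda>a. rk (hom a))"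
proof
  show "rk (hom (a * c\<^sup>2)) = rk (hom a)" if "c \<noteq> 0" for a c
    using that rk_square[of "hom c" "hom a"] by (simp add: hom_distribs)
  show "rk (hom a) + rk (hom b) = rk (hom (a + b)) + rk (hom (a * b * (a + b)))" for a b
    using rk_add[of "hom a" "hom b"] by (simp add: hom_distribs)
qed simp

interpretation wm: witt_map "\<lambda>a. rk (hom a)"
  by (rule witt_map_hom)

definition wbc :: "'a witt \<Rightarrow> 'b witt" where
  "wbc = wlift (\<lambda>a. rk (hom a))"

lemma wbc_rk [simp]: "wbc (rk a) = rk (hom a)" and wbc_0 [simp]: "wbc 0 = 0"
  and wbc_add: "wbc (x + y) = wbc x + wbc y"
  and wbc_diff: "wbc (x - y) = wbc x - wbc y"
  by (simp_all add: wbc_def wm.wlift_add wm.wlift_diff)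

lemma wbc_wcls: "wbc (wcls xs) = wcls (map hom xs)"
  by (induct xs) (simp_all add: wbc_add)

lemma wbc_rk_mult: "wbc (rk a * x) = rk (hom a) * wbc x"
  by (induct x rule: witt_induct) (simp_all add: wbc_add distrib_left hom_distribs flip: rk_mult)

lemma wbc_mult: "wbc (x * y) = wbc x * wbc y"
  by (induct x rule: witt_induct) (simp_all add: wbc_add distrib_right wbc_rk_mult)

lemma wbc_1 [simp]: "wbc 1 = 1"
  using wbc_rk[of 1] by simp

lemma wbc_pf: "wbc (pf as) = pf (map hom as)"
  by (induct as) (simp_all add: wbc_mult wbc_diff)

lemma wbc_psum: "wbc (psum L) = psum (map (\<lambda>(b, as). (hom b, map hom as)) L)"
  by (induct L) (auto simp: wbc_add wbc_mult wbc_pf)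

lemma pfister_terms_map: "pfister_terms n L \<Longrightarrow> pfister_terms n (map (\<lambda>(b, as). (hom b, map hom as)) L)"
  by (induct L) auto

lemma wbc_IW: "x \<in> IW n \<Longrightarrow> wbc x \<in> IW n"
  unfolding IW_def by (auto simp: wbc_psum dest: pfister_terms_map)

lemma bf_map_hom: "bf (map hom xs) (\<lambda>i. hom (v i)) (\<lambda>i. hom (w i)) = hom (bf xs v w)"
  by (simp add: bf_def hom_distribs)

end

section \<open>The Cassels--Pfister theorem\<close>

definition qpol :: "'a::field list \<Rightarrow> (nat \<Rightarrow> 'a poly) \<Rightarrow> (nat \<Rightarrow> 'a poly) \<Rightarrow> 'a poly" where
  "qpol xs f g = (\<Sum>i<length xs. smult (xs ! i) (f i * g i))"

lemma qpol_commute: "qpol xs f g = qpol xs g f"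
  by (simp add: qpol_def mult.commute)

lemma qpol_add: "qpol xs (\<lambda>i. f i + f' i) g = qpol xs f g + qpol xs f' g"
  "qpol xs f (\<lambda>i. g i + g' i) = qpol xs f g + qpol xs f g'"
  by (simp_all add: qpol_def algebra_simps smult_add_right sum.distrib)

lemma qpol_mult: "qpol xs (\<lambda>i. p * f i) g = p * qpol xs f g"
  "qpol xs f (\<lambda>i. p * g i) = p * qpol xs f g"
  by (simp_all add: qpol_def sum_distrib_left algebra_simps)

lemma coeff_mult_degree_le:
  assumes "degree p \<le> m" "degree q \<le> n"
  shows "coeff (p * q) (m + n) = coeff p m * coeff (q :: 'a::idom poly) n"
proof (cases "degree p = m \<and> degree q = n")
  case True
  then show ?thesis using coeff_mult_degree_sum[of p q] by simp
next
  case False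
  then have "degree p < m \<or> degree q < n" using assms by linarith
  moreover have "degree (p * q) < m + n"
    using degree_mult_le[of p q] False assms by linarith
  ultimately show ?thesis by (auto simp: coeff_eq_0)
qed

lemma coeff_qpol_lead:
  assumes "\<And>i. i < length xs \<Longrightarrow> degree (f i) \<le> e"
  shows "coeff (qpol xs f f) (2 * e) = bf xs (\<lambda>i. coeff (f i) e) (\<lambda>i. coeff (f i) e)"
  using coeff_mult_degree_le[OF assms assms]
  by (simp add: qpol_def coeff_sum bf_def mult_2 mult.assoc)

text \<open>Leading terms cannot cancel: the coefficients at the highest degree \<open>e\<close>
  form a nonzero vector, and its value is the coefficient at \<open>2 * e\<close>.\<close>

lemma anis_degree_le:
  assumes "anis xs" "i < length xs"
  shows "2 * degree (f i) \<le> degree (qpol xs f f)"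
proof -
  define e where "e = Max ((\<lambda>i. degree (f i)) ` {..<length xs})"
  have ne: "{..<length xs} \<noteq> {}" using assms by auto
  have le: "degree (f j) \<le> e" if "j < length xs" for j
    using that unfolding e_def by (intro Max_ge) auto
  obtain j where j: "j < length xs" "e = degree (f j)"
    using Max_in[of "(\<lambda>i. degree (f i)) ` {..<length xs}"] ne unfolding e_def[symmetric] by auto
  show ?thesis
  proof (cases "e = 0")
    case True
    then show ?thesis using le[OF assms(2)] by simp
  next
    case False
    then have "coeff (f j) e \<noteq> 0" using j by (metis degree_0 leading_coeff_0_iff)
    then have "bf xs (\<lambda>i. coeff (f i) e) (\<lambda>i. coeff (f i) e) \<noteq> 0"
      using assms(1) j(1) unfolding anis_def by metis
    then have "coeff (qpol xs f f) (2 * e) \<noteq> 0" using coeff_qpol_lead[of xs f e] le by simp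
    then have "2 * e \<le> degree (qpol xs f f)" by (rule le_degree)
    then show ?thesis using le[OF assms(2)] by linarith
  qed
qed

text \<open>The degree of the polynomial 0 is 0, so \<open>anis_degree_le\<close> reduces the claim
  to constants.\<close>

lemma anis_qpol_0:
  assumes "anis xs" "qpol xs f f = 0" "i < length xs"
  shows "f i = 0"
proof -
  have deg: "degree (f j) \<le> 0" if "j < length xs" for j
    using anis_degree_le[OF assms(1) that, of f] assms(2) by simp
  have "bf xs (\<lambda>i. coeff (f i) 0) (\<lambda>i. coeff (f i) 0) = 0"
    using coeff_qpol_lead[of xs f 0] deg assms(2) by simp
  then have "coeff (f i) 0 = 0" using assms unfolding anis_def by metis
  moreover have "degree (f i) = 0" using deg[OF assms(3)] by simp
  then obtain c where "f i = [:c:]" using degree_eq_zeroE by blast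
  ultimately show ?thesis by simp
qed

lemma degree_qpol_le:
  assumes "\<And>i. i < length xs \<Longrightarrow> degree (f i) \<le> e"
  shows "degree (qpol xs f f) \<le> 2 * e"
  unfolding qpol_def
proof (intro degree_sum_le)
  fix i assume "i \<in> {..<length xs}"
  then have "degree (f i * f i) \<le> 2 * e"
    using degree_mult_le[of "f i" "f i"] assms[of i] by simp
  then show "degree (smult (xs ! i) (f i * f i)) \<le> 2 * e"
    using degree_smult_le[of "xs ! i" "f i * f i"] by linarith
qed simp

text \<open>The descent step replaces the point \<open>f/g\<close> of the quadric \<open>\<phi> = h\<close> by the second
  intersection of the quadric with the line through \<open>f/g\<close> and its polynomial part \<open>f div g\<close>.\<close>

theorem cassels:
  fixes h :: "'a::field poly"
  assumes "anis xs" "g \<noteq> 0" "qpol xs f f = g * g * h"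
  shows "\<exists>f'. qpol xs f' f' = h"
  using assms(2,3)
proof (induct "degree g" arbitrary: f g rule: less_induct)
  case less
  show ?case
  proof (cases "degree g = 0")
    case True
    then obtain c where c: "g = [:c:]" using degree_eq_zeroE by blast
    then have "c \<noteq> 0" using less.prems by auto
    moreover have "qpol xs (\<lambda>i. [:1 / c:] * f i) (\<lambda>i. [:1 / c:] * f i) = [:1 / c:] * [:1 / c:] * (g * g * h)"
      unfolding qpol_mult less.prems by (simp add: mult.assoc)
    ultimately have "qpol xs (\<lambda>i. [:1 / c:] * f i) (\<lambda>i. [:1 / c:] * f i) = h"
      by (simp add: c)
    then show ?thesis by blast
  next
    case deg: False
    define q where "q i = f i div g" for i
    define r where "r i = f i mod g" for i
    have f: "f = (\<lambda>i. g * q i + r i)" by (simp add: q_def r_def fun_eq_iff)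
    show ?thesis
    proof (cases "\<forall>i<length xs. r i = 0")
      case True
      then have "qpol xs f f = qpol xs (\<lambda>i. g * q i) (\<lambda>i. g * q i)"
        unfolding f by (simp add: qpol_def)
      then have "g * g * qpol xs q q = g * g * h"
        unfolding less.prems qpol_mult by (metis mult.assoc)
      then have "qpol xs q q = h" using less.prems(1) by (metis mult_cancel_left mult_eq_0_iff)
      then show ?thesis by blast
    next
      case False
      define A where "A = qpol xs q q - h"
      define B where "B = 2 * (h * g - qpol xs f q)"
      define f' where "f' i = A * f i + B * q i" for i
      define g' where "g' = A * g + B"
      have fq: "qpol xs q f = qpol xs f q" by (rule qpol_commute)
      have "qpol xs f' f' = A * A * qpol xs f f + 2 * A * B * qpol xs f q + B * B * qpol xs q q"
        unfolding f'_def qpol_add qpol_mult fq by (simp add: algebra_simps)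
      also have "\<dots> = g' * g' * h"
        unfolding less.prems g'_def A_def B_def by (simp add: algebra_simps)
      finally have 1: "qpol xs f' f' = g' * g' * h" .
      have r: "r = (\<lambda>i. f i + (- g) * q i)" using f by (simp add: fun_eq_iff)
      have "qpol xs r r = qpol xs f f - 2 * g * qpol xs f q + g * g * qpol xs q q"
        unfolding r qpol_add qpol_mult fq by (simp add: algebra_simps)
      also have "\<dots> = g' * g"
        unfolding less.prems g'_def A_def B_def by (simp add: algebra_simps)
      finally have 2: "qpol xs r r = g' * g" .
      \<comment> \<open>\<open>g' * g\<close> is the value at the remainders \<open>r\<close>:
        anisotropy makes it nonzero, and the degree bound for remainders makes the degree of
        \<open>g'\<close> smaller than that of \<open>g\<close>.\<close>
      have "qpol xs r r \<noteq> 0" using False anis_qpol_0[OF assms(1)] by blast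
      then have g': "g' \<noteq> 0" using 2 by auto
      have "degree (r i) \<le> degree g - 1" for i
        using degree_mod_less'[of g "f i"] deg less.prems(1) unfolding r_def by (cases "f i mod g = 0") auto
      then have "degree (g' * g) \<le> 2 * (degree g - 1)"
        unfolding 2[symmetric] by (intro degree_qpol_le)
      then have "degree g' < degree g"
        using degree_mult_eq[OF g' less.prems(1)] deg by simp
      then show ?thesis using less.hyps 1 g' by blast
    qed
  qed
qed

text \<open>A polynomial representation has components of degree at most 1, say u T + w; the three
  equations compare its coefficients with those of b T^2 + d.\<close>

lemma cassels_quadratic:
  fixes b d :: "'a::field"
  assumes two: "(2::'a) \<noteq> 0" and anis: "anis xs" and "g \<noteq> 0" and "qpol xs f f = g * g * [:d, 0, b:]"
  shows "\<exists>u w. bf xs u u = b \<and> bf xs w w = d \<and> bf xs u w = 0"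
proof -
  obtain f where f: "qpol xs f f = [:d, 0, b:]" using cassels[OF anis assms(3,4)] by blast
  define u where "u i = coeff (f i) 1" for i
  define w where "w i = coeff (f i) 0" for i
  have deg: "degree (f i) \<le> 1" if "i < length xs" for i
    using anis_degree_le[OF anis that, of f] f by (auto split: if_splits)
  have "bf xs u u = b"
    using coeff_qpol_lead[of xs f 1] deg f by (simp add: u_def[abs_def] numeral_2_eq_2)
  moreover have "coeff (qpol xs f f) 0 = bf xs w w"
    by (simp add: qpol_def coeff_sum bf_def w_def coeff_mult_0 mult.assoc)
  then have "bf xs w w = d" using f by simp
  moreover have "coeff (qpol xs f f) 1 = 2 * bf xs u w"
    by (simp add: qpol_def coeff_sum bf_def w_def u_def coeff_mult sum_distrib_left algebra_simps)
  then have "bf xs u w = 0" using f two by simp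
  ultimately show ?thesis by blast
qed

lemma (in field_hom) map_pflist: "map hom (pflist as) = pflist (map hom as)"
proof (induct as)
  case (Cons a as)
  show ?case by (simp add: hom_distribs comp_def flip: Cons)
qed simp

section \<open>The Hauptsatz over a field isomorphic to its own rational function field\<close>

lemma common_denominator:
  fixes e :: "'p::idom \<Rightarrow> 'b::field" and k :: nat
  assumes mult: "\<And>p q. e (p * q) = e p * e q" and gen: "\<And>z. \<exists>p q. q \<noteq> 0 \<and> z * e q = e p"
  shows "\<exists>f g. g \<noteq> 0 \<and> (\<forall>i<k. v i * e g = e (f i))"
proof (induct k)
  case (Suc k)
  then obtain f g where fg: "g \<noteq> 0" "\<And>i. i < k \<Longrightarrow> v i * e g = e (f i)" by blast
  obtain p q where pq: "q \<noteq> 0" "v k * e q = e p" using gen by blast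
  have "v i * e (g * q) = e (if i = k then p * g else f i * q)" if "i < Suc k" for i
    using fg(2)[of i] pq(2) that by (auto simp: mult less_Suc_eq mult.assoc[symmetric])
  then show ?case using fg(1) pq(1)
    by (intro exI[of _ "\<lambda>i. if i = k then p * g else f i * q"] exI[of _ "g * q"]) simp
qed (auto intro: exI[of _ 1])

locale evaluation = field_hom s for s :: "'a::field \<Rightarrow> 'b::field" +
  fixes x0 :: 'b
begin

definition ev :: "'a poly \<Rightarrow> 'b" where "ev p = poly (map_poly s p) x0"

lemma ev_0 [simp]: "ev 0 = 0" by (simp add: ev_def)

lemma ev_pCons [simp]: "ev (pCons c p) = s c + x0 * ev p"
  by (simp add: ev_def map_poly_pCons)

lemma ev_add: "ev (p + q) = ev p + ev q"
  by (induct p q rule: poly_induct2) (simp_all add: hom_add algebra_simps)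

lemma ev_smult: "ev (smult c p) = s c * ev p"
  by (induct p) (simp_all add: hom_mult algebra_simps)

lemma ev_mult: "ev (p * q) = ev p * ev q"
  by (induct p) (simp_all add: ev_add ev_smult algebra_simps)

lemma ev_sum: "finite A \<Longrightarrow> ev (sum f A) = (\<Sum>i\<in>A. ev (f i))"
  by (induct rule: finite_induct) (simp_all add: ev_add)

end

text \<open>The field is the rational function field in \<open>x0\<close> over the image of
  \<open>s\<close>, which is a copy of the whole field: \<open>ev_eq_0\<close> makes
  \<open>x0\<close> transcendental over this image, and \<open>generated\<close> makes every element
  a fraction. Applying \<open>s\<close> thus amounts to adjoining a variable without changing the
  type.\<close>

locale self_rational = evaluation s x0 for s :: "'a::field \<Rightarrow> 'a" and x0 +
  assumes two: "(2::'a) \<noteq> 0"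
    and ev_eq_0: "ev p = 0 \<Longrightarrow> p = 0"
    and generated: "\<exists>p q. q \<noteq> 0 \<and> z * ev q = ev p"
begin

lemma ev_inj: "ev p = ev q \<Longrightarrow> p = q"
  using ev_eq_0[of "p - q"] ev_add[of "p - q" q] by simp

lemma bf_map_s:
  obtains f g where "g \<noteq> 0" "ev (qpol xs f f) = ev (g * g) * bf (map s xs) v v"
    "\<And>i. i < length xs \<Longrightarrow> v i * ev g = ev (f i)"
proof -
  obtain f g where fg: "g \<noteq> 0" "\<And>i. i < length xs \<Longrightarrow> v i * ev g = ev (f i)"
    using common_denominator[of ev "length xs" v, OF ev_mult generated] by blast
  have "ev (qpol xs f f) = (\<Sum>i<length xs. s (xs ! i) * ((v i * ev g) * (v i * ev g)))"
    by (simp add: qpol_def ev_sum ev_smult ev_mult fg(2))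
  also have "\<dots> = ev (g * g) * bf (map s xs) v v"
    by (simp add: bf_def ev_mult sum_distrib_left algebra_simps)
  finally show ?thesis using that fg by blast
qed

lemma anis_map_s: "anis xs \<Longrightarrow> anis (map s xs)"
  unfolding anis_def[of "map s xs"]
proof (intro allI impI)
  fix v i assume anis: "anis xs" and v: "bf (map s xs) v v = 0" and i: "i < length (map s xs)"
  obtain f g where fg: "g \<noteq> 0" "ev (qpol xs f f) = ev (g * g) * bf (map s xs) v v"
    "\<And>i. i < length xs \<Longrightarrow> v i * ev g = ev (f i)" using bf_map_s by blast
  have "qpol xs f f = 0" using fg(2) v ev_eq_0 by simp
  then have "f i = 0" using anis_qpol_0 anis i by simp
  then have "v i * ev g = 0" using fg(3) i by simp
  then show "v i = 0" using fg(1) ev_eq_0 by auto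
qed

lemma value_map_s:
  assumes "anis xs" "bf (map s xs) v v = s b * x0\<^sup>2 + s d"
  shows "\<exists>u w. bf xs u u = b \<and> bf xs w w = d \<and> bf xs u w = 0"
proof -
  obtain f g where fg: "g \<noteq> 0" "ev (qpol xs f f) = ev (g * g) * bf (map s xs) v v"
    using bf_map_s by blast
  have h: "ev [:d, 0, b:] = s b * x0\<^sup>2 + s d" by (simp add: power2_eq_square algebra_simps)
  have "ev (qpol xs f f) = ev (g * g * [:d, 0, b:])"
    unfolding fg(2) assms(2) ev_mult h ..
  then have "qpol xs f f = g * g * [:d, 0, b:]" by (rule ev_inj)
  then show ?thesis using cassels_quadratic two assms(1) fg(1) by blast
qed

section \<open>Iterated adjunction of variables and generic values\<close>

lemma field_hom_pow: "field_hom (s ^^ N)"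
proof -
  have "(s ^^ N) 0 = 0 \<and> (s ^^ N) 1 = 1 \<and> (\<forall>x y. (s ^^ N) (x + y) = (s ^^ N) x + (s ^^ N) y) \<and>
      (\<forall>x y. (s ^^ N) (x * y) = (s ^^ N) x * (s ^^ N) y)"
    by (induct N) (simp_all add: hom_distribs)
  then show ?thesis by unfold_locales auto
qed

lemma map_s_pow_Suc: "map (s ^^ Suc N) xs = map s (map (s ^^ N) xs)"
  by simp

lemma anis_map_pow: "anis xs \<Longrightarrow> anis (map (s ^^ N) xs)"
  by (induct N) (simp_all only: map_s_pow_Suc anis_map_s, simp)

lemma value_map_pow:
  assumes "anis xs" "bf (map (s ^^ N) xs) v v = (s ^^ N) b"
  shows "\<exists>w. bf xs w w = b"
  using assms(2)
proof (induct N arbitrary: v)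
  case (Suc N)
  \<comment> \<open>A constant is treated as a quadratic polynomial in \<open>x0\<close> with
    leading coefficient 0.\<close>
  have "bf (map s (map (s ^^ N) xs)) v v = s 0 * x0\<^sup>2 + s ((s ^^ N) b)"
    using Suc.prems by (simp add: comp_def)
  from value_map_s[OF anis_map_pow[OF assms(1)] this] show ?case using Suc.hyps by blast
qed auto

text \<open>The element \<open>(s ^^ i) x0\<close> plays the role of the \<open>i\<close>-th variable, so this is the value of the
  form \<open>bs\<close> at a vector of independent variables.\<close>

fun gv :: "'a list \<Rightarrow> 'a" where
  "gv [] = 0"
| "gv (b # bs) = s ((s ^^ length bs) b) * x0\<^sup>2 + s (gv bs)"

lemma gv_value: "gv bs = bf (map (s ^^ length bs) bs) (\<lambda>i. (s ^^ i) x0) (\<lambda>i. (s ^^ i) x0)"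
proof (induct bs)
  case (Cons b bs)
  have "s (gv bs) = bf (map s (map (s ^^ length bs) bs)) (\<lambda>i. s ((s ^^ i) x0)) (\<lambda>i. s ((s ^^ i) x0))"
    unfolding Cons bf_map_hom ..
  then show ?case by (simp add: power2_eq_square mult.assoc comp_def)
qed simp

lemma gv_mult: "gv (map ((*) c) bs) = (s ^^ length bs) c * gv bs"
proof (induct bs)
  case (Cons b bs)
  interpret p: field_hom "s ^^ length bs" by (rule field_hom_pow)
  show ?case using Cons by (simp add: hom_mult p.hom_mult algebra_simps)
qed simp

text \<open>As a polynomial in \<open>x0\<close>, the generic value has the nonzero leading
  coefficient \<open>(s ^^ length bs) b\<close>.\<close>

lemma gv_nonzero: "b \<noteq> 0 \<Longrightarrow> gv (b # bs) \<noteq> 0"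
proof
  assume b: "b \<noteq> 0" and 0: "gv (b # bs) = 0"
  interpret p: field_hom "s ^^ length bs" by (rule field_hom_pow)
  have "ev [:gv bs, 0, (s ^^ length bs) b:] = 0" using 0 by (simp add: power2_eq_square algebra_simps)
  then have "[:gv bs, 0, (s ^^ length bs) b:] = 0" by (rule ev_eq_0)
  then show False using b by simp
qed

text \<open>The subform theorem of Cassels and Pfister, as far as dimensions are concerned. The last
  variable yields orthogonal vectors \<open>u\<close>, \<open>w\<close> with values \<open>b\<close>
  and \<open>gv bs\<close>. The value \<open>b\<close> descends to the ground field and is split off
  there; by \<open>represents_orthogonal_split\<close> the complement still represents
  \<open>gv bs\<close>.\<close>

lemma subform_length:
  assumes "anis xs" "0 \<notin> set bs" "bf (map (s ^^ length bs) xs) v v = gv bs"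
  shows "length bs \<le> length xs"
  using assms
proof (induct bs arbitrary: xs v)
  case (Cons b bs)
  let ?h = "s ^^ length bs"
  interpret h: field_hom ?h by (rule field_hom_pow)
  have b: "b \<noteq> 0" "?h b \<noteq> 0" using Cons.prems by auto
  have "bf (map s (map ?h xs)) v v = s (?h b) * x0\<^sup>2 + s (gv bs)"
    using Cons.prems(3) by (simp add: comp_def)
  from value_map_s[OF anis_map_pow[OF Cons.prems(1)] this] obtain u w where
    uw: "bf (map ?h xs) u u = ?h b" "bf (map ?h xs) w w = gv bs" "bf (map ?h xs) u w = 0" by blast
  obtain u' where u': "bf xs u' u' = b" using value_map_pow[OF Cons.prems(1) uw(1)] by blast
  obtain ys where ys: "0 \<notin> set ys" "isometric xs (b # ys)" "length ys + 1 = length xs"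
    using represents_split[OF two anis_nonzero[OF Cons.prems(1)] u' b(1)] by blast
  have nz: "0 \<notin> set xs" using Cons.prems(1) by (rule anis_nonzero)
  have "anis (b # ys)" using isometric_anis[OF ys(2) Cons.prems(1)] ys b by simp
  then have anis: "anis ys" using anis_append(2)[of "[b]" ys] by simp
  have "wcls xs = wcls (b # ys)" using isometric_wcls[OF two ys(2)] nz ys b by simp
  then have "wcls (?h b # map ?h ys) = wcls (map ?h xs)"
    using h.wbc_wcls[of xs] h.wbc_wcls[of "b # ys"] by simp
  then have "isometric (?h b # map ?h ys) (map ?h xs)"
    using nz ys b by (intro isometric_if_wcls_eq[OF two]) auto
  from represents_orthogonal_split[OF two this b(2) uw(1,3)]
  obtain w' where "bf (map ?h ys) w' w' = gv bs" using uw(2) by auto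
  then have "length bs \<le> length ys" using Cons.hyps anis Cons.prems by simp
  then show ?case using ys by simp
qed simp

text \<open>The induction on the number of terms is for all \<open>n\<close> at once: annihilating
  one term turns the others into (n + 1)-fold ones, and the dimension at most doubles.\<close>

theorem hauptsatz_psum:
  fixes xs :: "'a list"
  assumes "anis xs" "wcls xs = psum L" "pfister_terms n L"
  shows "xs = [] \<or> 2 ^ n \<le> length xs"
  using assms
proof (induct "length L" arbitrary: L n xs)
  case 0
  then show ?case using anis_wcls_0[OF two, of xs] by simp
next
  case (Suc r)
  then obtain b as L' where L: "L = (b, as) # L'" "length L' = r"
    by (cases L) auto
  show ?case
  proof (rule ccontr)
    assume "\<not> (xs = [] \<or> 2 ^ n \<le> length xs)"
    then have ne: "xs \<noteq> []" and small: "length xs < 2 ^ n" by auto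
    have as: "length as = n" "0 \<notin> set as" using Suc.prems L by auto
    have pl: "length (pflist as) = 2 ^ n" using as by simp
    \<comment> \<open>As many variables are adjoined as \<open>pflist as\<close> has entries;
      \<open>d\<close> is the generic value of this form.\<close>
    define h where "h = s ^^ (2 ^ n)"
    interpret h: field_hom h unfolding h_def by (rule field_hom_pow)
    define d where "d = gv (pflist as)"
    have d: "d \<noteq> 0" using hd_pflist[of as] gv_nonzero[of 1] unfolding d_def by auto
    have dv: "d = bf (pflist (map h as)) (\<lambda>i. (s ^^ i) x0) (\<lambda>i. (s ^^ i) x0)"
      unfolding d_def gv_value pl h_def[symmetric] h.map_pflist ..
    have round: "rk d * pf (map h as) = pf (map h as)"
      by (rule pfister_round[OF _ dv[symmetric] d]) (use as in auto)
    define M where "M = map (\<lambda>(b, as). (h b, map h as)) L'"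
    define M' where "M' = map (\<lambda>(b, as). (b, d # as)) M"
    have "pfister_terms n M" unfolding M_def using Suc.prems L by (intro h.pfister_terms_map) simp
    then have M': "pfister_terms (Suc n) M'" unfolding M'_def using d by (induct M) auto
    have psum_M': "psum M' = (1 - rk d) * psum M"
      unfolding M'_def by (induct M) (auto simp: algebra_simps)
    have "wcls (map h xs) = rk (h b) * pf (map h as) + psum M"
      using h.wbc_psum[of L] h.wbc_wcls[of xs] Suc.prems(2) by (simp add: L M_def)
    then have "(1 - rk d) * wcls (map h xs) = rk (h b) * (pf (map h as) - rk d * pf (map h as)) + psum M'"
      unfolding psum_M' by (simp add: algebra_simps)
    then have dx: "(1 - rk d) * wcls (map h xs) = psum M'" unfolding round by simp
    obtain zs where zs: "anis zs" "wcls zs = wcls (map h xs @ map ((*) (- d)) (map h xs))"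
      "length zs \<le> length (map h xs @ map ((*) (- d)) (map h xs))"
      using anis_rep[of "map h xs @ map ((*) (- d)) (map h xs)"] by blast
    have "wcls zs = psum M'" unfolding zs(2) dx[symmetric] wcls_append wcls_map_mult rk_uminus
      by (simp add: algebra_simps)
    moreover have "length zs < 2 ^ Suc n" using zs(3) small by simp
    moreover have "r = length M'" using L by (simp add: M'_def M_def)
    \<comment> \<open>The dimension of \<open>zs\<close> is below 2^(n + 1), so by induction
      \<open>zs\<close> is empty, and \<open>d\<close> is a similarity factor of \<open>xs\<close>
      over the extension.\<close>
    ultimately have "zs = []" using Suc.hyps(1)[of M' zs "Suc n"] zs(1) M' by fastforce
    then have eq: "wcls (map h xs) = wcls (map ((*) d) (map h xs))"
      using \<open>wcls zs = psum M'\<close> dx unfolding wcls_map_mult by (simp add: algebra_simps)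
    have anis: "anis (map h xs)" unfolding h_def using Suc.prems(1) by (rule anis_map_pow)
    then have "isometric (map h xs) (map ((*) d) (map h xs))"
      using eq d by (intro anis_unique[OF two]) (simp_all add: anis_map_mult del: map_map)
    then obtain T where T: "\<And>v w. bf (map h xs) (T v) (T w) = bf (map ((*) d) (map h xs)) v w"
      unfolding isometric_def by blast
    obtain c xs' where xs: "xs = c # xs'" using ne by (cases xs) auto
    \<comment> \<open>With \<open>c\<close> the first entry of \<open>xs\<close>, the value
      \<open>h c * d\<close> is the generic value of the Pfister form scaled by \<open>c\<close>, so
      \<open>subform_length\<close> applies.\<close>
    have "bf (map h xs) (T (unit_fun 0)) (T (unit_fun 0)) = h c * d"
      unfolding T using bf_unit[of 0 "map ((*) d) (map h xs)"] xs by (simp add: unit_fun_def)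
    also have "\<dots> = gv (map ((*) c) (pflist as))" unfolding gv_mult pl d_def h_def ..
    finally have v: "bf (map (s ^^ length (map ((*) c) (pflist as))) xs) (T (unit_fun 0)) (T (unit_fun 0))
        = gv (map ((*) c) (pflist as))" by (simp only: length_map pl h_def)
    have "0 \<notin> set (map ((*) c) (pflist as))"
      using anis_nonzero[OF Suc.prems(1)] xs pflist_nonzero[OF as(2)] by auto
    from subform_length[OF Suc.prems(1) this v]
    have "length (map ((*) c) (pflist as)) \<le> length xs" .
    then show False using small by (simp add: as)
  qed
qed

end

section \<open>A field isomorphic to its own rational function field\<close>

text \<open>\<open>int poly\<close> serves as an ordered group isomorphic to \<open>int \<times> int poly\<close>: its elements are the
  exponent vectors of Laurent monomials in countably many variables, and \<open>pCons 0\<close> renames the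
  variables so as to free the first one.\<close>

abbreviation (input) "lookup \<equiv> Poly_Mapping.lookup"
abbreviation (input) "keys \<equiv> Poly_Mapping.keys"
abbreviation (input) "single \<equiv> Poly_Mapping.single"

type_synonym 'a laurent = "int poly \<Rightarrow>\<^sub>0 'a"

section \<open>Arithmetic of Laurent polynomials with ordered exponents\<close>

lemma mapping_sum: "(f :: 'b \<Rightarrow>\<^sub>0 'a::comm_monoid_add) = (\<Sum>k\<in>keys f. single k (lookup f k))"
  by (rule poly_mapping_eqI) (simp add: lookup_sum lookup_single when_def sum.delta in_keys_iff)

lemma mult_sum: "(f :: 'b::monoid_add \<Rightarrow>\<^sub>0 'a::semiring_0) * g =
    (\<Sum>k\<in>keys f. \<Sum>l\<in>keys g. single (k + l) (lookup f k * lookup g l))"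
proof -
  have "f * g = (\<Sum>k\<in>keys f. single k (lookup f k)) * (\<Sum>l\<in>keys g. single l (lookup g l))"
    using mapping_sum[of f] mapping_sum[of g] by simp
  then show ?thesis by (simp add: sum_product mult_single)
qed

text \<open>In an ordered group two exponents bounded by \<open>m\<close> add up to
  \<open>m + m\<close> only if both equal \<open>m\<close>.\<close>

lemma lookup_mult_max:
  fixes f g :: "'b::linordered_ab_group_add \<Rightarrow>\<^sub>0 'a::semiring_0"
  assumes "\<And>k. k \<in> keys f \<Longrightarrow> k \<le> m" "\<And>k. k \<in> keys g \<Longrightarrow> k \<le> m"
  shows "lookup (f * g) (m + m) = lookup f m * lookup g m"
proof -
  have "k + l = m + m \<longleftrightarrow> k = m \<and> l = m" if "k \<in> keys f" "l \<in> keys g" for k l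
    using assms(1)[OF that(1)] assms(2)[OF that(2)]
    by (metis add_le_less_mono add_less_le_mono order_le_less less_irrefl)
  then have "lookup (f * g) (m + m) = (\<Sum>k\<in>keys f. \<Sum>l\<in>keys g.
      (if l = m then (if k = m then lookup f m * lookup g m else 0) else 0))"
    by (auto simp: mult_sum lookup_sum lookup_single when_def intro!: sum.cong)
  also have "\<dots> = lookup f m * lookup g m"
    by (cases "lookup g m = 0") (auto simp: sum.delta in_keys_iff)
  finally show ?thesis .
qed

lemma lookup_mult_single:
  "lookup (f * single k (1::'a::semiring_1)) (k + l) = lookup f (l :: 'b::ab_group_add)"
proof -
  have "f * single k 1 = (\<Sum>j\<in>keys f. single j (lookup f j)) * single k 1"
    using mapping_sum[of f] by simp
  also have "\<dots> = (\<Sum>j\<in>keys f. single (j + k) (lookup f j))"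
    by (simp add: sum_distrib_right mult_single)
  finally show ?thesis
    by (simp add: lookup_sum lookup_single when_def add.commute[of k] sum.delta in_keys_iff)
qed

text \<open>Every variable is renamed to the next one: exponents receive a new first coordinate 0,
  which \<open>poly_shift 1\<close> drops again.\<close>

lift_definition shift :: "'a::zero laurent \<Rightarrow> 'a laurent" is
  "\<lambda>f k. if coeff k 0 = 0 then f (poly_shift 1 k) else 0"
proof -
  fix f :: "int poly \<Rightarrow> 'a" assume fin: "finite {k. f k \<noteq> 0}"
  have "k = pCons 0 (poly_shift 1 k)" if "coeff k 0 = 0" for k :: "int poly"
    using that by (auto simp: poly_eq_iff coeff_poly_shift coeff_pCons split: nat.split)
  then have "{k. (if coeff k 0 = 0 then f (poly_shift 1 k) else 0) \<noteq> 0} \<subseteq> pCons 0 ` {k. f k \<noteq> 0}"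
    by (auto split: if_splits)
  then show "finite {k. (if coeff k 0 = 0 then f (poly_shift 1 k) else 0) \<noteq> 0}"
    using fin by (meson finite_imageI finite_subset)
qed

lemma lookup_shift: "lookup (shift f) (pCons a k) = (if a = 0 then lookup f k else 0)"
proof -
  have "poly_shift 1 (pCons a k) = k" for a by (simp add: poly_eq_iff coeff_poly_shift)
  then show ?thesis by (simp add: shift.rep_eq)
qed

lemma laurent_eqI: "(\<And>a k. lookup f (pCons a k) = lookup g (pCons a k)) \<Longrightarrow> f = (g :: 'a::zero laurent)"
  by (rule poly_mapping_eqI) (metis pCons_cases)

lemma shift_add: "shift (f + g) = shift f + shift g"
  by (rule laurent_eqI) (simp add: lookup_shift lookup_add)

lemma shift_0 [simp]: "shift 0 = 0"
  by (rule laurent_eqI) (simp add: lookup_shift)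

lemma shift_single: "shift (single k c) = single (pCons 0 k) c"
  by (rule laurent_eqI) (simp add: lookup_shift lookup_single when_def)

lemma shift_1 [simp]: "shift 1 = (1 :: 'a::zero_neq_one laurent)"
  by (simp add: shift_single flip: single_one)

lemma shift_sum: "finite A \<Longrightarrow> shift (sum f A) = (\<Sum>k\<in>A. shift (f k))"
  by (induct rule: finite_induct) (simp_all add: shift_add)

lemma shift_mult: "shift (f * g) = shift f * shift (g :: 'a::semiring_0 laurent)"
proof -
  have 1: "shift f = (\<Sum>k\<in>keys f. single (pCons 0 k) (lookup f k))" for f :: "'a laurent"
    using arg_cong[OF mapping_sum[of f], of shift] by (simp add: shift_sum shift_single)
  show ?thesis
    unfolding mult_sum[of f g] 1[of f] 1[of g] sum_product
    by (simp add: shift_sum shift_single mult_single)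
qed

lemma shift_eq_0: "shift f = 0 \<longleftrightarrow> f = 0"
proof
  assume "shift f = 0"
  then have "lookup f k = 0" for k using lookup_shift[of f 0 k] by simp
  then show "f = 0" by (intro poly_mapping_eqI) simp
qed simp

text \<open>Independent of the chosen fraction because \<open>shift\<close> is injective and
  multiplicative, see \<open>fshift_Fract\<close>.\<close>

definition fshift :: "'a::field laurent fract \<Rightarrow> 'a laurent fract" where
  "fshift z = (THE w. \<exists>a b. b \<noteq> 0 \<and> z = Fract a b \<and> w = Fract (shift a) (shift b))"

lemma fshift_Fract:
  assumes b: "b \<noteq> 0"
  shows "fshift (Fract a b) = Fract (shift a) (shift b)"
  unfolding fshift_def
proof (rule the_equality)
  fix w assume "\<exists>a' b'. b' \<noteq> 0 \<and> Fract a b = Fract a' b' \<and> w = Fract (shift a') (shift b')"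
  then obtain a' b' where w: "b' \<noteq> 0" "Fract a b = Fract a' b'" "w = Fract (shift a') (shift b')"
    by blast
  then have "a * b' = a' * b" using b by (simp add: eq_fract)
  then show "w = Fract (shift a) (shift b)"
    using w b by (simp add: eq_fract shift_eq_0 flip: shift_mult)
qed (use b in blast)

lemma field_hom_fshift: "field_hom fshift"
proof
  show "fshift 0 = 0" by (simp add: Zero_fract_def fshift_Fract)
  show "fshift 1 = 1" by (simp add: One_fract_def fshift_Fract)
  show "fshift (x + y) = fshift x + fshift y" for x y
    by (cases x, cases y) (simp add: fshift_Fract shift_eq_0 shift_add shift_mult)
  show "fshift (x * y) = fshift x * fshift y" for x y
    by (cases x, cases y) (simp add: fshift_Fract shift_eq_0 shift_mult)
qed

definition monomial :: "int poly \<Rightarrow> 'a::field \<Rightarrow> 'a laurent fract" where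
  "monomial k c = Fract (single k c) 1"

definition fvar :: "'a::field laurent fract" where
  "fvar = monomial [:1:] 1"

lemma monomial_mult: "monomial k c * monomial l d = monomial (k + l) (c * d)"
  by (simp add: monomial_def mult_single)

lemma monomial_1: "monomial 0 1 = 1"
  by (simp add: monomial_def One_fract_def)

lemma Fract_sum: "finite A \<Longrightarrow> Fract (sum f A) 1 = (\<Sum>k\<in>A. Fract (f k) 1)"
proof (induct rule: finite_induct)
  case (insert x A)
  then show ?case unfolding sum.insert[OF insert(1,2)] insert(3)[symmetric] by simp
qed (simp add: Zero_fract_def)

lemma fvar_power: "fvar ^ n = monomial [:int n:] 1"
  by (induct n) (simp_all add: monomial_1 fvar_def monomial_mult)

lemma common_denominator_fract:
  fixes k :: nat and v :: "nat \<Rightarrow> 'a::idom fract"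
  shows "\<exists>f g. g \<noteq> 0 \<and> (\<forall>i<k. v i * Fract g 1 = Fract (f i) 1)"
proof (rule common_denominator)
  fix z :: "'a fract"
  obtain p q where "z = Fract p q" "q \<noteq> 0" by (cases z)
  then show "\<exists>p q. q \<noteq> 0 \<and> z * Fract q 1 = Fract p 1"
    by (intro exI[of _ p] exI[of _ q]) (simp add: eq_fract)
qed simp

interpretation fsh: evaluation fshift fvar
  by (rule evaluation.intro[OF field_hom_fshift])

text \<open>Transcendence of \<open>fvar\<close>. After clearing denominators, shifted coefficients
  have first exponent coordinate 0, and multiplication by \<open>fvar ^ i\<close> moves this
  coordinate to \<open>i\<close>. Different powers occupy disjoint sets of exponents and cannot
  cancel.\<close>

lemma ev_fvar_eq_0:
  assumes "fsh.ev p = 0"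
  shows "p = 0"
proof -
  obtain c g where cg: "g \<noteq> 0" "\<And>i. i < Suc (degree p) \<Longrightarrow> coeff p i * Fract g 1 = Fract (c i) 1"
    using common_denominator_fract[of "Suc (degree p)" "coeff p"] by blast
  have "fsh.ev p = (\<Sum>i\<le>degree p. fshift (coeff p i) * fvar ^ i)"
    unfolding fsh.ev_def poly_altdef by (simp add: coeff_map_poly degree_map_poly)
  then have "0 = fshift (Fract g 1) * (\<Sum>i\<le>degree p. fshift (coeff p i) * fvar ^ i)"
    using assms by simp
  also have "\<dots> = (\<Sum>i\<le>degree p. fshift (coeff p i * Fract g 1) * fvar ^ i)"
    by (simp add: sum_distrib_left fsh.hom_mult ac_simps)
  also have "\<dots> = (\<Sum>i\<le>degree p. Fract (shift (c i) * single [:int i:] 1) 1)"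
    by (intro sum.cong) (auto simp: cg(2) fshift_Fract fvar_power monomial_def)
  also have "\<dots> = Fract (\<Sum>i\<le>degree p. shift (c i) * single [:int i:] 1) 1"
    by (simp add: Fract_sum)
  finally have 0: "(\<Sum>i\<le>degree p. shift (c i) * single [:int i:] 1) = 0"
    by (simp add: Zero_fract_def eq_fract)
  have "c j = 0" if j: "j \<le> degree p" for j
  proof (rule poly_mapping_eqI)
    fix k
    have "lookup (shift (c i) * single [:int i:] 1) (pCons (int j) k) = (if i = j then lookup (c j) k else 0)" for i
      using lookup_mult_single[of "shift (c i)" "[:int i:]" "pCons (int j - int i) k"]
      by (simp add: lookup_shift)
    then have "lookup (\<Sum>i\<le>degree p. shift (c i) * single [:int i:] 1) (pCons (int j) k) = lookup (c j) k"
      using j by (simp add: lookup_sum sum.delta)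
    then show "lookup (c j) k = lookup 0 k" unfolding 0 by simp
  qed
  then have "coeff p j * Fract g 1 = 0" if "j \<le> degree p" for j
    using cg(2)[of j] that by (simp add: Zero_fract_def)
  moreover have "Fract g 1 \<noteq> 0" using cg(1) by (simp add: Zero_fract_def eq_fract)
  ultimately have "coeff p j = 0" if "j \<le> degree p" for j
    using that by (metis mult_eq_0_iff)
  then show ?thesis by (metis leading_coeff_0_iff order_refl)
qed

section \<open>Generation of the field by the image of the shift and the free variable\<close>

context evaluation
begin

text \<open>Denominators must have nonzero value, since evaluation need not be injective in this
  locale. These elements form a subfield containing \<open>x0\<close> and the image of
  \<open>s\<close>.\<close>

definition quot :: "'b \<Rightarrow> bool" where
  "quot z \<longleftrightarrow> (\<exists>p q. ev q \<noteq> 0 \<and> z * ev q = ev p)"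

lemma quot_s: "quot (s c)"
  unfolding quot_def by (intro exI[of _ "[:c:]"] exI[of _ 1]) (simp add: one_pCons)

lemma quot_x0: "quot x0"
  unfolding quot_def by (intro exI[of _ "[:0, 1:]"] exI[of _ 1]) (simp add: one_pCons)

lemma quot_mult: "quot x \<Longrightarrow> quot y \<Longrightarrow> quot (x * y)"
  unfolding quot_def
proof (elim exE conjE)
  fix p q p' q' assume "ev q \<noteq> 0" "x * ev q = ev p" "ev q' \<noteq> 0" "y * ev q' = ev p'"
  moreover from this have "x * y * ev (q * q') = ev (p * p')" by (simp add: ev_mult) (metis mult.assoc mult.commute)
  ultimately show "\<exists>p q. ev q \<noteq> 0 \<and> x * y * ev q = ev p"
    by (intro exI[of _ "p * p'"] exI[of _ "q * q'"]) (simp add: ev_mult)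
qed

lemma quot_add: "quot x \<Longrightarrow> quot y \<Longrightarrow> quot (x + y)"
  unfolding quot_def
proof (elim exE conjE)
  fix p q p' q' assume a: "ev q \<noteq> 0" "x * ev q = ev p" "ev q' \<noteq> 0" "y * ev q' = ev p'"
  have "(x + y) * ev (q * q') = (x * ev q) * ev q' + (y * ev q') * ev q"
    by (simp add: ev_mult algebra_simps)
  then have "(x + y) * ev (q * q') = ev (p * q' + p' * q)" unfolding a by (simp add: ev_mult ev_add)
  then show "\<exists>p q. ev q \<noteq> 0 \<and> (x + y) * ev q = ev p"
    using a by (intro exI[of _ "p * q' + p' * q"] exI[of _ "q * q'"]) (simp add: ev_mult)
qed

lemma quot_inverse: "quot x \<Longrightarrow> quot (inverse x)"
proof (cases "x = 0")
  case True
  then show "quot (inverse x)" using quot_s[of 0] by simp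
next
  case False
  assume "quot x"
  then obtain p q where "ev q \<noteq> 0" "x * ev q = ev p" unfolding quot_def by blast
  moreover from this False have "ev p \<noteq> 0" "inverse x * ev p = ev q" by (auto simp: field_simps)
  ultimately show ?thesis unfolding quot_def by blast
qed

lemma quot_sum: "finite A \<Longrightarrow> (\<And>k. k \<in> A \<Longrightarrow> quot (f k)) \<Longrightarrow> quot (sum f A)"
proof (induct rule: finite_induct)
  case empty
  then show ?case using quot_s[of 0] by simp
qed (auto intro: quot_add)

lemma quot_power: "quot x \<Longrightarrow> quot (x ^ n)"
  using quot_s[of 1] by (induct n) (auto intro: quot_mult)

end

text \<open>The first exponent coordinate contributes a power of \<open>fvar\<close>, inverted if
  negative; the other coordinates lie in the image of \<open>fshift\<close>.\<close>

lemma quot_monomial: "fsh.quot (monomial k (c :: 'a::field))"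
proof -
  obtain a l where k: "k = pCons a l" by (cases k)
  have a: "fsh.quot (monomial [:a:] (1::'a))"
  proof (cases "a \<ge> 0")
    case True
    then show ?thesis using fsh.quot_power[OF fsh.quot_x0, of "nat a"] by (simp add: fvar_power)
  next
    case False
    have "monomial [:a:] 1 * monomial [:- a:] (1::'a) = 1" by (simp add: monomial_mult monomial_1)
    then have "monomial [:a:] 1 = inverse (monomial [:- a:] (1::'a))"
      by (metis inverse_unique mult.commute)
    moreover have "fsh.quot (monomial [:- a:] (1::'a))"
      using fsh.quot_power[OF fsh.quot_x0, of "nat (- a)"] False by (simp add: fvar_power)
    ultimately show ?thesis using fsh.quot_inverse by metis
  qed
  have "monomial k c = fshift (monomial l c) * monomial [:a:] 1"
    by (simp add: monomial_def fshift_Fract shift_single mult_single k)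
  then show ?thesis using a fsh.quot_s fsh.quot_mult by metis
qed

lemma quot_fract: "fsh.quot (z :: 'a::field laurent fract)"
proof -
  have 1: "fsh.quot (Fract f 1)" for f :: "'a laurent"
  proof -
    have "Fract f 1 = (\<Sum>k\<in>keys f. monomial k (lookup f k))"
      unfolding monomial_def using arg_cong[OF mapping_sum[of f], of "\<lambda>f. Fract f 1"] by (simp add: Fract_sum)
    then show ?thesis by (auto intro!: fsh.quot_sum quot_monomial)
  qed
  obtain f g where "z = Fract f g" "g \<noteq> 0" by (cases z)
  then have "z = Fract f 1 * inverse (Fract g 1)" by simp
  then show ?thesis using 1 fsh.quot_mult fsh.quot_inverse by metis
qed

lemma field_hom_const: "field_hom (monomial 0)"
  by unfold_locales (simp_all add: monomial_def Zero_fract_def One_fract_def single_add mult_single)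

lemma self_rational_fshift:
  assumes "(2::'a::field) \<noteq> 0"
  shows "self_rational (fshift :: 'a laurent fract \<Rightarrow> _) fvar"
proof
  interpret c: field_hom "monomial 0 :: 'a \<Rightarrow> _" by (rule field_hom_const)
  have 2: "(2 :: 'a laurent fract) = monomial 0 2" using c.hom_add[of 1 1] by simp
  show "(2 :: 'a laurent fract) \<noteq> 0" unfolding 2 using assms by simp
  show "p = 0" if "fsh.ev p = 0" for p :: "'a laurent fract poly" using that by (rule ev_fvar_eq_0)
  show "\<exists>p q. q \<noteq> 0 \<and> z * fsh.ev q = fsh.ev p" for z :: "'a laurent fract"
    using quot_fract[of z] unfolding fsh.quot_def by (metis fsh.ev_0)
qed

text \<open>Let \<open>m\<close> be the largest exponent in the numerators of an isotropic vector.
  The coefficient of its value at \<open>m + m\<close> is the value of \<open>xs\<close> at the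
  coefficients at \<open>m\<close>, which is nonzero by anisotropy.\<close>

lemma anis_const:
  assumes anis: "anis (xs :: 'a::field list)"
  shows "anis (map (monomial 0) xs)"
  unfolding anis_def[of "map (monomial 0) xs"]
proof (intro allI impI)
  fix v i assume v: "bf (map (monomial 0) xs) v v = 0" and i: "i < length (map (monomial 0) xs)"
  obtain f g where fg: "g \<noteq> 0" "\<And>i. i < length xs \<Longrightarrow> v i * Fract g 1 = Fract (f i) 1"
    using common_denominator_fract[of "length xs" v] by blast
  have "0 = Fract g 1 * Fract g 1 * bf (map (monomial 0) xs) v v" unfolding v by simp
  also have "\<dots> = (\<Sum>i<length xs. monomial 0 (xs ! i) * (v i * Fract g 1) * (v i * Fract g 1))"
    by (simp add: bf_def sum_distrib_left mult_ac del: mult_fract)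
  also have "\<dots> = Fract (\<Sum>i<length xs. single 0 (xs ! i) * (f i * f i)) 1"
    by (simp add: fg(2) monomial_def Fract_sum mult.assoc)
  finally have 0: "(\<Sum>i<length xs. single 0 (xs ! i) * (f i * f i)) = 0"
    by (simp add: Zero_fract_def eq_fract)
  have "f i = 0"
  proof (rule ccontr)
    assume "f i \<noteq> 0"
    define S where "S = (\<Union>i<length xs. keys (f i))"
    have fin: "finite S" by (simp add: S_def)
    have "keys (f i) \<noteq> {}" using \<open>f i \<noteq> 0\<close> by simp
    then have ne: "S \<noteq> {}" using i by (auto simp: S_def)
    define m where "m = Max S"
    have "m \<in> S" unfolding m_def using fin ne by (rule Max_in)
    then obtain j where j: "j < length xs" "lookup (f j) m \<noteq> 0" by (auto simp: S_def in_keys_iff)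
    have le: "k \<le> m" if "j < length xs" "k \<in> keys (f j)" for j k
      using that fin unfolding m_def by (intro Max_ge) (auto simp: S_def)
    have const: "lookup (single 0 c * h) k = c * lookup h k" for c :: 'a and h :: "'a laurent" and k
    proof -
      have "single 0 c * h = (\<Sum>l\<in>keys h. single l (c * lookup h l))"
        using arg_cong[OF mapping_sum[of h], of "\<lambda>h. single 0 c * h"] by (simp add: sum_distrib_left mult_single)
      then show ?thesis by (simp add: lookup_sum lookup_single when_def sum.delta in_keys_iff)
    qed
    have "0 = lookup (\<Sum>i<length xs. single 0 (xs ! i) * (f i * f i)) (m + m)" unfolding 0 by simp
    also have "\<dots> = bf xs (\<lambda>i. lookup (f i) m) (\<lambda>i. lookup (f i) m)"
      unfolding lookup_sum const bf_def mult.assoc using le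
      by (intro sum.cong refl) (subst lookup_mult_max, auto)
    finally show False using anis j unfolding anis_def by metis
  qed
  then have "v i * Fract g 1 = 0" using fg(2) i by (simp add: Zero_fract_def)
  moreover have "Fract g 1 \<noteq> 0" using fg(1) by (simp add: Zero_fract_def eq_fract)
  ultimately show "v i = 0" by (metis mult_eq_0_iff)
qed

section \<open>The Hauptsatz of Arason and Pfister\<close>

theorem hauptsatz:
  assumes two: "(2::'a::field) \<noteq> 0" and "anis (xs :: 'a list)" "wcls xs \<in> IW n"
  shows "xs = [] \<or> 2 ^ n \<le> length xs"
proof -
  interpret c: field_hom "monomial 0 :: 'a \<Rightarrow> _" by (rule field_hom_const)
  interpret self_rational "fshift :: 'a laurent fract \<Rightarrow> _" fvar by (rule self_rational_fshift[OF two])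
  have "wcls (map (monomial 0) xs) \<in> IW n" using c.wbc_IW[OF assms(3)] by (simp add: c.wbc_wcls)
  then obtain L where "wcls (map (monomial 0) xs) = psum L" "pfister_terms n L" unfolding IW_def by blast
  then show ?thesis using hauptsatz_psum[OF anis_const[OF assms(2)]] by simp
qed

section \<open>Similarity of pairs of residue forms\<close>

text \<open>The property Sim for diagonal forms, see \<open>has_Sim_iff\<close>. Similarity is
  expressed by Witt classes; for anisotropic forms it entails equal dimensions by
  \<open>similar_length\<close>.\<close>

definition sim_diag :: "'a::field itself \<Rightarrow> nat \<Rightarrow> bool" where
  "sim_diag _ m \<longleftrightarrow> (\<forall>xs ys :: 'a list. xs \<noteq> [] \<and> ys \<noteq> [] \<and> anis xs \<and> anis ys \<and>
      length xs \<le> 2 ^ m + 2 ^ (m - 1) \<and> length ys \<le> 2 ^ m + 2 ^ (m - 1) \<and>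
      wcls xs \<in> IW m \<and> wcls ys \<in> IW m \<and> wcls xs - wcls ys \<in> IW (m + 1)
      \<longrightarrow> (\<exists>c. c \<noteq> 0 \<and> wcls ys = rk c * wcls xs))"

lemma sim_diagD:
  assumes "sim_diag TYPE('a::field) m" "xs \<noteq> []" "ys \<noteq> []" "anis xs" "anis (ys :: 'a list)"
    "length xs \<le> 2 ^ m + 2 ^ (m - 1)" "length ys \<le> 2 ^ m + 2 ^ (m - 1)"
    "wcls xs \<in> IW m" "wcls ys \<in> IW m" "wcls xs - wcls ys \<in> IW (Suc m)"
  obtains c where "c \<noteq> 0" "wcls ys = rk c * wcls xs"
proof -
  have "\<exists>c. c \<noteq> 0 \<and> wcls ys = rk c * wcls xs"
    using assms(2-10) by (intro assms(1)[unfolded sim_diag_def, rule_format]) simp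
  then show ?thesis using that by blast
qed

lemma wcls_difference: "wcls (xs @ map ((*) (- a)) ys) = wcls xs - rk a * wcls ys"
  by (simp add: wcls_map_mult rk_uminus)

lemma common_value_isotropic:
  assumes "bf xs v v = a * bf ys w w" "bf ys w w \<noteq> 0"
  shows "\<not> anis (xs @ map ((*) (- a)) ys)"
proof
  assume anis: "anis (xs @ map ((*) (- a)) ys)"
  let ?u = "\<lambda>i. if i < length xs then v i else w (i - length xs)"
  have "bf (xs @ map ((*) (- a)) ys) ?u ?u = bf xs v v + bf (map ((*) (- a)) ys) w w"
    by (simp add: bf_append cong: bf_cong)
  also have "\<dots> = 0" using assms by (simp add: bf_map_mult)
  finally have 0: "bf (xs @ map ((*) (- a)) ys) ?u ?u = 0" .
  have u: "?u i = 0" if "i < length xs + length ys" for i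
    by (rule anis[unfolded anis_def, rule_format, OF 0]) (use that in simp)
  have "\<forall>i<length ys. w i = 0"
  proof (intro allI impI)
    fix i assume "i < length ys"
    then show "w i = 0" using u[of "length xs + i"] by simp
  qed
  then show False using assms(2) bf_eq_0[of ys w w] by simp
qed

lemma isotropic_common_value:
  assumes "anis xs" "anis ys" "a \<noteq> 0" "\<not> anis (xs @ map ((*) (- a)) ys)"
  obtains v w where "bf xs v v = a * bf ys w w" "bf ys w w \<noteq> 0"
proof -
  obtain u i where u: "bf (xs @ map ((*) (- a)) ys) u u = 0" "i < length xs + length ys" "u i \<noteq> 0"
    using assms(4) unfolding anis_def by auto
  define w where "w = (\<lambda>i. u (length xs + i))"
  have eq: "bf xs u u = a * bf ys w w" using u(1) by (simp add: bf_append bf_map_mult w_def)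
  have "bf ys w w \<noteq> 0"
  proof
    assume 0: "bf ys w w = 0"
    then have "\<forall>i<length ys. w i = 0" "\<forall>i<length xs. u i = 0"
      using assms(1,2) eq unfolding anis_def by auto
    then show False using u(2,3) unfolding w_def by (metis add_diff_inverse_nat nat_add_left_cancel_less)
  qed
  then show ?thesis by (rule that[OF eq])
qed

text \<open>The anisotropic part has dimension below 2^n, because in the boundary dimension 2^n
  isotropy makes it drop; the Hauptsatz then leaves only 0.\<close>

lemma hauptsatz_zero:
  assumes two: "(2::'a::field) \<noteq> 0" and "wcls (xs :: 'a list) \<in> IW n" "length xs \<le> 2 ^ n"
    "length xs < 2 ^ n \<or> \<not> anis xs"
  shows "wcls xs = 0"
proof -
  obtain zs where zs: "anis zs" "wcls zs = wcls xs" "length zs \<le> length xs" "\<not> anis xs \<longrightarrow> length zs < length xs"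
    using anis_rep[of xs] by blast
  then have "length zs < 2 ^ n" using assms(3,4) by linarith
  then have "zs = []" using hauptsatz[OF two zs(1), of n] zs(2) assms(2) by auto
  then show ?thesis using zs(2) by simp
qed

lemma similar_length:
  assumes two: "(2::'a::field) \<noteq> 0" and "anis xs" "anis (ys :: 'a list)" "c \<noteq> 0" "wcls ys = rk c * wcls xs"
  shows "length xs = length ys"
proof -
  have "isometric ys (map ((*) c) xs)"
    using assms by (intro anis_unique[OF two]) (simp_all add: anis_map_mult wcls_map_mult)
  from isometric_length[OF this] show ?thesis by simp
qed

text \<open>Both pairs share the second residue \<open>f2\<close>, and a factor is sought that fixes
  \<open>f2\<close> and carries \<open>f1\<close> to \<open>g1\<close>. Unless 1 is such a factor,
  the Hauptsatz determines all dimensions.\<close>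

lemma similar_pair_normalized:
  fixes f1 f2 g1 :: "'a::field list"
  assumes two: "(2::'a) \<noteq> 0" and sim: "sim_diag TYPE('a) (Suc m)"
    and anis: "anis f1" "anis f2" "anis g1" and ne: "f1 \<noteq> []" "f2 \<noteq> []"
    and len: "length f1 + length f2 \<le> 3 * 2 ^ m" "length g1 + length f2 \<le> 3 * 2 ^ m"
    and f2: "wcls f2 \<in> IW m" and f12: "wcls f1 + wcls f2 \<in> IW (Suc m)"
    and fg: "wcls f1 - wcls g1 \<in> IW (Suc (Suc m))"
  shows "\<exists>c. c \<noteq> 0 \<and> wcls g1 = rk c * wcls f1 \<and> rk c * wcls f2 = wcls f2"
proof (cases "wcls f1 = wcls g1")
  case True
  then show ?thesis by (intro exI[of _ 1]) simp
next
  case False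
  have len_f2: "2 ^ m \<le> length f2" using hauptsatz[OF two anis(2) f2] ne by simp
  \<comment> \<open>The difference of \<open>f1\<close> and \<open>g1\<close> is a nonzero class in
    \<open>IW (Suc (Suc m))\<close>, so the two lengths add up to at least \<open>4 * 2 ^ m\<close>.
    Together with the upper bounds this fixes each length.\<close>
  have "\<not> length (f1 @ map ((*) (- 1)) g1) < 2 ^ Suc (Suc m)"
    using hauptsatz_zero[OF two, of "f1 @ map ((*) (- 1)) g1" "Suc (Suc m)"] fg False
    unfolding wcls_difference by auto
  then have "length f1 + length g1 \<ge> 4 * 2 ^ m" by simp
  then have lens: "length f1 = 2 * 2 ^ m" "length g1 = 2 * 2 ^ m" "length f2 = 2 ^ m"
    using len len_f2 by linarith+
  \<comment> \<open>The factor \<open>a\<close> makes the first entry \<open>p\<close> of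
    \<open>f1\<close> a value of \<open>f2\<close> scaled by \<open>a\<close>.\<close>
  obtain p f1' q f2' where pq: "f1 = p # f1'" "f2 = q # f2'" using ne by (meson neq_Nil_conv)
  define a where "a = p / q"
  have pq0: "p \<noteq> 0" "q \<noteq> 0" using anis_nonzero[OF anis(1)] anis_nonzero[OF anis(2)] pq by auto
  then have a: "a \<noteq> 0" by (simp add: a_def)
  have "bf f1 (unit_fun 0) (unit_fun 0) = p" "bf f2 (unit_fun 0) (unit_fun 0) = q"
    using bf_unit[of 0 f1] bf_unit[of 0 f2] pq by (simp_all add: unit_fun_def)
  then have iso1: "\<not> anis (f1 @ map ((*) (- a)) f2)"
    using pq0 by (intro common_value_isotropic) (auto simp: a_def)
  \<comment> \<open>The bound of \<open>sim_diag\<close> for \<open>Suc m\<close> is exactly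
    \<open>3 * 2 ^ m\<close>. Isotropy makes it strict for \<open>xs\<close>, and similarity will
    pass the strictness on to \<open>ys\<close>.\<close>
  obtain xs where xs: "anis xs" "wcls xs = wcls f1 - rk a * wcls f2" "length xs < 3 * 2 ^ m"
    using anis_rep[of "f1 @ map ((*) (- a)) f2"] iso1 lens unfolding wcls_difference by auto
  obtain ys where ys: "anis ys" "wcls ys = wcls g1 - rk a * wcls f2" "length ys \<le> 3 * 2 ^ m"
    using anis_rep[of "g1 @ map ((*) (- a)) f2"] lens unfolding wcls_difference by auto
  have "wcls xs = (wcls f1 + wcls f2) - (1 + rk a) * wcls f2" unfolding xs by (simp add: algebra_simps)
  then have xsI: "wcls xs \<in> IW (Suc m)" using f12 IW_Suc_mult_plus[OF f2 a] by (simp add: IW_diff)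
  have xy: "wcls xs - wcls ys = wcls f1 - wcls g1" unfolding xs ys by simp
  have "wcls ys = wcls xs - (wcls f1 - wcls g1)" unfolding xs ys by simp
  then have ysI: "wcls ys \<in> IW (Suc m)" using xsI IW_Suc_subset[OF fg] by (simp add: IW_diff)
  have xs_ne: "xs \<noteq> []"
  proof
    assume "xs = []"
    then have "wcls f1 = rk a * wcls f2" using xs by simp
    then show False using similar_length[OF two anis(2,1) a] lens by simp
  qed
  have ys_ne: "ys \<noteq> []"
  proof
    assume "ys = []"
    then have "wcls g1 = rk a * wcls f2" using ys by simp
    then show False using similar_length[OF two anis(2,3) a] lens by simp
  qed
  obtain c where c: "c \<noteq> 0" "wcls ys = rk c * wcls xs"
    using sim xs_ne ys_ne xs(1) ys(1) _ _ xsI ysI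
  proof (rule sim_diagD)
    show "wcls xs - wcls ys \<in> IW (Suc (Suc m))" unfolding xy by (rule fg)
  qed (use xs(3) ys(3) in simp_all)
  \<comment> \<open>Hence \<open>ys\<close> is shorter than the form it represents, which must be
    isotropic.\<close>
  have "length xs = length ys" using similar_length[OF two xs(1) ys(1) c] .
  then have iso2: "\<not> anis (g1 @ map ((*) (- a)) f2)"
    using anis_length_le(1)[OF two, of "g1 @ map ((*) (- a)) f2" ys] ys(2) xs(3) lens
    unfolding wcls_difference by auto
  obtain v w where vw: "bf f1 v v = a * bf f2 w w" "bf f2 w w \<noteq> 0"
    using isotropic_common_value[OF anis(1,2) a iso1] .
  obtain v' w' where vw': "bf g1 v' v' = a * bf f2 w' w'" "bf f2 w' w' \<noteq> 0"
    using isotropic_common_value[OF anis(3,2) a iso2] .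
  \<comment> \<open>\<open>k\<close> is the ratio of the two values of \<open>f2\<close> that yield
    common values with \<open>g1\<close> and with \<open>f1\<close>.\<close>
  define k where "k = bf f2 w' w' / bf f2 w w"
  have k: "k \<noteq> 0" "bf f2 w' w' = k * bf f2 w w" using vw vw' by (simp_all add: k_def)
  \<comment> \<open>The difference of \<open>f2\<close> and its multiple by \<open>k\<close> is
    isotropic of dimension 2^(m + 1), the boundary case of the Hauptsatz for
    \<open>Suc m\<close>.\<close>
  have kI: "(1 - rk k) * wcls f2 = 0"
  proof -
    have "\<not> anis (f2 @ map ((*) (- k)) f2)" using k vw by (intro common_value_isotropic) auto
    moreover have eq: "wcls (f2 @ map ((*) (- k)) f2) = (1 - rk k) * wcls f2"
      unfolding wcls_difference by (simp add: algebra_simps)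
    ultimately show ?thesis
      using hauptsatz_zero[OF two, of "f2 @ map ((*) (- k)) f2" "Suc m"] IW_Suc_mult[OF f2 k(1)] lens by simp
  qed
  \<comment> \<open>Scaled by \<open>k\<close>, the form \<open>f1\<close> shares a value with
    \<open>g1\<close>, so the same boundary case applies one power higher.\<close>
  have "wcls (map ((*) k) f1 @ map ((*) (- 1)) g1) = 0"
  proof (rule hauptsatz_zero[OF two])
    have "wcls (map ((*) k) f1 @ map ((*) (- 1)) g1) = (wcls f1 - wcls g1) - (1 - rk k) * (wcls f1 + wcls f2)"
      using kI unfolding wcls_difference wcls_map_mult by (simp add: algebra_simps)
    then show "wcls (map ((*) k) f1 @ map ((*) (- 1)) g1) \<in> IW (Suc (Suc m))"
      using fg IW_Suc_mult[OF f12 k(1)] by (simp add: IW_diff)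
    have "bf (map ((*) k) f1) v v = 1 * bf g1 v' v'" using vw vw' k by (simp add: bf_map_mult)
    then show "length (map ((*) k) f1 @ map ((*) (- 1)) g1) < 2 ^ Suc (Suc m) \<or>
        \<not> anis (map ((*) k) f1 @ map ((*) (- 1)) g1)"
      using vw' a common_value_isotropic[of "map ((*) k) f1" v 1 g1 v'] by simp
  qed (simp add: lens)
  then show ?thesis using k(1) kI unfolding wcls_difference wcls_map_mult
    by (intro exI[of _ k]) (simp add: algebra_simps)
qed

text \<open>The hypothesis for \<open>m\<close> provides a similarity factor \<open>c\<close> from
  \<open>f2\<close> to \<open>g2\<close>. Scaling the second pair by \<open>c\<close> leads to the
  normalized case, and the two factors multiply.\<close>

lemma similar_pair_small:
  fixes f1 f2 g1 g2 :: "'a::field list"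
  assumes two: "(2::'a) \<noteq> 0" and m: "m \<ge> 1" and sim: "sim_diag TYPE('a) m" "sim_diag TYPE('a) (Suc m)"
    and anis: "anis f1" "anis f2" "anis g1" "anis g2" and ne: "f1 \<noteq> []" "f2 \<noteq> []" "g2 \<noteq> []"
    and len: "length f1 + length f2 \<le> 3 * 2 ^ m" "length g1 + length g2 \<le> 3 * 2 ^ m"
    and small: "2 * length f2 \<le> 3 * 2 ^ m" "2 * length g2 \<le> 3 * 2 ^ m"
    and IW: "wcls f2 \<in> IW m" "wcls g2 \<in> IW m" "wcls f1 + wcls f2 \<in> IW (Suc m)" "wcls g1 + wcls g2 \<in> IW (Suc m)"
    and fg2: "wcls f2 - wcls g2 \<in> IW (Suc m)"
    and fg: "wcls f1 + wcls f2 - (wcls g1 + wcls g2) \<in> IW (Suc (Suc m))"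
  shows "\<exists>c. c \<noteq> 0 \<and> wcls g1 = rk c * wcls f1 \<and> wcls g2 = rk c * wcls f2"
proof -
  define B :: nat where "B = 2 ^ m + 2 ^ (m - 1)"
  \<comment> \<open>The dimension bound of \<open>sim_diag\<close> for \<open>m\<close> is half of
    the bound for \<open>Suc m\<close>.\<close>
  have half: "2 * B = 3 * 2 ^ m" using m by (cases m) (auto simp: B_def)
  obtain c where c: "c \<noteq> 0" "wcls g2 = rk c * wcls f2"
  proof (rule sim_diagD[OF sim(1) ne(2,3) anis(2,4) _ _ IW(1,2) fg2])
    show "length f2 \<le> 2 ^ m + 2 ^ (m - 1)" using small half unfolding B_def[symmetric] by linarith
    show "length g2 \<le> 2 ^ m + 2 ^ (m - 1)" using small half unfolding B_def[symmetric] by linarith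
  qed blast
  have cc: "rk c * rk c = 1" using c(1) by (rule rk_mult_self)
  have cg2: "rk c * wcls g2 = wcls f2" unfolding c(2) using cc by (simp flip: mult.assoc)
  have "length f2 = length g2" using similar_length[OF two anis(2,4) c] .
  then have 2: "length (map ((*) c) g1) + length f2 \<le> 3 * 2 ^ m" using len by simp
  have 3: "wcls f1 - wcls (map ((*) c) g1) \<in> IW (Suc (Suc m))"
  proof -
    \<comment> \<open>Scaling by \<open>c\<close> changes a class in \<open>IW (Suc m)\<close> only
      by an element of the next power.\<close>
    have eq: "wcls f1 - wcls (map ((*) c) g1)
        = wcls f1 + wcls f2 - (wcls g1 + wcls g2) + (1 - rk c) * (wcls g1 + wcls g2)"
      unfolding wcls_map_mult by (simp add: algebra_simps cg2)
    show ?thesis unfolding eq by (rule IW_add[OF fg IW_Suc_mult[OF IW(4) c(1)]])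
  qed
  have 1: "anis (map ((*) c) g1)" using anis(3) c(1) by (simp add: anis_map_mult)
  obtain k where k: "k \<noteq> 0" "rk c * wcls g1 = rk k * wcls f1" "rk k * wcls f2 = wcls f2"
    using similar_pair_normalized[OF two sim(2) anis(1,2) 1 ne(1,2) len(1) 2 IW(1,3) 3]
    unfolding wcls_map_mult by auto
  have "wcls g1 = rk c * (rk c * wcls g1)" using cc by (simp flip: mult.assoc)
  then have "wcls g1 = rk (c * k) * wcls f1" unfolding k(2) by (simp add: rk_mult mult.assoc)
  moreover have "wcls g2 = rk (c * k) * wcls f2" unfolding c(2) rk_mult mult.assoc k(3) ..
  ultimately show ?thesis using c k by (intro exI[of _ "c * k"]) simp
qed

text \<open>The first pair consists of \<open>f1\<close> alone. By the Hauptsatz a nonempty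
  \<open>g1\<close> or \<open>g2\<close> has dimension at least \<open>2 * 2 ^ m\<close>, so the
  total bound allows only one of them, and that one is compared with \<open>f1\<close>.\<close>

lemma similar_pair_unimodular:
  fixes f1 g1 g2 :: "'a::field list"
  assumes two: "(2::'a) \<noteq> 0" and sim: "sim_diag TYPE('a) (Suc m)"
    and anis: "anis f1" "anis g1" "anis g2" and ne: "f1 \<noteq> []" "g1 \<noteq> [] \<or> g2 \<noteq> []"
    and len: "length f1 \<le> 3 * 2 ^ m" "length g1 + length g2 \<le> 3 * 2 ^ m"
    and IW: "wcls f1 \<in> IW (Suc m)" "wcls g2 \<in> IW (Suc m)" "wcls g1 + wcls g2 \<in> IW (Suc m)"
    and fg: "wcls f1 - (wcls g1 + wcls g2) \<in> IW (Suc (Suc m))"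
  shows "\<exists>c. c \<noteq> 0 \<and> (wcls g1 = rk c * wcls f1 \<and> wcls g2 = 0 \<or> wcls g2 = rk c * wcls f1 \<and> wcls g1 = 0)"
proof -
  have g1: "wcls g1 \<in> IW (Suc m)" using IW_diff[OF IW(3,2)] by simp
  have sim': "\<exists>c. c \<noteq> 0 \<and> wcls g = rk c * wcls f1"
    if "anis g" "g \<noteq> []" "length g \<le> 3 * 2 ^ m" "wcls g \<in> IW (Suc m)" "wcls f1 - wcls g \<in> IW (Suc (Suc m))" for g
    using sim_diagD[OF sim ne(1) that(2) anis(1) that(1) _ _ IW(1) that(4,5)] that(3) len(1) by auto
  have "length g1 = 0 \<or> 2 ^ Suc m \<le> length g1" "length g2 = 0 \<or> 2 ^ Suc m \<le> length g2"
    using hauptsatz[OF two anis(2) g1] hauptsatz[OF two anis(3) IW(2)] by auto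
  moreover have "\<not> (2 ^ Suc m \<le> length g1 \<and> 2 ^ Suc m \<le> length g2)"
  proof
    assume "2 ^ Suc m \<le> length g1 \<and> 2 ^ Suc m \<le> length g2"
    then have "2 * 2 ^ m \<le> length g1" "2 * 2 ^ m \<le> length g2" by simp_all
    then show False using len(2) zero_less_power[of "2::nat" m] by linarith
  qed
  ultimately consider "g1 = []" "g2 \<noteq> []" | "g2 = []" "g1 \<noteq> []" using ne(2) by auto
  then show ?thesis
  proof cases
    case 1
    then show ?thesis using sim'[of g2] anis len IW fg by auto
  next
    case 2
    then show ?thesis using sim'[of g1] anis len g1 fg by auto
  qed
qed

text \<open>The two elements differ by y + y = (1 + rk 1) y, which lies one power higher than
  y.\<close>

lemma IW_plus_iff_diff: "y \<in> IW m \<Longrightarrow> x + y \<in> IW (Suc m) \<longleftrightarrow> x - y \<in> IW (Suc m)"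
proof -
  assume "y \<in> IW m"
  then have 2: "y + y \<in> IW (Suc m)" using IW_Suc_mult_plus[of y m 1] by (simp add: distrib_right)
  show ?thesis using IW_diff[OF _ 2, of "x + y"] IW_add[OF _ 2, of "x - y"] by (auto simp: algebra_simps)
qed

text \<open>The conclusion allows exchanged residues because a uniformizer as factor exchanges them.
  If none is empty, each pair has a member of at most half the total bound. All four differences
  between the pairs lie in \<open>IW (Suc m)\<close>, so whichever members are small can be
  compared.\<close>

theorem similar_pair:
  fixes f1 f2 g1 g2 :: "'a::field list"
  assumes two: "(2::'a) \<noteq> 0" and m: "m \<ge> 1" and sim: "sim_diag TYPE('a) m" "sim_diag TYPE('a) (Suc m)"
    and anis: "anis f1" "anis f2" "anis g1" "anis g2"
    and ne: "f1 \<noteq> [] \<or> f2 \<noteq> []" "g1 \<noteq> [] \<or> g2 \<noteq> []"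
    and len: "length f1 + length f2 \<le> 3 * 2 ^ m" "length g1 + length g2 \<le> 3 * 2 ^ m"
    and IW: "wcls f2 \<in> IW m" "wcls g2 \<in> IW m" "wcls f1 + wcls f2 \<in> IW (Suc m)" "wcls g1 + wcls g2 \<in> IW (Suc m)"
    and fg2: "wcls f2 - wcls g2 \<in> IW (Suc m)"
    and fg: "wcls f1 + wcls f2 - (wcls g1 + wcls g2) \<in> IW (Suc (Suc m))"
  shows "\<exists>c. c \<noteq> 0 \<and> (wcls g1 = rk c * wcls f1 \<and> wcls g2 = rk c * wcls f2 \<or>
    wcls g1 = rk c * wcls f2 \<and> wcls g2 = rk c * wcls f1)"
proof -
  have IW1: "wcls f1 \<in> IW m" "wcls g1 \<in> IW m"
    using IW_diff[OF IW_Suc_subset[OF IW(3)] IW(1)] IW_diff[OF IW_Suc_subset[OF IW(4)] IW(2)] by simp_all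
  have f12: "wcls f1 - wcls f2 \<in> IW (Suc m)" and g12: "wcls g1 - wcls g2 \<in> IW (Suc m)"
    using IW_plus_iff_diff[OF IW(1)] IW_plus_iff_diff[OF IW(2)] IW(3,4) by simp_all
  have fg12: "wcls f1 - wcls g2 \<in> IW (Suc m)" using IW_add[OF f12 fg2] by simp
  have fg21: "wcls f2 - wcls g1 \<in> IW (Suc m)" using IW_diff[OF fg2 g12] by simp
  have fg11: "wcls f1 - wcls g1 \<in> IW (Suc m)" using IW_diff[OF fg12 g12] by simp
  have gf: "wcls g1 + wcls g2 - (wcls f1 + wcls f2) \<in> IW (Suc (Suc m))" using IW_uminus[OF fg] by simp
  have inv: "x = rk c * y \<Longrightarrow> y = rk c * x" if "c \<noteq> 0" for c :: 'a and x y
    using rk_mult_self[OF that] by (simp flip: mult.assoc)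
  consider "f2 = []" | "f1 = []" | "g2 = []" | "g1 = []" | "f1 \<noteq> []" "f2 \<noteq> []" "g1 \<noteq> []" "g2 \<noteq> []"
    by blast
  then show ?thesis
  proof cases
    case 1
    then have "wcls g2 \<in> IW (Suc m)" using IW_uminus[OF fg2] by simp
    then obtain c where "c \<noteq> 0" "wcls g1 = rk c * wcls f1 \<and> wcls g2 = 0 \<or> wcls g2 = rk c * wcls f1 \<and> wcls g1 = 0"
      using similar_pair_unimodular[OF two sim(2) anis(1,3,4) _ ne(2) _ len(2) _ _ IW(4)] 1 ne(1) len(1) IW(3) fg
      by auto
    then show ?thesis using 1 by auto
  next
    case 2
    then have "wcls g2 \<in> IW (Suc m)" using IW_uminus[OF fg12] by simp
    then obtain c where "c \<noteq> 0" "wcls g1 = rk c * wcls f2 \<and> wcls g2 = 0 \<or> wcls g2 = rk c * wcls f2 \<and> wcls g1 = 0"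
      using similar_pair_unimodular[OF two sim(2) anis(2,3,4) _ ne(2) _ len(2) _ _ IW(4)] 2 ne(1) len(1) IW(3) fg
      by auto
    then show ?thesis using 2 by auto
  next
    case 3
    then have "wcls f2 \<in> IW (Suc m)" using fg2 by simp
    then obtain c where "c \<noteq> 0" "wcls f1 = rk c * wcls g1 \<and> wcls f2 = 0 \<or> wcls f2 = rk c * wcls g1 \<and> wcls f1 = 0"
      using similar_pair_unimodular[OF two sim(2) anis(3,1,2) _ ne(1) _ len(1) _ _ IW(3)] 3 ne(2) len(2) IW(4) gf
      by auto
    then show ?thesis using 3 inv by (metis mult_zero_right wcls_Nil)
  next
    case 4
    then have "wcls f2 \<in> IW (Suc m)" using fg21 by simp
    then obtain c where "c \<noteq> 0" "wcls f1 = rk c * wcls g2 \<and> wcls f2 = 0 \<or> wcls f2 = rk c * wcls g2 \<and> wcls f1 = 0"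
      using similar_pair_unimodular[OF two sim(2) anis(4,1,2) _ ne(1) _ len(1) _ _ IW(3)] 4 ne(2) len(2) IW(4) gf
      by auto
    then show ?thesis using 4 inv by (metis mult_zero_right wcls_Nil)
  next
    case 5
    note small = similar_pair_small[OF two m sim]
    have len': "length f2 + length f1 \<le> 3 * 2 ^ m" "length g2 + length g1 \<le> 3 * 2 ^ m"
      using len by simp_all
    have IW': "wcls f2 + wcls f1 \<in> IW (Suc m)" "wcls g2 + wcls g1 \<in> IW (Suc m)"
      using IW(3,4) by (simp_all add: add.commute)
    consider "2 * length f2 \<le> 3 * 2 ^ m" "2 * length g2 \<le> 3 * 2 ^ m"
      | "2 * length f2 \<le> 3 * 2 ^ m" "2 * length g1 \<le> 3 * 2 ^ m"
      | "2 * length f1 \<le> 3 * 2 ^ m" "2 * length g2 \<le> 3 * 2 ^ m"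
      | "2 * length f1 \<le> 3 * 2 ^ m" "2 * length g1 \<le> 3 * 2 ^ m"
      using len by linarith
    then show ?thesis
    proof cases
      case 1
      show ?thesis
        using small[OF anis 5(1,2,4) len 1 IW fg2 fg] by blast
    next
      case 2
      show ?thesis
        using small[OF anis(1,2,4,3) 5(1,2,3) len(1) len'(2) 2 IW(1) IW1(2) IW(3) IW'(2) fg21] fg
        by (auto simp: add.commute)
    next
      case 3
      show ?thesis
        using small[OF anis(2,1,3,4) 5(2,1,4) len'(1) len(2) 3 IW1(1) IW(2) IW'(1) IW(4) fg12] fg
        by (auto simp: add.commute)
    next
      case 4
      show ?thesis
        using small[OF anis(2,1,4,3) 5(2,1,3) len' 4 IW1 IW' fg11] fg
        by (auto simp: add.commute)
    qed
  qed
qed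

section \<open>Residue forms over a 2-Henselian discrete valuation ring\<close>

locale henselian_dvr =
  fixes R :: "'k::field set" and v :: "'k \<Rightarrow> int" and res :: "'k \<Rightarrow> 'f::field"
  assumes two_k: "(2::'k) \<noteq> 0" and two_f: "(2::'f) \<noteq> 0"
    and disc: "discrete_valuation v" and R_def: "R = {x. x = 0 \<or> 0 \<le> v x}"
    and res: "residue_map R res" and hens: "two_henselian R res"
begin

section \<open>The valuation ring and its residue map\<close>

lemma v_mult: "x \<noteq> 0 \<Longrightarrow> y \<noteq> 0 \<Longrightarrow> v (x * y) = v x + v y"
  and v_add: "x \<noteq> 0 \<Longrightarrow> y \<noteq> 0 \<Longrightarrow> x + y \<noteq> 0 \<Longrightarrow> min (v x) (v y) \<le> v (x + y)"
  using disc by (auto simp: discrete_valuation_def)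

lemma v_1 [simp]: "v 1 = 0"
  using v_mult[of 1 1] by simp

lemma v_inverse: "x \<noteq> 0 \<Longrightarrow> v (inverse x) = - v x"
  using v_mult[of x "inverse x"] by simp

lemma v_uminus [simp]: "v (- x) = v x"
proof (cases "x = 0")
  case False
  have "v (- 1) = 0" using v_mult[of "- 1" "- 1"] by simp
  then show ?thesis using v_mult[of "- 1" x] False by simp
qed simp

lemma R_iff: "x \<in> R \<longleftrightarrow> x = 0 \<or> 0 \<le> v x"
  by (simp add: R_def)

lemma units_iff: "x \<in> units_in R \<longleftrightarrow> x \<noteq> 0 \<and> v x = 0"
  by (auto simp: units_in_def R_iff v_inverse)

lemma R_0 [simp]: "0 \<in> R" and R_1 [simp]: "1 \<in> R"
  by (simp_all add: R_iff)

lemma R_add: "x \<in> R \<Longrightarrow> y \<in> R \<Longrightarrow> x + y \<in> R"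
  using v_add[of x y] by (cases "x = 0 \<or> y = 0 \<or> x + y = 0") (auto simp: R_iff)

lemma R_mult: "x \<in> R \<Longrightarrow> y \<in> R \<Longrightarrow> x * y \<in> R"
  by (cases "x = 0 \<or> y = 0") (auto simp: R_iff v_mult)

lemma R_uminus: "x \<in> R \<Longrightarrow> - x \<in> R"
  by (simp add: R_iff)

lemma R_sum: "finite A \<Longrightarrow> (\<And>i. i \<in> A \<Longrightarrow> f i \<in> R) \<Longrightarrow> sum f A \<in> R"
  by (induct rule: finite_induct) (auto intro: R_add)

lemma res_1 [simp]: "res 1 = 1"
  and res_add: "x \<in> R \<Longrightarrow> y \<in> R \<Longrightarrow> res (x + y) = res x + res y"
  and res_mult: "x \<in> R \<Longrightarrow> y \<in> R \<Longrightarrow> res (x * y) = res x * res y"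
  and res_surj: "\<exists>x\<in>R. res x = c"
  and res_kernel: "{x \<in> R. res x = 0} = R - units_in R"
proof -
  show "\<exists>x\<in>R. res x = c" using res unfolding residue_map_def by (metis UNIV_I imageE)
qed (use res in \<open>auto simp: residue_map_def\<close>)

lemma res_eq_0_iff: "x \<in> R \<Longrightarrow> res x = 0 \<longleftrightarrow> x = 0 \<or> v x \<noteq> 0"
  using res_kernel units_iff by blast

lemma res_0 [simp]: "res 0 = 0"
  using res_eq_0_iff[of 0] by simp

lemma res_uminus: "x \<in> R \<Longrightarrow> res (- x) = - res x"
  using res_add[of x "- x"] R_uminus[of x] by (simp add: eq_neg_iff_add_eq_0 add.commute)

lemma res_sum: "finite A \<Longrightarrow> (\<And>i. i \<in> A \<Longrightarrow> f i \<in> R) \<Longrightarrow> res (sum f A) = (\<Sum>i\<in>A. res (f i))"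
  by (induct rule: finite_induct) (simp_all add: res_add R_sum)

lemma R_unit_inverse: "x \<noteq> 0 \<Longrightarrow> v x = 0 \<Longrightarrow> inverse x \<in> R"
  by (simp add: R_iff v_inverse)

lemma res_inverse: "x \<noteq> 0 \<Longrightarrow> v x = 0 \<Longrightarrow> res (inverse x) = inverse (res x)"
  using res_mult[of x "inverse x"] R_unit_inverse[of x] by (simp add: R_iff inverse_unique)

section \<open>Uniformizer, angular components and residues of one-dimensional forms\<close>

definition unif :: 'k where "unif = (SOME t. t \<noteq> 0 \<and> v t = 1)"

lemma unif: "unif \<noteq> 0" "v unif = 1"
proof -
  have "1 \<in> v ` (UNIV - {0})" using disc by (simp add: discrete_valuation_def)
  then have "\<exists>t. t \<noteq> 0 \<and> v t = 1" by auto
  then have "unif \<noteq> 0 \<and> v unif = 1" unfolding unif_def by (rule someI_ex)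
  then show "unif \<noteq> 0" "v unif = 1" by auto
qed

lemma v_power: "x \<noteq> 0 \<Longrightarrow> v (x ^ n) = int n * v x"
  by (induct n) (simp_all add: v_mult algebra_simps)

lemma v_unif_powi: "v (unif powi k) = k"
  using unif by (cases k rule: int_cases2) (simp_all add: power_int_minus v_power v_inverse)

text \<open>The angular component with respect to \<open>unif\<close>.\<close>

definition ac :: "'k \<Rightarrow> 'f" where "ac x = res (x * unif powi (- v x))"

lemma ac_0 [simp]: "ac 0 = 0" by (simp add: ac_def)

lemma v_normalized: "x \<noteq> 0 \<Longrightarrow> v (x * unif powi k) = v x + k"
  using unif by (simp add: v_mult v_unif_powi)

lemma ac_nonzero: "x \<noteq> 0 \<Longrightarrow> ac x \<noteq> 0"
  unfolding ac_def using unif by (subst res_eq_0_iff) (simp_all add: R_iff v_normalized)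

lemma ac_eq_0_iff [simp]: "ac x = 0 \<longleftrightarrow> x = 0"
  using ac_nonzero by auto

lemma ac_mult: "ac (x * y) = ac x * ac y"
proof (cases "x = 0 \<or> y = 0")
  case False
  then have eq: "(x * y) * unif powi (- v (x * y)) = (x * unif powi (- v x)) * (y * unif powi (- v y))"
    using unif by (simp add: v_mult power_int_add power_int_diff power_int_minus field_simps)
  show ?thesis unfolding ac_def eq using False by (intro res_mult) (simp_all add: R_iff v_normalized)
qed auto

lemma ac_unit: "v u = 0 \<Longrightarrow> ac u = res u"
  by (simp add: ac_def)

lemma ac_unif: "ac unif = 1"
  using unif by (simp add: ac_def power_int_minus)

lemma ac_add_normalized:
  assumes "x \<noteq> 0" "y \<noteq> 0" "v x \<le> v y"
  shows "res ((x + y) * unif powi (- v x)) = ac x + res (y * unif powi (- v x))"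
    and "(x + y) * unif powi (- v x) \<in> R"
proof -
  have R: "x * unif powi (- v x) \<in> R" "y * unif powi (- v x) \<in> R"
    using assms by (simp_all add: R_iff v_normalized)
  then show "res ((x + y) * unif powi (- v x)) = ac x + res (y * unif powi (- v x))"
    "(x + y) * unif powi (- v x) \<in> R"
    unfolding distrib_right ac_def by (simp_all add: res_add R_add)
qed

lemma ac_add_less:
  assumes "x \<noteq> 0" "y \<noteq> 0" "v x < v y"
  shows "x + y \<noteq> 0" "v (x + y) = v x" "ac (x + y) = ac x"
proof -
  have "res (y * unif powi (- v x)) = 0"
    using assms by (subst res_eq_0_iff) (simp_all add: R_iff v_normalized)
  then have r: "res ((x + y) * unif powi (- v x)) = ac x" using ac_add_normalized(1)[of x y] assms by simp
  then have "res ((x + y) * unif powi (- v x)) \<noteq> 0" using assms by simp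
  then have "x + y \<noteq> 0" "v ((x + y) * unif powi (- v x)) = 0"
    using res_eq_0_iff[OF ac_add_normalized(2)[of x y]] assms by auto
  then show "x + y \<noteq> 0" "v (x + y) = v x" "ac (x + y) = ac x"
    using r by (simp_all add: v_normalized) (simp add: ac_def v_normalized)
qed

text \<open>After normalization the residues add up, and a larger valuation of the sum means that
  they cancel. The sum 0 is listed separately because \<open>v 0\<close> is unspecified.\<close>

lemma ac_add_eq:
  assumes "x \<noteq> 0" "y \<noteq> 0" "v x = v y"
  shows "x + y \<noteq> 0 \<Longrightarrow> v (x + y) = v x \<Longrightarrow> ac (x + y) = ac x + ac y"
    and "x + y = 0 \<or> v x \<noteq> v (x + y) \<Longrightarrow> ac y = - ac x"
proof -
  have y: "res (y * unif powi (- v x)) = ac y" using assms by (simp add: ac_def)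
  have r: "res ((x + y) * unif powi (- v x)) = ac x + ac y"
    using ac_add_normalized(1)[of x y] assms y by simp
  show "v (x + y) = v x \<Longrightarrow> ac (x + y) = ac x + ac y" using r by (simp add: ac_def[of "x + y"])
  assume "x + y = 0 \<or> v x \<noteq> v (x + y)"
  then have "res ((x + y) * unif powi (- v x)) = 0"
    using res_eq_0_iff[OF ac_add_normalized(2)[of x y]] assms by (auto simp: v_normalized)
  then show "ac y = - ac x" using r by (simp add: eq_neg_iff_add_eq_0 add.commute)
qed

text \<open>The residue homomorphisms of the Witt group: the first one is \<open>resd True\<close>, the second one
  (with respect to the uniformizer) is \<open>resd False\<close>.\<close>

definition resd :: "bool \<Rightarrow> 'k \<Rightarrow> 'f witt" where
  "resd b x = (if even (v x) = b then rk (ac x) else 0)"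

lemma resd_0 [simp]: "resd b 0 = 0" by (simp add: resd_def)

lemma resd_square: "c \<noteq> 0 \<Longrightarrow> resd b (a * c\<^sup>2) = resd b a"
proof (cases "a = 0")
  case False
  assume c: "c \<noteq> 0"
  have "v (a * c\<^sup>2) = v a + 2 * v c" using c False by (simp add: v_mult v_power)
  moreover have "rk (ac (a * c\<^sup>2)) = rk (ac a)"
    using c rk_square[of "ac c" "ac a"] by (simp add: ac_mult power2_eq_square)
  ultimately show ?thesis by (simp add: resd_def)
qed simp

lemma resd_add_less:
  assumes "x \<noteq> 0" "y \<noteq> 0" "v x < v y"
  shows "resd b x + resd b y = resd b (x + y) + resd b (x * y * (x + y))"
proof -
  note a = ac_add_less[OF assms]
  have "resd b (x * y * (x + y)) = resd b y"
  proof -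
    have "v (x * y * (x + y)) = v y + 2 * v x" using assms a by (simp add: v_mult)
    moreover have "rk (ac (x * y * (x + y))) = rk (ac y)"
      using rk_square[of "ac x" "ac y"] assms a by (simp add: ac_mult power2_eq_square ac_simps)
    ultimately show ?thesis by (simp add: resd_def)
  qed
  then show ?thesis using a by (simp add: resd_def)
qed

text \<open>With different valuations both sides agree up to squares. With equal valuations and no
  cancellation this is \<open>rk_add\<close> over the residue field; under cancellation the angular
  components are opposite and both sides are 0.\<close>

lemma resd_add: "resd b x + resd b y = resd b (x + y) + resd b (x * y * (x + y))"
proof -
  consider "x = 0 \<or> y = 0" | "x \<noteq> 0" "y \<noteq> 0" "v x < v y" | "x \<noteq> 0" "y \<noteq> 0" "v y < v x"
    | "x \<noteq> 0" "y \<noteq> 0" "v x = v y" "x + y \<noteq> 0" "v (x + y) = v x"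
    | "x \<noteq> 0" "y \<noteq> 0" "v x = v y" "x + y = 0 \<or> v x \<noteq> v (x + y)"
    using less_linear[of "v x" "v y"] by metis
  then show ?thesis
  proof cases
    case 2
    then show ?thesis by (rule resd_add_less)
  next
    case 3
    then show ?thesis using resd_add_less[of y x] by (simp add: ac_simps)
  next
    case 4
    then have "ac (x + y) = ac x + ac y" using ac_add_eq by blast
    moreover have "v (x * y * (x + y)) = v x + 2 * v x" using 4 by (simp add: v_mult)
    ultimately show ?thesis using 4 rk_add[of "ac x" "ac y"] by (simp add: resd_def ac_mult)
  next
    case 5
    then have ac: "ac y = - ac x" using ac_add_eq by blast
    have "resd b x + resd b y = 0" using 5 ac by (simp add: resd_def rk_uminus)
    moreover have "resd b (x + y) + resd b (x * y * (x + y)) = 0"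
    proof (cases "x + y = 0")
      case False
      have "v (x * y * (x + y)) = v (x + y) + 2 * v x" using 5 False by (simp add: v_mult)
      moreover have "ac (x * y * (x + y)) = - (ac (x + y) * (ac x)\<^sup>2)"
        by (simp add: ac_mult ac power2_eq_square)
      then have "rk (ac (x * y * (x + y))) = - rk (ac (x + y))"
        using rk_square[of "ac x" "ac (x + y)"] 5 by (simp add: rk_uminus)
      ultimately show ?thesis by (simp add: resd_def)
    qed simp
    ultimately show ?thesis by simp
  qed auto
qed

section \<open>Residue homomorphisms and powers of the fundamental ideal\<close>

lemma witt_map_resd: "witt_map (resd b)"
  by (rule witt_map.intro[OF resd_0 resd_square resd_add])

definition D :: "bool \<Rightarrow> 'k witt \<Rightarrow> 'f witt" where "D b = wlift (resd b)"

lemma D_rk: "D b (rk a) = resd b a" and D_0 [simp]: "D b 0 = 0"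
  and D_add: "D b (x + y) = D b x + D b y" and D_diff: "D b (x - y) = D b x - D b y"
  unfolding D_def using witt_map_resd[of b]
  by (simp_all add: witt_map.wlift_rk witt_map.wlift_0 witt_map.wlift_add witt_map.wlift_diff)

text \<open>A factor of even valuation keeps the two residues in place, one of odd valuation
  exchanges them; the index \<open>even (v a) = b\<close> encodes this.\<close>

lemma D_rk_mult: "a \<noteq> 0 \<Longrightarrow> D b (rk a * x) = rk (ac a) * D (even (v a) = b) x"
proof (induct x rule: witt_induct)
  case (add c x)
  have "resd b (a * c) = rk (ac a) * resd (even (v a) = b) c"
    using add(2) by (cases "c = 0") (auto simp: resd_def v_mult ac_mult rk_mult)
  then show ?case using add by (simp add: distrib_left D_add D_rk flip: rk_mult)
qed simp

text \<open>What membership in \<open>IW n\<close> implies for the residues. A single residue need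
  not lie in \<open>IW n\<close>, as the one-fold Pfister form of a uniformizer shows. For
  \<open>n = 0\<close> the truncated \<open>n - 1\<close> is harmless, \<open>IW 0\<close> being
  everything.\<close>

definition graded :: "nat \<Rightarrow> 'k witt \<Rightarrow> bool" where
  "graded n x \<longleftrightarrow> D False x \<in> IW (n - 1) \<and> D True x + D False x \<in> IW n"

lemma graded_True: "graded n x \<Longrightarrow> D True x \<in> IW (n - 1)"
proof -
  assume g: "graded n x"
  then have "D True x + D False x \<in> IW (n - 1)"
    by (cases n) (auto simp: graded_def intro: IW_Suc_subset)
  then show ?thesis using IW_diff[of "D True x + D False x" "n - 1" "D False x"] g
    by (simp add: graded_def)
qed

lemma graded_add: "graded n x \<Longrightarrow> graded n y \<Longrightarrow> graded n (x + y)"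
  unfolding graded_def D_add
  using IW_add[of "D True x + D False x" n "D True y + D False y"] by (auto simp: IW_add ac_simps)

lemma graded_rk_mult: "graded n x \<Longrightarrow> a \<noteq> 0 \<Longrightarrow> graded n (rk a * x)"
proof (cases "even (v a)")
  case True
  assume "graded n x" "a \<noteq> 0"
  then show ?thesis unfolding graded_def using True
    by (auto simp: D_rk_mult IW_rk_mult simp flip: distrib_left)
next
  case False
  assume g: "graded n x" and a: "a \<noteq> 0"
  have "D True (rk a * x) + D False (rk a * x) = rk (ac a) * (D True x + D False x)"
    using False a by (simp add: D_rk_mult distrib_left)
  moreover have "D False (rk a * x) = rk (ac a) * D True x" using False a by (simp add: D_rk_mult)
  ultimately show ?thesis using g graded_True[OF g] by (simp add: graded_def IW_rk_mult)
qed

lemma graded_Suc_mult: "graded n x \<Longrightarrow> a \<noteq> 0 \<Longrightarrow> graded (Suc n) ((1 - rk a) * x)"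
proof -
  assume g: "graded n x" and a: "a \<noteq> 0"
  have eq: "(1 - rk a) * x = x - rk a * x" by (simp add: algebra_simps)
  \<comment> \<open>The sum of the residues is invariant under their exchange, so both parities of
    \<open>v a\<close> give the same formula.\<close>
  have "D True ((1 - rk a) * x) + D False ((1 - rk a) * x) = (1 - rk (ac a)) * (D True x + D False x)"
    unfolding eq D_diff D_rk_mult[OF a] by (cases "even (v a)") (simp_all add: algebra_simps)
  then have 1: "D True ((1 - rk a) * x) + D False ((1 - rk a) * x) \<in> IW (Suc n)"
    using g a by (simp add: graded_def IW_Suc_mult)
  have "D False ((1 - rk a) * x) \<in> IW n"
  proof (cases n)
    case (Suc m)
    show ?thesis
    proof (cases "even (v a)")
      case True
      then have "D False ((1 - rk a) * x) = (1 - rk (ac a)) * D False x"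
        unfolding eq D_diff D_rk_mult[OF a] by (simp add: algebra_simps)
      then show ?thesis using g Suc a by (simp add: graded_def IW_Suc_mult)
    next
      case False
      \<comment> \<open>The exchanged residue is compensated by the sum of both, which lies in the
        higher power.\<close>
      then have "D False ((1 - rk a) * x) = (D True x + D False x) - (1 + rk (ac a)) * D True x"
        unfolding eq D_diff D_rk_mult[OF a] by (simp add: algebra_simps)
      moreover have "(1 + rk (ac a)) * D True x \<in> IW n"
        using graded_True[OF g] Suc a by (simp add: IW_Suc_mult_plus)
      ultimately show ?thesis using g by (simp add: graded_def IW_diff)
    qed
  qed simp
  with 1 show ?thesis by (simp add: graded_def)
qed

lemma IW_graded: "x \<in> IW n \<Longrightarrow> graded n x"
proof (induct rule: IW_induct)
  case zero
  show ?case by (simp add: graded_def)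
next
  case (add b as x)
  have "0 \<notin> set as \<Longrightarrow> graded (length as) (pf as)" for as
  proof (induct as)
    case Nil
    show ?case by (simp add: graded_def)
  next
    case (Cons a as)
    then show ?case using graded_Suc_mult[of "length as" "pf as" a] by simp
  qed
  then show ?case using add by (intro graded_add graded_rk_mult) auto
qed

section \<open>Residue forms and lifting of isotropic vectors\<close>

definition residues :: "bool \<Rightarrow> 'k list \<Rightarrow> 'f list" where
  "residues b xs = map ac (filter (\<lambda>x. even (v x) = b) xs)"

lemma D_wcls: "D b (wcls xs) = wcls (residues b xs)"
  by (induct xs) (auto simp: residues_def D_add D_rk resd_def)

lemma length_residues: "length (residues True xs) + length (residues False xs) = length xs"
  using sum_length_filter_compl[of "\<lambda>x. even (v x)" xs] by (simp add: residues_def)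

lemma anis_filter: "anis xs \<Longrightarrow> anis (filter P xs)" for xs :: "'k list"
proof -
  assume anis: "anis xs"
  let ?ys = "filter P xs @ filter (\<lambda>x. \<not> P x) xs"
  have m: "mset xs = mset ?ys" by simp
  have "anis ?ys"
    using anis_length_le(2)[OF two_k anis wcls_mset[OF m]] m by (metis size_mset)
  then show ?thesis by (rule anis_append)
qed

text \<open>Lift the isotropic vector to \<open>R\<close> and correct coordinate \<open>j\<close>:
  its square has to be \<open>z\<close>, a unit with residue \<open>(w j)\<^sup>2\<close>, hence a
  square by the 2-Henselian property. Powers of \<open>unif\<close> absorb the valuations up to
  their common parity.\<close>

lemma isotropic_lift:
  fixes xs :: "'k list"
  assumes nz: "0 \<notin> set xs" and parity: "\<forall>x\<in>set xs. even (v x) = b"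
    and w: "bf (map ac xs) w w = 0" and j: "j < length xs" "w j \<noteq> 0"
  shows "\<not> anis xs"
proof
  assume anis: "anis xs"
  let ?n = "length xs"
  define u where "u i = xs ! i * unif powi (- v (xs ! i))" for i
  have nz_i: "xs ! i \<noteq> 0" if "i < ?n" for i using nz that by (auto simp: in_set_conv_nth)
  have u: "u i \<noteq> 0" "v (u i) = 0" "u i \<in> R" "res (u i) = ac (xs ! i)" if "i < ?n" for i
    using nz_i[OF that] unif by (simp_all add: u_def v_normalized R_iff ac_def)
  have "\<forall>i. \<exists>x\<in>R. res x = w i" using res_surj by blast
  then obtain x where x: "\<And>i. x i \<in> R" "\<And>i. res (x i) = w i" by metis
  define S where "S = (\<Sum>i\<in>{..<?n} - {j}. u i * (x i)\<^sup>2)"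
  define z where "z = - S * inverse (u j)"
  have SR: "S \<in> R" unfolding S_def by (intro R_sum) (auto simp: power2_eq_square intro!: R_mult u x)
  have "res S = (\<Sum>i\<in>{..<?n} - {j}. ac (xs ! i) * (w i)\<^sup>2)"
    unfolding S_def by (subst res_sum) (auto simp: power2_eq_square res_mult R_mult u x intro!: sum.cong)
  moreover have "bf (map ac xs) w w = ac (xs ! j) * (w j)\<^sup>2 + (\<Sum>i\<in>{..<?n} - {j}. ac (xs ! i) * (w i)\<^sup>2)"
    unfolding bf_def using j by (simp add: sum.remove[of "{..<?n}" j] power2_eq_square mult.assoc)
  ultimately have resS: "- res S = ac (xs ! j) * (w j)\<^sup>2" using w by (simp add: neg_eq_iff_add_eq_0 add.commute)
  have zR: "z \<in> R" unfolding z_def using u[OF j(1)] SR by (intro R_mult R_uminus R_unit_inverse)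
  have "res z = - res S * inverse (ac (xs ! j))"
    unfolding z_def using u[OF j(1)] SR by (simp add: res_mult R_uminus R_unit_inverse res_uminus res_inverse del: mult_minus_left)
  also have "\<dots> = (w j)\<^sup>2" unfolding resS using nz_i[OF j(1)] by simp
  finally have resz: "res z = (w j)\<^sup>2" .
  then have "z \<in> units_in R" using res_eq_0_iff[OF zR] j(2) by (simp add: units_iff)
  then obtain y where y: "z = y\<^sup>2" using hens resz unfolding two_henselian_def by blast
  have "y \<noteq> 0" using resz j(2) y by auto
  define x' where "x' = x(j := y)"
  have "(\<Sum>i<?n. u i * (x' i)\<^sup>2) = u j * y\<^sup>2 + S"
    using j(1) by (simp add: sum.remove[of "{..<?n}" j] S_def x'_def)
  also have "\<dots> = 0" using u(1)[OF j(1)] unfolding y[symmetric] z_def by simp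
  finally have sum0: "(\<Sum>i<?n. u i * (x' i)\<^sup>2) = 0" .
  define m where "m i = v (xs ! i) div 2" for i
  \<comment> \<open>\<open>r\<close> is the common valuation of the entries modulo 2.\<close>
  define r where "r = (if b then 0 else 1 :: int)"
  have vm: "v (xs ! i) = r + 2 * m i" if "i < ?n" for i
  proof -
    have "even (v (xs ! i)) = b" using parity nth_mem[OF that] by blast
    then show ?thesis unfolding m_def r_def by (cases b) (auto, presburger)
  qed
  define V where "V i = x' i * unif powi (- m i)" for i
  have "xs ! i * V i * V i = unif powi r * (u i * (x' i)\<^sup>2)" if "i < ?n" for i
  proof -
    have "unif powi (- v (xs ! i)) * unif powi r = unif powi (- m i) * unif powi (- m i)"
      unfolding vm[OF that] using unif by (simp flip: power_int_add)
    then show ?thesis unfolding V_def u_def by (simp add: power2_eq_square algebra_simps)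
  qed
  then have "bf xs V V = unif powi r * (\<Sum>i<?n. u i * (x' i)\<^sup>2)"
    by (simp add: bf_def sum_distrib_left)
  then have "V j = 0" using sum0 anis j(1) unfolding anis_def by simp
  then show False using \<open>y \<noteq> 0\<close> unif by (simp add: V_def x'_def)
qed

lemma anis_residues: "anis xs \<Longrightarrow> anis (residues b xs)"
proof (rule ccontr)
  assume anis: "anis xs" and "\<not> anis (residues b xs)"
  then obtain w j where "bf (residues b xs) w w = 0" "j < length (residues b xs)" "w j \<noteq> 0"
    unfolding anis_def by blast
  then have "\<not> anis (filter (\<lambda>x. even (v x) = b) xs)"
    using anis_nonzero[OF anis] by (intro isotropic_lift[of _ b w j]) (auto simp: residues_def)
  then show False using anis_filter[OF anis] by blast
qed

text \<open>An anisotropic representative has anisotropic residue forms. If their classes are 0 they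
  are empty, and so is the representative.\<close>

lemma D_injective:
  assumes "D True x = 0" "D False x = 0"
  shows "x = 0"
proof -
  obtain xs where xs: "anis xs" "wcls xs = x" using witt_anis_rep by blast
  have "residues b xs = []" for b
    using assms xs(2) anis_wcls_0[OF two_f anis_residues[OF xs(1), of b]] by (cases b) (auto simp flip: D_wcls)
  then have "xs = []" using length_residues[of xs] by simp
  then show ?thesis using xs by simp
qed

lemma unit_lift: "c \<noteq> 0 \<Longrightarrow> \<exists>u. u \<noteq> 0 \<and> v u = 0 \<and> ac u = c"
proof -
  assume c: "c \<noteq> 0"
  obtain u where u: "u \<in> R" "res u = c" using res_surj by blast
  then have "u \<noteq> 0 \<and> v u = 0" using c res_eq_0_iff[of u] by auto
  then show ?thesis using u ac_unit by blast
qed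

theorem sim_diag_lift:
  assumes m: "m \<ge> 1" and sim: "sim_diag TYPE('f) m" "sim_diag TYPE('f) (Suc m)"
  shows "sim_diag TYPE('k) (Suc m)"
  unfolding sim_diag_def
proof (intro allI impI, elim conjE)
  fix xs ys :: "'k list"
  assume ne: "xs \<noteq> []" "ys \<noteq> []" and anis: "anis xs" "anis ys"
    and len: "length xs \<le> 2 ^ Suc m + 2 ^ (Suc m - 1)" "length ys \<le> 2 ^ Suc m + 2 ^ (Suc m - 1)"
    and IW: "wcls xs \<in> IW (Suc m)" "wcls ys \<in> IW (Suc m)" "wcls xs - wcls ys \<in> IW (Suc m + 1)"
  have g: "graded (Suc m) (wcls xs)" "graded (Suc m) (wcls ys)" "graded (Suc (Suc m)) (wcls xs - wcls ys)"
    using IW by (auto intro: IW_graded)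
  note lr = length_residues[of xs] length_residues[of ys]
  have "residues True xs \<noteq> [] \<or> residues False xs \<noteq> []" "residues True ys \<noteq> [] \<or> residues False ys \<noteq> []"
    using lr ne by auto
  moreover have "length (residues True xs) + length (residues False xs) \<le> 3 * 2 ^ m"
    "length (residues True ys) + length (residues False ys) \<le> 3 * 2 ^ m"
    using lr len by simp_all
  ultimately obtain c where c: "c \<noteq> 0"
    "D True (wcls ys) = rk c * D True (wcls xs) \<and> D False (wcls ys) = rk c * D False (wcls xs) \<or>
     D True (wcls ys) = rk c * D False (wcls xs) \<and> D False (wcls ys) = rk c * D True (wcls xs)"
    using similar_pair[OF two_f m sim anis_residues anis_residues anis_residues anis_residues,
        OF anis(1) anis(1) anis(2) anis(2), of True False True False] g
    by (auto simp: graded_def D_diff algebra_simps simp flip: D_wcls)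
  obtain u where u: "u \<noteq> 0" "v u = 0" "ac u = c" using unit_lift[OF c(1)] by blast
  \<comment> \<open>\<open>unif\<close> has odd valuation and angular component 1, so the additional
    factor exchanges the residues without scaling them.\<close>
  have ut: "u * unif \<noteq> 0" "v (u * unif) = 1" "ac (u * unif) = c"
    using u unif by (simp_all add: v_mult ac_mult ac_unif)
  from c(2) show "\<exists>c. c \<noteq> 0 \<and> wcls ys = rk c * wcls xs"
  proof
    assume "D True (wcls ys) = rk c * D True (wcls xs) \<and> D False (wcls ys) = rk c * D False (wcls xs)"
    then have "wcls ys - rk u * wcls xs = 0"
      using u by (intro D_injective) (simp_all add: D_diff D_rk_mult)
    then show ?thesis using u by (intro exI[of _ u]) simp
  next
    assume "D True (wcls ys) = rk c * D False (wcls xs) \<and> D False (wcls ys) = rk c * D True (wcls xs)"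
    then have "wcls ys - rk (u * unif) * wcls xs = 0"
      using ut by (intro D_injective) (simp_all add: D_diff D_rk_mult)
    then show ?thesis using ut by (intro exI[of _ "u * unif"]) simp
  qed
qed

end

section \<open>Symmetric matrices and diagonal forms\<close>

definition bm :: "'a::field mat \<Rightarrow> (nat \<Rightarrow> 'a) \<Rightarrow> (nat \<Rightarrow> 'a) \<Rightarrow> 'a" where
  "bm A v w = (\<Sum>i<dim_row A. \<Sum>j<dim_row A. v i * A $$ (i, j) * w j)"

definition dm :: "'a::field list \<Rightarrow> 'a mat" where
  "dm xs = mat_diag (length xs) (\<lambda>i. xs ! i)"

text \<open>As for \<open>isometric\<close>, the map need not be linear;
  \<open>misom_imp_qf_isometric\<close> builds a matrix from the images of the unit vectors.\<close>

definition misom :: "'a::field mat \<Rightarrow> 'a mat \<Rightarrow> bool" where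
  "misom A B \<longleftrightarrow> dim_row A = dim_row B \<and> (\<exists>T. \<forall>v w. bm A (T v) (T w) = bm B v w)"

lemma dim_dm [simp]: "dim_row (dm xs) = length xs" "dim_col (dm xs) = length xs"
  by (simp_all add: dm_def mat_diag_def)

lemma index_dm: "i < length xs \<Longrightarrow> j < length xs \<Longrightarrow> dm xs $$ (i, j) = (if i = j then xs ! i else 0)"
  by (simp add: dm_def mat_diag_def)

lemma bm_dm [simp]: "bm (dm xs) v w = bf xs v w"
proof -
  have "(\<Sum>j<length xs. v i * dm xs $$ (i, j) * w j) = xs ! i * v i * w i" if "i < length xs" for i
  proof -
    have "(\<Sum>j<length xs. v i * dm xs $$ (i, j) * w j) = (\<Sum>j<length xs. if j = i then xs ! i * v i * w i else 0)"
      using that by (intro sum.cong) (auto simp: index_dm)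
    then show ?thesis using that by simp
  qed
  then show ?thesis by (simp add: bm_def bf_def)
qed

lemma misom_dm: "misom (dm xs) (dm ys) \<longleftrightarrow> isometric xs ys"
  by (simp add: misom_def isometric_def)

lemma misom_trans: "misom A B \<Longrightarrow> misom B C \<Longrightarrow> misom A C"
  unfolding misom_def
proof (elim conjE exE, intro conjI)
  fix S T assume "\<forall>v w. bm A (S v) (S w) = bm B v w" "\<forall>v w. bm B (T v) (T w) = bm C v w"
  then show "\<exists>T. \<forall>v w. bm A (T v) (T w) = bm C v w" by (intro exI[of _ "\<lambda>v. S (T v)"]) simp
qed simp

lemma bm_cong: "(\<And>i. i < dim_row A \<Longrightarrow> v i = v' i) \<Longrightarrow> (\<And>i. i < dim_row A \<Longrightarrow> w i = w' i) \<Longrightarrow>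
    bm A v w = bm A v' w'"
  by (simp add: bm_def)

lemma bm_sum_left: "bm A (\<lambda>i. \<Sum>l\<in>L. c l * p l i) w = (\<Sum>l\<in>L. c l * bm A (p l) w)"
proof -
  have "bm A (\<lambda>i. \<Sum>l\<in>L. c l * p l i) w
      = (\<Sum>i<dim_row A. \<Sum>j<dim_row A. \<Sum>l\<in>L. c l * (p l i * A $$ (i, j) * w j))"
    by (simp add: bm_def sum_distrib_right mult.assoc)
  also have "\<dots> = (\<Sum>i<dim_row A. \<Sum>l\<in>L. \<Sum>j<dim_row A. c l * (p l i * A $$ (i, j) * w j))"
    by (intro sum.cong refl sum.swap)
  also have "\<dots> = (\<Sum>l\<in>L. \<Sum>i<dim_row A. \<Sum>j<dim_row A. c l * (p l i * A $$ (i, j) * w j))"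
    by (rule sum.swap)
  finally show ?thesis by (simp add: bm_def sum_distrib_left)
qed

lemma bm_sum_right: "bm A v (\<lambda>j. \<Sum>l\<in>L. c l * p l j) = (\<Sum>l\<in>L. c l * bm A v (p l))"
proof -
  have "bm A v (\<lambda>j. \<Sum>l\<in>L. c l * p l j)
      = (\<Sum>i<dim_row A. \<Sum>j<dim_row A. \<Sum>l\<in>L. c l * (v i * A $$ (i, j) * p l j))"
    by (simp add: bm_def sum_distrib_left ac_simps)
  also have "\<dots> = (\<Sum>i<dim_row A. \<Sum>l\<in>L. \<Sum>j<dim_row A. c l * (v i * A $$ (i, j) * p l j))"
    by (intro sum.cong refl sum.swap)
  also have "\<dots> = (\<Sum>l\<in>L. \<Sum>i<dim_row A. \<Sum>j<dim_row A. c l * (v i * A $$ (i, j) * p l j))"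
    by (rule sum.swap)
  finally show ?thesis by (simp add: bm_def sum_distrib_left)
qed

lemma bm_add: "bm A (\<lambda>i. v i + v' i) w = bm A v w + bm A v' w"
  "bm A v (\<lambda>i. w i + w' i) = bm A v w + bm A v w'"
  by (simp_all add: bm_def algebra_simps sum.distrib)

lemma bm_diff: "bm A (\<lambda>i. v i - v' i) w = bm A v w - bm A v' w"
  "bm A v (\<lambda>i. w i - w' i) = bm A v w - bm A v w'"
  by (simp_all add: bm_def algebra_simps sum_subtractf)

lemma bm_unit:
  assumes "i < dim_row A" "j < dim_row A"
  shows "bm A (unit_fun i) (unit_fun j) = A $$ (i, j)"
proof -
  have "bm A (unit_fun i) (unit_fun j) = (\<Sum>a<dim_row A. \<Sum>b<dim_row A. if b = j then (if a = i then A $$ (i, j) else 0) else 0)"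
    unfolding bm_def by (intro sum.cong refl) (auto simp: unit_fun_def)
  then show ?thesis using assms by simp
qed

lemma misomI_basis:
  assumes dim: "dim_row A = dim_row B"
    and p: "\<And>i j. i < dim_row B \<Longrightarrow> j < dim_row B \<Longrightarrow> bm A (p i) (p j) = B $$ (i, j)"
  shows "misom A B"
proof -
  let ?T = "\<lambda>v k. \<Sum>l<dim_row B. v l * p l k"
  have "bm A (?T v) (?T w) = bm B v w" for v w
    unfolding bm_sum_left bm_sum_right bm_def[of B] by (simp add: p sum_distrib_left ac_simps)
  then show ?thesis using dim unfolding misom_def by (intro conjI exI[of _ ?T]) auto
qed

section \<open>Congruence of matrices and preservation of bilinear forms\<close>

lemma congruence_entry:
  assumes "A \<in> carrier_mat n n" "P \<in> carrier_mat n n" "i < n" "j < n"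
  shows "(P\<^sup>T * A * P) $$ (i, j) = bm A (\<lambda>k. P $$ (k, i)) (\<lambda>k. P $$ (k, j))"
  using assms by (simp add: bm_def scalar_prod_def atLeast0LessThan sum_distrib_left mult.assoc)

lemma qform_carrier: "is_qform A \<Longrightarrow> A \<in> carrier_mat (qf_dim A) (qf_dim A)"
  by (auto simp: is_qform_def qf_dim_def)

lemma nonzero_det_inverse:
  assumes A: "(A :: 'a::field mat) \<in> carrier_mat n n" and "det A \<noteq> 0"
  obtains B where "B \<in> carrier_mat n n" "A * B = 1\<^sub>m n" "B * A = 1\<^sub>m n"
proof -
  have "A \<in> Units (ring_mat TYPE('a) n ())" by (rule det_non_zero_imp_unit[OF assms])
  then show ?thesis using that by (auto simp: Units_def ring_mat_def)
qed

text \<open>The columns of \<open>P\<close> are the images of the unit vectors. Invertibility of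
  \<open>P\<close> follows from det B = (det P)^2 det A, as \<open>B\<close> is
  nondegenerate.\<close>

lemma misom_imp_qf_isometric:
  assumes A: "A \<in> carrier_mat n n" and B: "is_qform B" and m: "misom A B"
  shows "qf_isometric A B"
proof -
  obtain T where T: "\<And>v w. bm A (T v) (T w) = bm B v w" and dim: "dim_row A = dim_row B"
    using m unfolding misom_def by blast
  have Bn: "B \<in> carrier_mat n n" using B A dim by (auto simp: is_qform_def)
  define P where "P = mat n n (\<lambda>(k, j). T (unit_fun j) k)"
  have P: "P \<in> carrier_mat n n" by (simp add: P_def)
  have eq: "P\<^sup>T * A * P = B"
  proof (rule eq_matI)
    fix i j assume "i < dim_row B" "j < dim_col B"
    then have ij: "i < n" "j < n" using Bn by auto
    have "(P\<^sup>T * A * P) $$ (i, j) = bm A (T (unit_fun i)) (T (unit_fun j))"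
      unfolding congruence_entry[OF A P ij] using A ij by (intro bm_cong) (auto simp: P_def)
    then show "(P\<^sup>T * A * P) $$ (i, j) = B $$ (i, j)"
      using ij Bn by (simp add: T bm_unit)
  qed (use A P Bn in auto)
  have "det B = det P * det A * det P"
    unfolding eq[symmetric] using A P by (simp add: det_mult[of _ n] det_transpose)
  then have "det P \<noteq> 0" using B by (auto simp: is_qform_def)
  then obtain Q where "Q \<in> carrier_mat n n" "P * Q = 1\<^sub>m n" "Q * P = 1\<^sub>m n"
    using nonzero_det_inverse[OF P] by blast
  then have "invertible_mat P" using P unfolding invertible_mat_def inverts_mat_def by auto
  then show ?thesis using A P eq unfolding qf_isometric_def qf_dim_def by auto
qed

lemma qf_isometric_imp_misom:
  assumes A: "A \<in> carrier_mat n n" and i: "qf_isometric A B"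
  shows "misom A B" "misom B A"
proof -
  obtain P where P: "P \<in> carrier_mat n n" "invertible_mat P" and B: "B = P\<^sup>T * A * P"
    using i A unfolding qf_isometric_def qf_dim_def by auto
  have dims: "dim_row B = n" "dim_row A = n" using A P B by auto
  show "misom A B"
    by (rule misomI_basis[where p = "\<lambda>j k. P $$ (k, j)"]) (use dims B congruence_entry[OF A P(1)] in auto)
  obtain Q where "P * Q = 1\<^sub>m (dim_row P)" "Q * P = 1\<^sub>m (dim_row Q)"
    using P(2) unfolding invertible_mat_def inverts_mat_def by auto
  moreover from this have "dim_col Q = n" "dim_row Q = n"
    using P(1) by (metis carrier_matD index_mult_mat(3) index_one_mat(3))+
  ultimately have Q: "Q \<in> carrier_mat n n" "P * Q = 1\<^sub>m n" using P(1) by auto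
  have "Q\<^sup>T * P\<^sup>T = 1\<^sub>m n" using transpose_mult[OF P(1) Q(1)] Q(2) by simp
  have "Q\<^sup>T * B * Q = (Q\<^sup>T * P\<^sup>T) * A * (P * Q)"
    unfolding B using A P(1) Q(1) by (simp add: assoc_mult_mat[of _ n n _ n _ n])
  also have "\<dots> = A" unfolding \<open>Q\<^sup>T * P\<^sup>T = 1\<^sub>m n\<close> Q(2) using A by simp
  finally have A': "Q\<^sup>T * B * Q = A" .
  have Bc: "B \<in> carrier_mat n n" using A P(1) B by auto
  show "misom B A"
    by (rule misomI_basis[where p = "\<lambda>j k. Q $$ (k, j)"]) (use dims A' congruence_entry[OF Bc Q(1)] in auto)
qed

lemma qform_dm: "0 \<notin> set xs \<Longrightarrow> is_qform (dm xs)"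
proof -
  assume nz: "0 \<notin> set xs"
  have "dm xs * mat_diag (length xs) (\<lambda>i. inverse (xs ! i)) = mat_diag (length xs) (\<lambda>i. xs ! i * inverse (xs ! i))"
    unfolding dm_def by simp
  also have "\<dots> = 1\<^sub>m (length xs)"
    using nz by (intro eq_matI) (auto simp: mat_diag_def in_set_conv_nth)
  finally have "det (dm xs) * det (mat_diag (length xs) (\<lambda>i. inverse (xs ! i))) = 1"
    by (metis det_mult[of "dm xs" "length xs"] det_one dm_def mat_diag_dim)
  then have "det (dm xs) \<noteq> 0" by auto
  moreover have "(dm xs)\<^sup>T = dm xs" by (intro eq_matI) (auto simp: index_dm)
  ultimately show ?thesis by (simp add: is_qform_def)
qed

section \<open>Nondegeneracy, orthogonal bases and anisotropy\<close>

lemma qform_symmetric: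
  "is_qform A \<Longrightarrow> i < dim_row A \<Longrightarrow> j < dim_row A \<Longrightarrow> A $$ (i, j) = A $$ (j, i)"
  unfolding is_qform_def by (metis index_transpose_mat(1) square_mat.simps)

lemma bm_commute:
  assumes "is_qform A" shows "bm A v w = bm A w v"
proof -
  have "bm A v w = (\<Sum>j<dim_row A. \<Sum>i<dim_row A. v i * A $$ (i, j) * w j)"
    unfolding bm_def by (rule sum.swap)
  also have "\<dots> = bm A w v" unfolding bm_def by (intro sum.cong refl) (simp add: qform_symmetric[OF assms] ac_simps)
  finally show ?thesis .
qed

text \<open>Pairing \<open>u\<close> with the columns of the inverse of \<open>A\<close> recovers
  its coordinates.\<close>

lemma bm_nondegenerate:
  assumes A: "is_qform A" and u: "\<And>w. bm A u w = 0" and a: "a < dim_row A"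
  shows "u a = 0"
proof -
  obtain n where n: "n = dim_row A" by blast
  have An: "A \<in> carrier_mat n n" using A unfolding n is_qform_def by (intro carrier_matI) auto
  obtain B where B: "B \<in> carrier_mat n n" "A * B = 1\<^sub>m n"
    using nonzero_det_inverse[OF An] A by (auto simp: is_qform_def)
  have AB: "(\<Sum>j<n. A $$ (i, j) * B $$ (j, a)) = (if i = a then 1 else 0)" if "i < n" for i
  proof -
    have "(A * B) $$ (i, a) = (\<Sum>j<n. A $$ (i, j) * B $$ (j, a))"
      using An B(1) that a by (simp add: scalar_prod_def atLeast0LessThan flip: n)
    then show ?thesis unfolding B(2) using that a n by simp
  qed
  have "bm A u (\<lambda>j. B $$ (j, a)) = (\<Sum>i<n. u i * (\<Sum>j<n. A $$ (i, j) * B $$ (j, a)))"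
    unfolding bm_def n[symmetric] by (simp add: sum_distrib_left mult.assoc)
  also have "\<dots> = (\<Sum>i<n. if i = a then u a else 0)"
    by (intro sum.cong refl) (auto simp: AB)
  also have "\<dots> = u a" using a n by simp
  finally show ?thesis using u by simp
qed

text \<open>Gram-Schmidt, with \<open>pr\<close> the projection to the complement of the vectors
  found so far. If the form vanished on all projections, polarization and nondegeneracy would make
  the projections 0, so that \<open>k\<close> vectors would span a space of larger
  dimension.\<close>

lemma orthogonal_system:
  assumes two: "(2::'a::field) \<noteq> 0" and A: "is_qform (A :: 'a mat)" and "k \<le> dim_row A"
  shows "\<exists>p xs. length xs = k \<and> 0 \<notin> set xs \<and>
    (\<forall>i<k. \<forall>j<k. bm A (p i) (p j) = (if i = j then xs ! i else 0))"
  using assms(3)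
proof (induct k)
  case 0
  show ?case by (intro exI[of _ undefined] exI[of _ "[]"]) simp
next
  case (Suc k)
  let ?n = "dim_row A"
  obtain p xs where len: "length xs = k" and nz: "0 \<notin> set xs"
    and p: "\<And>i j. i < k \<Longrightarrow> j < k \<Longrightarrow> bm A (p i) (p j) = (if i = j then xs ! i else 0)"
    using Suc by auto
  have nz_i: "xs ! i \<noteq> 0" if "i < k" for i using nz len that by (auto simp: in_set_conv_nth)
  define c where "c v i = bm A v (p i) / xs ! i" for v i
  define pr where "pr v = (\<lambda>a. v a - (\<Sum>i<k. c v i * p i a))" for v
  have pr_p: "bm A (pr v) (p j) = 0" if "j < k" for v j
  proof -
    have "(\<Sum>i<k. c v i * bm A (p i) (p j)) = (\<Sum>i<k. if i = j then c v j * xs ! j else 0)"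
      using that by (intro sum.cong) (auto simp: p)
    also have "\<dots> = bm A v (p j)" using that nz_i[OF that] by (simp add: c_def)
    finally show ?thesis by (simp add: pr_def bm_diff bm_sum_left)
  qed
  have pr_pr: "bm A (pr v) (pr w) = bm A (pr v) w" for v w
    unfolding pr_def[of w] bm_diff bm_sum_right by (simp add: pr_p)
  have "\<exists>v. bm A (pr v) (pr v) \<noteq> 0"
  proof (rule ccontr)
    assume "\<not> ?thesis"
    then have iso: "bm A (pr v) (pr v) = 0" for v by blast
    have "bm A (pr v) w = 0" for v w
    proof -
      have add: "pr (\<lambda>a. v a + w a) = (\<lambda>a. pr v a + pr w a)"
        by (simp add: pr_def c_def bm_add add_divide_distrib distrib_right sum.distrib fun_eq_iff)
      have "0 = bm A (\<lambda>a. pr v a + pr w a) (\<lambda>a. pr v a + pr w a)" using iso unfolding add[symmetric] by simp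
      also have "\<dots> = 2 * bm A (pr v) (pr w)"
        unfolding bm_add iso bm_commute[OF A, of "pr w" "pr v"] by simp
      finally show ?thesis using two pr_pr by simp
    qed
    then have pr0: "pr v a = 0" if "a < ?n" for v a using bm_nondegenerate[OF A _ that] by blast
    \<comment> \<open>The expansion in the \<open>k\<close> vectors is padded to square matrices.
      Column \<open>k\<close> of \<open>Q\<close> is zero, which contradicts the invertibility of
      \<open>Q\<close>.\<close>
    define P where "P = mat ?n ?n (\<lambda>(i, a). p i a)"
    define Q where "Q = mat ?n ?n (\<lambda>(b, i). if i < k then c (unit_fun b) i else 0)"
    have PQ: "P \<in> carrier_mat ?n ?n" "Q \<in> carrier_mat ?n ?n" by (simp_all add: P_def Q_def)
    have "Q * P = 1\<^sub>m ?n"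
    proof (rule eq_matI)
      fix b a assume "b < dim_row (1\<^sub>m ?n :: 'a mat)" "a < dim_col (1\<^sub>m ?n :: 'a mat)"
      then have ab: "a < ?n" "b < ?n" by auto
      have "(Q * P) $$ (b, a) = (\<Sum>i<?n. (if i < k then c (unit_fun b) i else 0) * p i a)"
        using ab by (simp add: P_def Q_def scalar_prod_def atLeast0LessThan)
      also have "\<dots> = (\<Sum>i<k. c (unit_fun b) i * p i a)"
        using Suc.prems by (intro sum.mono_neutral_cong_right) auto
      also have "\<dots> = unit_fun b a" using pr0[OF ab(1), of "unit_fun b"] by (simp add: pr_def)
      finally show "(Q * P) $$ (b, a) = 1\<^sub>m ?n $$ (b, a)" using ab by (simp add: unit_fun_def)
    qed (use PQ in auto)
    then have "P * Q = 1\<^sub>m ?n" by (rule mat_mult_left_right_inverse[OF PQ(2,1)])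
    then have "(P * Q) $$ (k, k) = 1" using Suc.prems by simp
    moreover have "(P * Q) $$ (k, k) = 0"
      using Suc.prems by (simp add: P_def Q_def scalar_prod_def)
    ultimately show False by simp
  qed
  then obtain v where v: "bm A (pr v) (pr v) \<noteq> 0" by blast
  have pp: "bm A (p j) (pr v) = 0" if "j < k" for j
    using pr_p[OF that] bm_commute[OF A] by simp
  define x where "x = bm A (pr v) (pr v)"
  have "\<forall>i<Suc k. \<forall>j<Suc k. bm A ((p(k := pr v)) i) ((p(k := pr v)) j) = (if i = j then (xs @ [x]) ! i else 0)"
    using p pr_p pp by (auto simp: less_Suc_eq x_def nth_append len)
  moreover have "0 \<notin> set (xs @ [x])" using nz v by (auto simp: x_def)
  ultimately show ?case using len by (intro exI[of _ "p(k := pr v)"] exI[of _ "xs @ [x]"]) auto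
qed

theorem diagonalization:
  assumes two: "(2::'a::field) \<noteq> 0" and A: "is_qform (A :: 'a mat)"
  shows "\<exists>xs. 0 \<notin> set xs \<and> misom A (dm xs)"
proof -
  obtain p xs where p: "length xs = dim_row A" "0 \<notin> set xs"
    "\<forall>i<dim_row A. \<forall>j<dim_row A. bm A (p i) (p j) = (if i = j then xs ! i else 0)"
    using orthogonal_system[OF two A order_refl] by blast
  have "misom A (dm xs)"
    by (rule misomI_basis[where p = p]) (simp_all add: p index_dm)
  then show ?thesis using p(2) by blast
qed

lemma misom_dm_sym: "is_qform A \<Longrightarrow> 0 \<notin> set xs \<Longrightarrow> misom A (dm xs) \<Longrightarrow> misom (dm xs) A"
  by (rule qf_isometric_imp_misom(2)[OF qform_carrier misom_imp_qf_isometric[OF qform_carrier qform_dm]])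

text \<open>The nonzero determinant of \<open>dm xs\<close> is det A times a square.\<close>

lemma is_qformI:
  assumes A: "A \<in> carrier_mat n n" and sym: "A\<^sup>T = A" and m: "misom A (dm xs)" and nz: "0 \<notin> set xs"
  shows "is_qform A"
proof -
  obtain P where P: "P \<in> carrier_mat n n" "dm xs = P\<^sup>T * A * P"
    using misom_imp_qf_isometric[OF A qform_dm[OF nz] m] carrier_matD(1)[OF A]
    unfolding qf_isometric_def qf_dim_def by blast
  have "det (dm xs) = det P * det A * det P"
    unfolding P(2) using A P(1) by (simp add: det_mult[of _ n] det_transpose)
  then have "det A \<noteq> 0" using qform_dm[OF nz] by (auto simp: is_qform_def)
  then show ?thesis using A sym by (simp add: is_qform_def)
qed

text \<open>\<open>T\<close> and \<open>S\<close> are only known to preserve the bilinear forms. If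
  the image of a vector is zero, the vector pairs to zero with everything and vanishes by
  nondegeneracy.\<close>

lemma anisotropic_iff:
  assumes A: "is_qform A" and nz: "0 \<notin> set xs" and m: "misom A (dm xs)"
  shows "anisotropic A \<longleftrightarrow> anis xs"
proof -
  obtain n where n: "dim_row A = n" by blast
  have An: "A \<in> carrier_mat n n" using A unfolding is_qform_def n[symmetric] by (intro carrier_matI) auto
  obtain T where T: "\<And>v w. bm A (T v) (T w) = bf xs v w" and len: "n = length xs"
    using m unfolding misom_def n by auto
  obtain S where S: "\<And>v w. bf xs (S v) (S w) = bm A v w"
    using misom_dm_sym[OF A nz m] unfolding misom_def by auto
  have val: "qf_value A u = bm A (\<lambda>i. u $ i) (\<lambda>i. u $ i)" if "u \<in> carrier_vec n" for u
    using that An by (simp add: qf_value_def bm_def n scalar_prod_def atLeast0LessThan sum_distrib_left mult.assoc)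
  have aniso: "anisotropic A \<longleftrightarrow> (\<forall>v. bm A v v = 0 \<longrightarrow> (\<forall>i<n. v i = 0))"
  proof
    assume a: "anisotropic A"
    show "\<forall>v. bm A v v = 0 \<longrightarrow> (\<forall>i<n. v i = 0)"
    proof (intro allI impI)
      fix v i assume v: "bm A v v = 0" and i: "i < n"
      have "qf_value A (vec n v) = bm A v v" by (subst val) (auto intro: bm_cong simp: n)
      then have "vec n v = 0\<^sub>v n" using a v unfolding anisotropic_def qf_dim_def n by auto
      then show "v i = 0" using i using index_vec[OF i, of v] by simp
    qed
  next
    assume r: "\<forall>v. bm A v v = 0 \<longrightarrow> (\<forall>i<n. v i = 0)"
    show "anisotropic A" unfolding anisotropic_def qf_dim_def n
    proof (intro ballI impI)
      fix u assume u: "u \<in> carrier_vec n" "qf_value A u = 0"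
      have "bm A (\<lambda>i. u $ i) (\<lambda>i. u $ i) = 0"
        unfolding val[OF u(1), symmetric] by (rule u(2))
      then have "\<forall>i<n. u $ i = 0" using r[rule_format] by blast
      then show "u = 0\<^sub>v n" using u by (intro eq_vecI) auto
    qed
  qed
  show ?thesis
  proof
    assume a: "anisotropic A"
    show "anis xs" unfolding anis_def
    proof (intro allI impI)
      fix v i assume v: "bf xs v v = 0" and i: "i < length xs"
      have "\<forall>i<n. T v i = 0" using a v unfolding aniso T[symmetric] by blast
      then have "bm A (T v) (T (unit_fun i)) = 0" by (simp add: bm_def n)
      then have "xs ! i * v i = 0" unfolding T bf_commute[of xs v] using i by (simp add: bf_unit)
      then show "v i = 0" using nz i by (auto simp: in_set_conv_nth)
    qed
  next
    assume a: "anis xs"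
    show "anisotropic A" unfolding aniso
    proof (intro allI impI)
      fix v i assume v: "bm A v v = 0" and i: "i < n"
      have "\<forall>i<length xs. S v i = 0" using a v unfolding anis_def S[symmetric] by blast
      then have "bm A v w = 0" for w unfolding S[symmetric] by (rule bf_eq_0)
      then show "v i = 0" using bm_nondegenerate[OF A _ i[folded n]] by blast
    qed
  qed
qed

subsection \<open>Orthogonal sums and tensor products\<close>

lemma sum_lessThan_add: "(\<Sum>i<m + n. f i) = (\<Sum>i<m. f i) + (\<Sum>i<n. f (m + i :: nat))"
  for f :: "nat \<Rightarrow> 'a::comm_monoid_add"
  by (induct n) (simp_all add: add.assoc)

lemma orth_sum_carrier:
  "A \<in> carrier_mat m m \<Longrightarrow> B \<in> carrier_mat n n \<Longrightarrow> orth_sum A B \<in> carrier_mat (m + n) (m + n)"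
  by (auto simp: orth_sum_def)

lemma bm_orth_sum:
  assumes A: "A \<in> carrier_mat m m" and B: "B \<in> carrier_mat n n"
  shows "bm (orth_sum A B) v w = bm A v w + bm B (\<lambda>i. v (m + i)) (\<lambda>i. w (m + i))"
  using A B by (simp add: bm_def orth_sum_def sum_lessThan_add sum.distrib)

lemma misom_orth_sum:
  assumes A: "A \<in> carrier_mat m m" and B: "B \<in> carrier_mat n n"
    and "misom A (dm xs)" "misom B (dm ys)"
  shows "misom (orth_sum A B) (dm (xs @ ys))"
proof -
  obtain S where S: "\<And>v w. bm A (S v) (S w) = bf xs v w" and m: "length xs = m"
    using assms unfolding misom_def by auto
  obtain T where T: "\<And>v w. bm B (T v) (T w) = bf ys v w" and n: "length ys = n"
    using assms unfolding misom_def by auto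
  let ?U = "\<lambda>v i. if i < m then S v i else T (\<lambda>i. v (m + i)) (i - m)"
  have "bm (orth_sum A B) (?U v) (?U w) = bf (xs @ ys) v w" for v w
  proof -
    have "bm A (?U v) (?U w) = bm A (S v) (S w)" using A by (intro bm_cong) auto
    then show ?thesis unfolding bm_orth_sum[OF A B] by (simp add: S T bf_append m)
  qed
  then show ?thesis using A B m n unfolding misom_def
    by (intro conjI exI[of _ ?U]) (auto simp: orth_sum_def)
qed

lemma orth_sum_symmetric:
  assumes A: "is_qform A" and B: "is_qform B"
  shows "(orth_sum A B)\<^sup>T = orth_sum A B"
proof -
  have "dim_col A = dim_row A" "dim_col B = dim_row B" using A B by (auto simp: is_qform_def)
  then show ?thesis
    by (intro eq_matI) (auto simp: orth_sum_def qform_symmetric[OF A] qform_symmetric[OF B])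
qed

lemma qform_orth_sum:
  assumes two: "(2::'a::field) \<noteq> 0" and A: "is_qform (A::'a mat)" and B: "is_qform B"
  shows "is_qform (orth_sum A B)"
proof -
  obtain xs ys where "0 \<notin> set xs" "misom A (dm xs)" "0 \<notin> set ys" "misom B (dm ys)"
    using diagonalization[OF two] A B by blast
  then show ?thesis
    using misom_orth_sum[OF qform_carrier[OF A] qform_carrier[OF B], of xs ys]
    by (intro is_qformI[OF orth_sum_carrier[OF qform_carrier[OF A] qform_carrier[OF B]]
          orth_sum_symmetric[OF A B], of "xs @ ys"]) auto
qed

lemma sum_div_mod:
  fixes f :: "nat \<Rightarrow> nat \<Rightarrow> 'a::comm_monoid_add"
  shows "(\<Sum>k<m * n. f (k div n) (k mod n)) = (\<Sum>i<m. \<Sum>j<n. f i j)"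
proof (cases "n = 0")
  case False
  have bound: "i * n + j < m * n" if "i < m" "j < n" for i j
  proof -
    have "i * n + j < Suc i * n" using that by simp
    also have "\<dots> \<le> m * n" using that by (intro mult_le_mono1) simp
    finally show ?thesis .
  qed
  have "(\<Sum>k<m * n. f (k div n) (k mod n)) = (\<Sum>(i, j)\<in>{..<m} \<times> {..<n}. f i j)"
    by (rule sum.reindex_bij_witness[where i = "\<lambda>(i, j). i * n + j" and j = "\<lambda>k. (k div n, k mod n)"])
      (use False in \<open>auto simp: less_mult_imp_div_less intro: bound\<close>)
  then show ?thesis by (simp add: sum.cartesian_product)
qed simp

lemma lmul_nth:
  assumes "k < length xs * length ys"
  shows "lmul xs ys ! k = xs ! (k div length ys) * ys ! (k mod length ys)"
  using assms
proof (induct xs arbitrary: k)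
  case (Cons x xs)
  have n: "length ys > 0" using Cons.prems by (cases ys) auto
  show ?case
  proof (cases "k < length ys")
    case False
    then obtain l where l: "k = length ys + l" by (metis le_add_diff_inverse not_less)
    then show ?thesis using Cons n by (simp add: lmul_Cons nth_append)
  qed (simp add: lmul_Cons nth_append)
qed simp

lemma length_lmul [simp]: "length (lmul xs ys) = length xs * length ys"
  by (induct xs) (simp_all add: lmul_Cons)

lemma dim_tensor [simp]: "dim_row (qf_tensor A B) = dim_row A * dim_row B"
  "dim_col (qf_tensor A B) = dim_col A * dim_col B"
  by (simp_all add: qf_tensor_def)

lemma bm_tensor:
  assumes A: "A \<in> carrier_mat m m" and B: "B \<in> carrier_mat n n"
  shows "bm (qf_tensor A B) (\<lambda>k. v (k div n) * v' (k mod n)) (\<lambda>k. w (k div n) * w' (k mod n)) = bm A v w * bm B v' w'"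
proof -
  have "bm (qf_tensor A B) (\<lambda>k. v (k div n) * v' (k mod n)) (\<lambda>k. w (k div n) * w' (k mod n))
    = (\<Sum>k<m * n. \<Sum>l<m * n. (v (k div n) * A $$ (k div n, l div n) * w (l div n)) * (v' (k mod n) * B $$ (k mod n, l mod n) * w' (l mod n)))"
    unfolding bm_def using A B by (simp add: qf_tensor_def ac_simps)
  also have "\<dots> = (\<Sum>i<m. \<Sum>j<n. \<Sum>i'<m. \<Sum>j'<n. (v i * A $$ (i, i') * w i') * (v' j * B $$ (j, j') * w' j'))"
    by (simp only: sum_div_mod[where f = "\<lambda>i' j'. (v _ * A $$ (_, i') * w i') * (v' _ * B $$ (_, j') * w' j')"]
      sum_div_mod[where f = "\<lambda>i j. \<Sum>i'<m. \<Sum>j'<n. (v i * A $$ (i, i') * w i') * (v' j * B $$ (j, j') * w' j')"])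
  also have "\<dots> = bm A v w * bm B v' w'"
    using A B by (simp add: bm_def sum_product)
  finally show ?thesis .
qed

text \<open>Unit vectors of the product are elementary tensors, for which \<open>bm_tensor\<close>
  computes the form; the index \<open>l\<close> corresponds to the pair \<open>l div n\<close>,
  \<open>l mod n\<close>.\<close>

lemma misom_tensor:
  assumes A: "A \<in> carrier_mat m m" and B: "B \<in> carrier_mat n n"
    and "misom A (dm xs)" "misom B (dm ys)"
  shows "misom (qf_tensor A B) (dm (lmul xs ys))"
proof -
  obtain S where S: "\<And>v w. bm A (S v) (S w) = bf xs v w" and m: "length xs = m"
    using assms unfolding misom_def by auto
  obtain T where T: "\<And>v w. bm B (T v) (T w) = bf ys v w" and n: "length ys = n"
    using assms unfolding misom_def by auto
  let ?p = "\<lambda>l k. S (unit_fun (l div n)) (k div n) * T (unit_fun (l mod n)) (k mod n)"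
  show ?thesis
  proof (rule misomI_basis[where p = ?p])
    fix i j assume "i < dim_row (dm (lmul xs ys))" "j < dim_row (dm (lmul xs ys))"
    then have ij: "i < m * n" "j < m * n" by (simp_all add: m n)
    then have n0: "n > 0" by (cases n) auto
    have d: "i div n < m" "j div n < m" "i mod n < n" "j mod n < n"
      using ij n0 by (simp_all add: less_mult_imp_div_less)
    have "bm (qf_tensor A B) (?p i) (?p j) = bf xs (unit_fun (i div n)) (unit_fun (j div n)) * bf ys (unit_fun (i mod n)) (unit_fun (j mod n))"
      unfolding bm_tensor[OF A B] S T ..
    also have "\<dots> = (if i div n = j div n \<and> i mod n = j mod n then xs ! (i div n) * ys ! (i mod n) else 0)"
      using d by (simp add: bf_unit m n) (auto simp: unit_fun_def)
    also have "i div n = j div n \<and> i mod n = j mod n \<longleftrightarrow> i = j"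
      by (metis div_mult_mod_eq)
    finally show "bm (qf_tensor A B) (?p i) (?p j) = dm (lmul xs ys) $$ (i, j)"
      using ij by (simp add: index_dm m n lmul_nth)
  qed (use A B m n in simp)
qed

lemma qform_tensor:
  assumes two: "(2::'a::field) \<noteq> 0" and A: "is_qform (A::'a mat)" and B: "is_qform B"
  shows "is_qform (qf_tensor A B)"
proof -
  obtain xs ys where xy: "0 \<notin> set xs" "misom A (dm xs)" "0 \<notin> set ys" "misom B (dm ys)"
    using diagonalization[OF two] A B by blast
  have d: "dim_col A = dim_row A" "dim_col B = dim_row B" using A B by (auto simp: is_qform_def)
  have "(qf_tensor A B)\<^sup>T = qf_tensor A B"
  proof (rule eq_matI)
    fix i j assume "i < dim_row (qf_tensor A B)" "j < dim_col (qf_tensor A B)"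
    then have ij: "i < dim_row A * dim_row B" "j < dim_row A * dim_row B" using d by auto
    then have "dim_row B > 0" by (cases "dim_row B") auto
    then show "(qf_tensor A B)\<^sup>T $$ (i, j) = qf_tensor A B $$ (i, j)"
      using ij d qform_symmetric[OF A, of "i div dim_row B" "j div dim_row B"] qform_symmetric[OF B, of "i mod dim_row B" "j mod dim_row B"]
      by (simp add: qf_tensor_def less_mult_imp_div_less)
  qed (use d in auto)
  moreover have "0 \<notin> set (lmul xs ys)" using xy by (auto simp: lmul_def)
  ultimately show ?thesis
    using misom_tensor[OF qform_carrier[OF A] qform_carrier[OF B] xy(2,4)] d
    by (intro is_qformI[of _ "dim_row A * dim_row B"]) auto
qed

section \<open>Hyperbolic forms\<close>

lemma hyperbolic_Suc: "hyperbolic (Suc k) = orth_sum hyperbolic_plane (hyperbolic k)"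
  by (simp add: hyperbolic_def orth_sum_def Let_def)

lemma hyperbolic_plane_carrier: "hyperbolic_plane \<in> carrier_mat 2 2"
  by (rule carrier_matI) (simp_all add: hyperbolic_plane_def mat_of_rows_list_def)

lemma hyperbolic_carrier: "hyperbolic k \<in> carrier_mat (2 * k) (2 * k)"
proof (induct k)
  case (Suc k)
  from orth_sum_carrier[OF hyperbolic_plane_carrier Suc] show ?case by (simp add: hyperbolic_Suc)
qed (simp add: hyperbolic_def)

lemma misom_hyperbolic_plane:
  assumes "(2::'a::field) \<noteq> 0"
  shows "misom (hyperbolic_plane :: 'a mat) (dm [1, - 1])"
proof -
  define h where "h = 1 / (2::'a)"
  have h: "h + h = 1" using assms by (simp add: h_def field_simps)
  \<comment> \<open>The form 2 x y becomes <1, -1> under x = v 0 + v 1, y = (v 0 - v 1) / 2.\<close>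
  let ?T = "\<lambda>v i. if i = 0 then v 0 + v (Suc 0) else h * (v 0 - v (Suc (0::nat)))"
  have "bm (hyperbolic_plane :: 'a mat) v w = v 0 * w 1 + v 1 * w 0" for v w
    by (simp add: bm_def hyperbolic_plane_def mat_of_rows_list_def numeral_2_eq_2)
  then have "bm hyperbolic_plane (?T v) (?T w) = (h + h) * (v 0 * w 0 - v 1 * w 1)" for v w
    by (simp add: algebra_simps)
  then have "bm hyperbolic_plane (?T v) (?T w) = bf [1, - 1] v w" for v w
    unfolding h by simp
  then show ?thesis unfolding misom_def
    by (intro conjI exI[of _ ?T]) (auto simp: hyperbolic_plane_def mat_of_rows_list_def)
qed

lemma misom_hyperbolic:
  assumes two: "(2::'a::field) \<noteq> 0"
  shows "misom (hyperbolic k :: 'a mat) (dm (hyp k))"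
proof (induct k)
  case 0
  show ?case by (simp add: misom_def hyperbolic_def bm_def)
next
  case (Suc k)
  from misom_orth_sum[OF hyperbolic_plane_carrier hyperbolic_carrier misom_hyperbolic_plane[OF two] Suc]
  show ?case by (simp add: hyperbolic_Suc)
qed

section \<open>Witt classes of matrices\<close>

text \<open>Independent of the chosen diagonalization by \<open>wm_eq\<close>.\<close>

definition wm :: "'a::field mat \<Rightarrow> 'a witt" where
  "wm A = wcls (SOME xs. 0 \<notin> set xs \<and> misom A (dm xs))"

lemma wm_eq:
  assumes two: "(2::'a::field) \<noteq> 0" and A: "is_qform (A :: 'a mat)" and nz: "0 \<notin> set xs"
    and m: "misom A (dm xs)"
  shows "wm A = wcls xs"
proof -
  define ys where "ys = (SOME xs. 0 \<notin> set xs \<and> misom A (dm xs))"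
  have "0 \<notin> set ys \<and> misom A (dm ys)"
    unfolding ys_def by (rule someI[of _ xs]) (use nz m in blast)
  then have ys: "0 \<notin> set ys" "misom A (dm ys)" by auto
  have "misom (dm xs) (dm ys)" using misom_trans[OF misom_dm_sym[OF A nz m] ys(2)] .
  then have "wcls xs = wcls ys" unfolding misom_dm using isometric_wcls[OF two] nz ys(1) by blast
  then show ?thesis by (simp add: wm_def ys_def)
qed

lemma wm_dm: "(2::'a::field) \<noteq> 0 \<Longrightarrow> 0 \<notin> set xs \<Longrightarrow> wm (dm xs) = wcls (xs :: 'a list)"
  by (rule wm_eq) (simp_all add: qform_dm misom_dm)

lemma obtain_diag:
  assumes two: "(2::'a::field) \<noteq> 0" and A: "is_qform (A :: 'a mat)"
  obtains xs where "0 \<notin> set xs" "misom A (dm xs)" "wm A = wcls xs" "length xs = qf_dim A"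
proof -
  obtain xs where xs: "0 \<notin> set xs" "misom A (dm xs)" using diagonalization[OF two A] by blast
  moreover have "length xs = qf_dim A" using xs(2) by (simp add: misom_def qf_dim_def)
  ultimately show ?thesis using that wm_eq[OF two A] by blast
qed

lemma wm_orth_sum:
  assumes two: "(2::'a::field) \<noteq> 0" and A: "is_qform (A :: 'a mat)" and B: "is_qform B"
  shows "wm (orth_sum A B) = wm A + wm B"
proof -
  obtain xs where xs: "0 \<notin> set xs" "misom A (dm xs)" "wm A = wcls xs" using obtain_diag[OF two A] .
  obtain ys where ys: "0 \<notin> set ys" "misom B (dm ys)" "wm B = wcls ys" using obtain_diag[OF two B] .
  have "misom (orth_sum A B) (dm (xs @ ys))"
    using misom_orth_sum[OF qform_carrier[OF A] qform_carrier[OF B] xs(2) ys(2)] .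
  then have "wm (orth_sum A B) = wcls (xs @ ys)"
    using wm_eq[OF two qform_orth_sum[OF two A B], of "xs @ ys"] xs(1) ys(1) by simp
  then show ?thesis using xs ys by simp
qed

lemma wm_tensor:
  assumes two: "(2::'a::field) \<noteq> 0" and A: "is_qform (A :: 'a mat)" and B: "is_qform B"
  shows "wm (qf_tensor A B) = wm A * wm B"
proof -
  obtain xs where xs: "0 \<notin> set xs" "misom A (dm xs)" "wm A = wcls xs" using obtain_diag[OF two A] .
  obtain ys where ys: "0 \<notin> set ys" "misom B (dm ys)" "wm B = wcls ys" using obtain_diag[OF two B] .
  have m: "misom (qf_tensor A B) (dm (lmul xs ys))"
    using misom_tensor[OF qform_carrier[OF A] qform_carrier[OF B] xs(2) ys(2)] .
  have "0 \<notin> set (lmul xs ys)" using xs(1) ys(1) by (auto simp: lmul_def)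
  from wm_eq[OF two qform_tensor[OF two A B] this m] show ?thesis using xs ys by (simp add: wcls_lmul)
qed

lemma wm_hyperbolic:
  assumes two: "(2::'a::field) \<noteq> 0"
  shows "is_qform (hyperbolic k :: 'a mat)" and "wm (hyperbolic k :: 'a mat) = 0"
proof -
  have p: "is_qform (hyperbolic_plane :: 'a mat)"
  proof (rule is_qformI[OF hyperbolic_plane_carrier _ misom_hyperbolic_plane[OF two]])
    show "(hyperbolic_plane :: 'a mat)\<^sup>T = hyperbolic_plane"
      by (rule eq_matI) (auto simp: hyperbolic_plane_def mat_of_rows_list_def numeral_2_eq_2 less_Suc_eq)
  qed simp
  show h: "is_qform (hyperbolic k :: 'a mat)"
  proof (induct k)
    case (Suc k)
    then show ?case unfolding hyperbolic_Suc by (intro qform_orth_sum two p)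
  qed (simp add: hyperbolic_def is_qform_def)
  show "wm (hyperbolic k :: 'a mat) = 0"
    using wm_eq[OF two h _ misom_hyperbolic[OF two]] by simp
qed

lemma qf_isometric_wm:
  assumes two: "(2::'a::field) \<noteq> 0" and A: "is_qform (A :: 'a mat)" and B: "is_qform B" and "qf_isometric A B"
  shows "wm A = wm B"
proof -
  obtain xs where xs: "0 \<notin> set xs" "misom B (dm xs)" "wm B = wcls xs" using obtain_diag[OF two B] .
  have "misom A (dm xs)"
    using misom_trans[OF qf_isometric_imp_misom(1)[OF qform_carrier[OF A] assms(4)] xs(2)] .
  then show ?thesis using wm_eq[OF two A xs(1)] xs(3) by simp
qed

lemma misom_imp_qf_isometric':
  assumes A: "is_qform A" and B: "is_qform B" and "0 \<notin> set ys"
    and "misom A (dm xs)" "isometric xs ys" "misom B (dm ys)"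
  shows "qf_isometric A B"
proof (rule misom_imp_qf_isometric[OF qform_carrier[OF A] B])
  have "misom A (dm ys)" using assms(4,5) misom_trans misom_dm by blast
  then show "misom A B" using misom_trans misom_dm_sym[OF B assms(3,6)] by blast
qed

lemma wm_eq_imp_qf_isometric:
  assumes two: "(2::'a::field) \<noteq> 0" and A: "is_qform (A :: 'a mat)" and B: "is_qform B"
    and "wm A = wm B" "qf_dim A = qf_dim B"
  shows "qf_isometric A B"
proof -
  obtain xs where xs: "0 \<notin> set xs" "misom A (dm xs)" "wm A = wcls xs" "length xs = qf_dim A"
    using obtain_diag[OF two A] .
  obtain ys where ys: "0 \<notin> set ys" "misom B (dm ys)" "wm B = wcls ys" "length ys = qf_dim B"
    using obtain_diag[OF two B] .
  have "isometric xs ys" using xs ys assms(4,5) by (intro isometric_if_wcls_eq[OF two]) auto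
  then show ?thesis using misom_imp_qf_isometric'[OF A B ys(1) xs(2) _ ys(2)] by blast
qed

lemma witt_equiv_iff:
  assumes two: "(2::'a::field) \<noteq> 0" and A: "is_qform (A :: 'a mat)" and B: "is_qform B"
  shows "witt_equiv A B \<longleftrightarrow> wm A = wm B"
proof
  note h = wm_hyperbolic[OF two]
  assume "witt_equiv A B"
  then obtain k l where "qf_isometric (orth_sum A (hyperbolic k)) (orth_sum B (hyperbolic l))"
    unfolding witt_equiv_def by blast
  then have "wm (orth_sum A (hyperbolic k)) = wm (orth_sum B (hyperbolic l))"
    using qf_isometric_wm[OF two qform_orth_sum[OF two A h(1)] qform_orth_sum[OF two B h(1)]] by blast
  then show "wm A = wm B" by (simp add: wm_orth_sum[OF two A h(1)] wm_orth_sum[OF two B h(1)] h(2))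
next
  note h = wm_hyperbolic[OF two]
  assume eq: "wm A = wm B"
  obtain xs where xs: "0 \<notin> set xs" "misom A (dm xs)" "wm A = wcls xs" using obtain_diag[OF two A] .
  obtain ys where ys: "0 \<notin> set ys" "misom B (dm ys)" "wm B = wcls ys" using obtain_diag[OF two B] .
  obtain k l where kl: "isometric (xs @ hyp k) (ys @ hyp l)"
    using wcls_eq_imp_isometric_hyp[OF two, of xs ys] xs ys eq by auto
  have "0 \<notin> set (ys @ hyp l)" using ys(1) by simp
  from misom_imp_qf_isometric'[OF qform_orth_sum[OF two A h(1)] qform_orth_sum[OF two B h(1)] this
      misom_orth_sum[OF qform_carrier[OF A] hyperbolic_carrier xs(2) misom_hyperbolic[OF two]] kl
      misom_orth_sum[OF qform_carrier[OF B] hyperbolic_carrier ys(2) misom_hyperbolic[OF two]]]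
  show "witt_equiv A B" unfolding witt_equiv_def by blast
qed

text \<open>For 2 nonzero this is the isomorphism from the ring \<open>'a witt\<close> onto
  \<open>witt_ring\<close>.\<close>

definition wset :: "'a::field witt \<Rightarrow> 'a mat set" where
  "wset x = {A. is_qform A \<and> wm A = x}"

context
  assumes two: "(2::'a::field) \<noteq> 0"
begin

lemma witt_class_eq: "is_qform A \<Longrightarrow> witt_class A = wset (wm A)" for A :: "'a mat"
  unfolding witt_class_def wset_def using witt_equiv_iff[OF two] by auto

lemma wset_rep: "0 \<notin> set xs \<Longrightarrow> dm xs \<in> wset (wcls xs)" for xs :: "'a list"
  by (simp add: wset_def qform_dm wm_dm[OF two])

lemma wset_nonempty: "\<exists>A. A \<in> wset x" for x :: "'a witt"
proof -
  obtain xs where "0 \<notin> set xs" "x = wcls xs" using wcls_nonzero_rep by blast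
  then show ?thesis using wset_rep by blast
qed

lemma wset_inj: "wset x = wset y \<Longrightarrow> x = y" for x y :: "'a witt"
proof -
  assume eq: "wset x = wset y"
  obtain A where "A \<in> wset x" using wset_nonempty by blast
  then show ?thesis using eq by (auto simp: wset_def)
qed

section \<open>Transfer of the ring operations and of the ideal powers\<close>

lemma carrier_witt_ring: "carrier (witt_ring :: 'a mat set ring) = range wset"
proof -
  have "wset x \<in> {witt_class A | A. is_qform A}" for x :: "'a witt"
  proof -
    obtain A where "A \<in> wset x" using wset_nonempty by blast
    then have "is_qform A" "wset x = witt_class A" using witt_class_eq by (auto simp: wset_def)
    then show ?thesis by blast
  qed
  then show ?thesis by (auto simp: witt_ring_def witt_class_eq)
qed

lemma witt_ring_add: "wset x \<oplus>\<^bsub>witt_ring\<^esub> wset y = wset (x + y)" for x y :: "'a witt"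
proof -
  have "witt_class (orth_sum A B) = wset (x + y)" if "A \<in> wset x" "B \<in> wset y" for A B
    using that witt_class_eq[OF qform_orth_sum[OF two]] wm_orth_sum[OF two] by (simp add: wset_def)
  then have "(\<Union>A\<in>wset x. \<Union>B\<in>wset y. witt_class (orth_sum A B)) = (\<Union>A\<in>wset x. \<Union>B\<in>wset y. wset (x + y))"
    by simp
  also have "\<dots> = wset (x + y)" using wset_nonempty[of x] wset_nonempty[of y] by auto
  finally show ?thesis by (simp add: witt_ring_def)
qed

lemma witt_ring_mult: "wset x \<otimes>\<^bsub>witt_ring\<^esub> wset y = wset (x * y)" for x y :: "'a witt"
proof -
  have "witt_class (qf_tensor A B) = wset (x * y)" if "A \<in> wset x" "B \<in> wset y" for A B
    using that witt_class_eq[OF qform_tensor[OF two]] wm_tensor[OF two] by (simp add: wset_def)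
  then have "(\<Union>A\<in>wset x. \<Union>B\<in>wset y. witt_class (qf_tensor A B)) = (\<Union>A\<in>wset x. \<Union>B\<in>wset y. wset (x * y))"
    by simp
  also have "\<dots> = wset (x * y)" using wset_nonempty[of x] wset_nonempty[of y] by auto
  finally show ?thesis by (simp add: witt_ring_def)
qed

lemma witt_ring_zero: "\<zero>\<^bsub>witt_ring\<^esub> = wset (0 :: 'a witt)"
proof -
  have "(0\<^sub>m 0 0 :: 'a mat) = dm []" by (rule eq_matI) auto
  then show ?thesis
    using witt_class_eq[OF qform_dm[of "[]"]] wm_dm[OF two, of "[]"] by (simp add: witt_ring_def)
qed

lemma witt_ring_minus: "wset x \<ominus>\<^bsub>witt_ring\<^esub> wset y = wset (x - y)" for x y :: "'a witt"
proof -
  have "\<ominus>\<^bsub>witt_ring\<^esub> wset y = wset (- y)"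
    \<comment> \<open>The additive inverse is a definite description; its uniqueness comes from the
      injectivity of \<open>wset\<close>.\<close>
    unfolding a_inv_def m_inv_def
  proof (rule the_equality)
    fix z assume "z \<in> carrier (add_monoid witt_ring) \<and> wset y \<otimes>\<^bsub>add_monoid witt_ring\<^esub> z = \<one>\<^bsub>add_monoid witt_ring\<^esub> \<and>
      z \<otimes>\<^bsub>add_monoid witt_ring\<^esub> wset y = \<one>\<^bsub>add_monoid witt_ring\<^esub>"
    then obtain u where u: "z = wset u" "wset (y + u) = wset 0"
      by (auto simp: carrier_witt_ring witt_ring_add witt_ring_zero)
    then have "y + u = 0" using wset_inj by blast
    then have "u = - y" by (simp add: eq_neg_iff_add_eq_0 add.commute)
    then show "z = wset (- y)" using u by simp
  qed (simp add: carrier_witt_ring witt_ring_add witt_ring_zero)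
  then show ?thesis by (simp add: a_minus_def witt_ring_add)
qed

lemma fundamental_ideal_eq: "fundamental_ideal = wset ` (IW 1 :: 'a witt set)"
proof (intro equalityI subsetI)
  fix X :: "'a mat set" assume "X \<in> fundamental_ideal"
  then obtain A where A: "X = witt_class A" "is_qform A" "even (qf_dim A)"
    unfolding fundamental_ideal_def by blast
  obtain xs where xs: "0 \<notin> set xs" "wm A = wcls xs" "length xs = qf_dim A" using obtain_diag[OF two A(2)] .
  then have "wm A \<in> IW 1" using wcls_even_IW1[OF xs(1)] A(3) by simp
  then show "X \<in> wset ` IW 1" using A witt_class_eq by blast
next
  fix X :: "'a mat set" assume "X \<in> wset ` IW 1"
  then obtain x where x: "x \<in> IW 1" "X = wset x" by blast
  obtain xs where xs: "0 \<notin> set xs" "even (length xs)" "wcls xs = x" using IW1_even[OF x(1)] by blast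
  have "X = witt_class (dm xs)" using witt_class_eq[OF qform_dm[OF xs(1)]] wm_dm[OF two xs(1)] x xs by simp
  moreover have "is_qform (dm xs)" "even (qf_dim (dm xs))" using xs by (simp_all add: qform_dm qf_dim_def)
  ultimately show "X \<in> fundamental_ideal" unfolding fundamental_ideal_def by blast
qed

text \<open>An (m + 1)-fold Pfister form is an m-fold one times \<open>1 - rk a\<close>; conversely
  \<open>IW_mult_IW1\<close> handles the products that generate the ideal product.\<close>

lemma fundamental_ideal_power_eq: "fundamental_ideal_power m = wset ` (IW m :: 'a witt set)"
proof (induct m)
  case 0
  then show ?case by (simp add: carrier_witt_ring)
next
  case (Suc m)
  have "ideal_prod witt_ring (wset ` IW m) (wset ` IW 1) = wset ` (IW (Suc m) :: 'a witt set)"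
  proof (intro equalityI subsetI)
    fix X :: "'a mat set" assume "X \<in> ideal_prod witt_ring (wset ` IW m) (wset ` IW 1)"
    then show "X \<in> wset ` IW (Suc m)"
    proof (induct rule: ideal_prod.induct)
      case (prod i j)
      then obtain x y where "i = wset x" "x \<in> IW m" "j = wset y" "y \<in> IW 1" by blast
      then show ?case using IW_mult_IW1[of y x m] by (simp add: witt_ring_mult)
    next
      case (sum s1 s2)
      then show ?case by (auto simp: witt_ring_add intro: IW_add)
    qed
  next
    fix X :: "'a mat set" assume "X \<in> wset ` IW (Suc m)"
    then obtain x where x: "X = wset x" "x \<in> IW (Suc m)" by blast
    have prod: "wset (y * z) \<in> ideal_prod witt_ring (wset ` IW m) (wset ` IW 1)"
      if "y \<in> IW m" "z \<in> IW 1" for y z :: "'a witt"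
      using ideal_prod.prod[of "wset y" "wset ` IW m" "wset z" "wset ` IW 1" witt_ring] that
      by (simp add: witt_ring_mult)
    have "wset x \<in> ideal_prod witt_ring (wset ` IW m) (wset ` IW 1)" using x(2)
    proof (induct rule: IW_induct)
      case zero
      show ?case using prod[of 0 0] by simp
    next
      case (add b as x)
      obtain a as' where as: "as = a # as'" using add(2) by (cases as) auto
      have 1: "rk b * pf as' \<in> IW m" using add(1,2,3) as by (intro IW_pf) auto
      have 2: "1 - rk a \<in> IW 1" using IW_pf[of 1 "[a]" 1] add(3) as by simp
      have "rk b * pf as' * (1 - rk a) = rk b * pf as" using as by (simp add: ac_simps)
      then have "wset (rk b * pf as) \<in> ideal_prod witt_ring (wset ` IW m) (wset ` IW 1)"
        using prod[OF 1 2] by simp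
      from ideal_prod.sum[OF this add(5)] show ?case by (simp add: witt_ring_add)
    qed
    then show "X \<in> ideal_prod witt_ring (wset ` IW m) (wset ` IW 1)" using x by simp
  qed
  then show ?case using Suc by (simp add: fundamental_ideal_eq)
qed

lemma witt_class_power_iff:
  "is_qform A \<Longrightarrow> witt_class A \<in> fundamental_ideal_power m \<longleftrightarrow> wm A \<in> IW m" for A :: "'a mat"
  using wset_inj by (auto simp: fundamental_ideal_power_eq witt_class_eq)

lemma witt_class_minus_power_iff:
  "is_qform A \<Longrightarrow> is_qform B \<Longrightarrow>
    witt_class A \<ominus>\<^bsub>witt_ring\<^esub> witt_class B \<in> fundamental_ideal_power m \<longleftrightarrow> wm A - wm B \<in> IW m" for A B :: "'a mat"
  using wset_inj by (auto simp: fundamental_ideal_power_eq witt_class_eq witt_ring_minus)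

section \<open>Similarity and the property Sim for matrices\<close>

lemma smult_qform:
  assumes A: "is_qform (A :: 'a mat)" and c: "c \<noteq> 0"
  shows "is_qform (c \<cdot>\<^sub>m A)" and "wm (c \<cdot>\<^sub>m A) = rk c * wm A"
proof -
  obtain xs where xs: "0 \<notin> set xs" "misom A (dm xs)" "wm A = wcls xs" using obtain_diag[OF two A] .
  obtain T where T: "\<And>v w. bm A (T v) (T w) = bf xs v w" and len: "dim_row A = length xs"
    using xs(2) unfolding misom_def by auto
  obtain n where n: "dim_row A = n" by blast
  have An: "A \<in> carrier_mat n n" using A unfolding is_qform_def n[symmetric] by (intro carrier_matI) auto
  have bm: "bm (c \<cdot>\<^sub>m A) v w = c * bm A v w" for v w
    using An by (simp add: bm_def sum_distrib_left algebra_simps)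
  have m: "misom (c \<cdot>\<^sub>m A) (dm (map ((*) c) xs))"
    using len unfolding misom_def by (intro conjI exI[of _ T]) (simp_all add: bm T bf_map_mult)
  have nz: "0 \<notin> set (map ((*) c) xs)" using xs(1) c by auto
  have "A\<^sup>T = A" using A by (simp add: is_qform_def)
  then have sym: "A $$ (i, j) = A $$ (j, i)" if "i < n" "j < n" for i j
    using index_transpose_mat(1)[of j A i] An that by auto
  have "(c \<cdot>\<^sub>m A)\<^sup>T = c \<cdot>\<^sub>m A"
    using An by (intro eq_matI) (auto simp: sym)
  then show q: "is_qform (c \<cdot>\<^sub>m A)" using An by (intro is_qformI[OF _ _ m nz]) auto
  show "wm (c \<cdot>\<^sub>m A) = rk c * wm A" using wm_eq[OF two q nz m] xs by (simp add: wcls_map_mult)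
qed

lemma qf_similarI:
  assumes A: "is_qform (A :: 'a mat)" and B: "is_qform B" and "qf_dim A = qf_dim B"
    and c: "c \<noteq> 0" "wm B = rk c * wm A"
  shows "qf_similar A B"
proof -
  have "qf_isometric B (c \<cdot>\<^sub>m A)"
    using assms(3) c smult_qform(2)[OF A c(1)]
    by (intro wm_eq_imp_qf_isometric[OF two B smult_qform(1)[OF A c(1)]]) (auto simp: qf_dim_def)
  then show ?thesis using c(1) unfolding qf_similar_def by blast
qed

lemma qf_similar_wm:
  assumes A: "is_qform (A :: 'a mat)" and B: "is_qform B" and "qf_similar A B"
  shows "\<exists>c. c \<noteq> 0 \<and> wm B = rk c * wm A"
proof -
  obtain c where c: "c \<noteq> 0" "qf_isometric B (c \<cdot>\<^sub>m A)" using assms(3) unfolding qf_similar_def by blast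
  then show ?thesis using qf_isometric_wm[OF two B smult_qform(1)[OF A c(1)]] smult_qform(2)[OF A c(1)] by auto
qed

lemma has_Sim_iff: "has_Sim TYPE('a) m \<longleftrightarrow> sim_diag TYPE('a) m"
proof
  assume sim: "has_Sim TYPE('a) m"
  show "sim_diag TYPE('a) m" unfolding sim_diag_def
  proof (intro allI impI, elim conjE)
    fix xs ys :: "'a list"
    assume a: "xs \<noteq> []" "ys \<noteq> []" "anis xs" "anis ys" "length xs \<le> 2 ^ m + 2 ^ (m - 1)"
      "length ys \<le> 2 ^ m + 2 ^ (m - 1)" "wcls xs \<in> IW m" "wcls ys \<in> IW m" "wcls xs - wcls ys \<in> IW (m + 1)"
    have nz: "0 \<notin> set xs" "0 \<notin> set ys" using a(3,4) by (auto dest: anis_nonzero)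
    note q = qform_dm[OF nz(1)] qform_dm[OF nz(2)]
    have w: "wm (dm xs) = wcls xs" "wm (dm ys) = wcls ys" using wm_dm[OF two] nz by auto
    have an: "anisotropic (dm xs)" "anisotropic (dm ys)"
      using anisotropic_iff[OF q(1) nz(1)] anisotropic_iff[OF q(2) nz(2)] a(3,4) by (auto simp: misom_dm)
    have "qf_similar (dm xs) (dm ys)"
      using a by (intro sim[unfolded has_Sim_def, rule_format])
        (simp add: q an witt_class_power_iff witt_class_minus_power_iff w qf_dim_def
          del: fundamental_ideal_power.simps)
    from qf_similar_wm[OF q this] show "\<exists>c. c \<noteq> 0 \<and> wcls ys = rk c * wcls xs" unfolding w .
  qed
next
  assume sim: "sim_diag TYPE('a) m"
  show "has_Sim TYPE('a) m" unfolding has_Sim_def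
  proof (intro allI impI, elim conjE)
    fix A B :: "'a mat"
    assume q: "is_qform A" "is_qform B" and d: "qf_dim A \<noteq> 0" "qf_dim B \<noteq> 0"
      and an: "anisotropic A" "anisotropic B"
      and le: "qf_dim A \<le> 2 ^ m + 2 ^ (m - 1)" "qf_dim B \<le> 2 ^ m + 2 ^ (m - 1)"
      and I: "witt_class A \<in> fundamental_ideal_power m" "witt_class B \<in> fundamental_ideal_power m"
        "witt_class A \<ominus>\<^bsub>witt_ring\<^esub> witt_class B \<in> fundamental_ideal_power (m + 1)"
    obtain xs where xs: "0 \<notin> set xs" "misom A (dm xs)" "wm A = wcls xs" "length xs = qf_dim A"
      using obtain_diag[OF two q(1)] .
    obtain ys where ys: "0 \<notin> set ys" "misom B (dm ys)" "wm B = wcls ys" "length ys = qf_dim B"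
      using obtain_diag[OF two q(2)] .
    have anis: "anis xs" "anis ys"
      using anisotropic_iff[OF q(1) xs(1,2)] anisotropic_iff[OF q(2) ys(1,2)] an by auto
    have IW: "wcls xs \<in> IW m" "wcls ys \<in> IW m" "wcls xs - wcls ys \<in> IW (Suc m)"
      using I witt_class_power_iff[OF q(1)] witt_class_power_iff[OF q(2)]
        witt_class_minus_power_iff[OF q] xs(3) ys(3)
      by (simp_all del: fundamental_ideal_power.simps)
    have ne: "xs \<noteq> []" "ys \<noteq> []" using d xs(4) ys(4) by auto
    obtain c where c: "c \<noteq> 0" "wcls ys = rk c * wcls xs"
      using sim_diagD[OF sim ne anis _ _ IW] le xs(4) ys(4) by auto
    have "qf_dim A = qf_dim B" using similar_length[OF two anis c] xs(4) ys(4) by simp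
    from qf_similarI[OF q this c(1)] show "qf_similar A B" using c(2) xs(3) ys(3) by simp
  qed
qed

end

lemma two_nonzero: "CHAR('a::field) \<noteq> 2 \<Longrightarrow> (2::'a) \<noteq> 0"
proof
  assume c: "CHAR('a) \<noteq> 2" and "(2::'a) = 0"
  then have "of_nat 2 = (0::'a)" by simp
  then have "CHAR('a) dvd 2" by (simp only: of_nat_eq_0_iff_char_dvd)
  then have "CHAR('a) \<le> 2" by (rule dvd_imp_le) simp
  moreover have "CHAR('a) \<noteq> 1" by simp
  moreover have "CHAR('a) \<noteq> 0" using \<open>CHAR('a) dvd 2\<close> by (metis dvd_0_left_iff zero_neq_numeral)
  ultimately show False using c by linarith
qed

theorem theorem5p5:
  fixes R :: "'k::field set" and res :: "'k \<Rightarrow> 'f::field" and n :: nat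
  assumes "CHAR('k) \<noteq> 2" and "CHAR('f) \<noteq> 2"
    and "DVR R" and "residue_map R res" and "two_henselian R res"
    and "n \<ge> 3"
    and "has_Sim TYPE('f) (n - 1)" and "has_Sim TYPE('f) n"
  shows "has_Sim TYPE('k) n"
proof -
  obtain v where v: "discrete_valuation v" "R = {x. x = 0 \<or> 0 \<le> v x}"
    using assms(3) unfolding DVR_def by blast
  interpret henselian_dvr R v res
    using v assms two_nonzero[where 'a='k] two_nonzero[where 'a='f] by unfold_locales auto
  obtain m where m: "n = Suc m" "m \<ge> 1" using assms(6) by (cases n) auto
  have "sim_diag TYPE('f) m" "sim_diag TYPE('f) (Suc m)"
    using assms(7,8) m(1) has_Sim_iff[OF two_f] by auto
  from sim_diag_lift[OF m(2) this] show ?thesis using m(1) has_Sim_iff[OF two_k] by simp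
qed

end
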